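(* Let $R$ be a commutative Noetherian local ring and let $M$ be a finitely generated $R$-module. If $\operatorname{qpd}_R M<\infty$, then $$\operatorname{qpd}_R M=\operatorname{depth} R-\operatorname{depth}_R M.$$
   Context: For a complex $X=(\cdots\to X_{i+1}\to X_i\to X_{i-1}\to\cdots)$ of $R$-modules put $\sup X=\sup\{i: X_i\neq 0\}$, $\inf X=\inf\{i: X_i\neq0\}$ and $\operatorname{hsup}X=\sup\{i: H_i(X)\neq0\}$. A quasi-projective resolution of an $R$-module $M$ is a bounded below complex $P$ of projective $R$-modules such that for all $i\ge\inf P$ there are integers $a_i\ge0$, not all zero, with $H_i(P)\cong M^{\oplus a_i}$; it is finite if $P$ is bounded. The quasi-projective dimension of $M\ne0$ is $\operatorname{qpd}_RM=\inf\{\sup P-\operatorname{hsup}P : P \text{ a finite quasi-projective resolution of } M\}$ (so $=\infty$ if there is no finite quasi-projective resolution), and $\operatorname{qpd}_R 0=-\infty$. The notation $\operatorname{qpd}_RM<\infty$ includes the case $-\infty$; the zero module has depth $\infty$. *)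

theory Defs
  imports "HOL-Library.Extended_Real" "HOL-Algebra.Module" "HOL-Algebra.Ring_Divisibility"
begin

definition local_ring :: "('a, 'r) ring_scheme \<Rightarrow> bool" where
  "local_ring R \<longleftrightarrow> cring R \<and> (\<exists>!I. maximalideal I R)"

definition max_ideal :: "('a, 'r) ring_scheme \<Rightarrow> 'a set" where
  "max_ideal R = (THE I. maximalideal I R)"


section \<open>Modules\<close>

text \<open>
  The record type of modules extends the one of rings, so it has fields \<open>mult\<close> and \<open>one\<close>.
  The locale \<^locale>\<open>module\<close> and all definitions below ignore them; where a module is built
  from scratch they are filled with arbitrary values.
\<close>

definition zero_module :: "('a, 'b, 'c) module_scheme \<Rightarrow> bool" where
  "zero_module M \<longleftrightarrow> carrier M = {\<zero>\<^bsub>M\<^esub>}"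

definition ring_as_module :: "('a, 'r) ring_scheme \<Rightarrow> ('a, 'a) module" where
  "ring_as_module R =
    \<lparr>carrier = carrier R, monoid.mult = monoid.mult R, one = one R, ring.zero = ring.zero R, add = add R, smult = monoid.mult R\<rparr>"

definition module_homs ::
    "('a, 'r) ring_scheme \<Rightarrow> ('a, 'b, 'd) module_scheme \<Rightarrow> ('a, 'c, 'e) module_scheme
      \<Rightarrow> ('b \<Rightarrow> 'c) set" where
  "module_homs R M N =
    {f \<in> carrier M \<rightarrow> carrier N.
      (\<forall>x\<in>carrier M. \<forall>y\<in>carrier M. f (x \<oplus>\<^bsub>M\<^esub> y) = f x \<oplus>\<^bsub>N\<^esub> f y) \<and>
      (\<forall>r\<in>carrier R. \<forall>x\<in>carrier M. f (r \<odot>\<^bsub>M\<^esub> x) = r \<odot>\<^bsub>N\<^esub> f x)}"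

definition module_iso ::
    "('a, 'r) ring_scheme \<Rightarrow> ('a, 'b, 'd) module_scheme \<Rightarrow> ('a, 'c, 'e) module_scheme \<Rightarrow> bool" where
  "module_iso R M N \<longleftrightarrow> (\<exists>f\<in>module_homs R M N. bij_betw f (carrier M) (carrier N))"

definition generated_submodule ::
    "('a, 'r) ring_scheme \<Rightarrow> ('a, 'b, 'd) module_scheme \<Rightarrow> 'b set \<Rightarrow> 'b set" where
  "generated_submodule R M S = \<Inter>{N. submodule N R M \<and> S \<subseteq> N}"

definition finitely_generated ::
    "('a, 'r) ring_scheme \<Rightarrow> ('a, 'b, 'd) module_scheme \<Rightarrow> bool" where
  "finitely_generated R M \<longleftrightarrow>
    (\<exists>S. finite S \<and> S \<subseteq> carrier M \<and> generated_submodule R M S = carrier M)"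

text \<open>
  The scalar action on cosets is \<open>r (N + x) = N + r x\<close>; the union in \<open>smult\<close> is over
  sets that all coincide when \<open>N\<close> is a submodule.
\<close>

definition quotient_module ::
    "('a, 'b, 'd) module_scheme \<Rightarrow> 'b set \<Rightarrow> ('a, 'b set) module" where
  "quotient_module M N =
    \<lparr>carrier = a_rcosets\<^bsub>M\<^esub> N, monoid.mult = undefined, one = undefined, ring.zero = N, add = set_add M,
     smult = (\<lambda>r C. \<Union>x\<in>C. N +>\<^bsub>M\<^esub> (r \<odot>\<^bsub>M\<^esub> x))\<rparr>"

text \<open>The direct sum of \<open>n\<close> copies of \<open>M\<close>, as \<open>n\<close>-tuples indexed by \<open>{..<n}\<close>.\<close>

definition direct_power ::
    "('a, 'b, 'd) module_scheme \<Rightarrow> nat \<Rightarrow> ('a, nat \<Rightarrow> 'b) module" where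
  "direct_power M n =
    \<lparr>carrier = {..<n} \<rightarrow>\<^sub>E carrier M, monoid.mult = undefined, one = undefined,
     ring.zero = (\<lambda>i\<in>{..<n}. \<zero>\<^bsub>M\<^esub>),
     add = (\<lambda>f g. \<lambda>i\<in>{..<n}. f i \<oplus>\<^bsub>M\<^esub> g i),
     smult = (\<lambda>r f. \<lambda>i\<in>{..<n}. r \<odot>\<^bsub>M\<^esub> f i)\<rparr>"

text \<open>The free module on a (possibly infinite) set \<open>B\<close>: finitely supported functions on \<open>B\<close>.\<close>

definition free_module :: "('a, 'r) ring_scheme \<Rightarrow> 'b set \<Rightarrow> ('a, 'b \<Rightarrow> 'a) module" where
  "free_module R B =
    \<lparr>carrier = {f \<in> B \<rightarrow>\<^sub>E carrier R. finite {b \<in> B. f b \<noteq> \<zero>\<^bsub>R\<^esub>}},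
     monoid.mult = undefined, one = undefined,
     ring.zero = (\<lambda>b\<in>B. \<zero>\<^bsub>R\<^esub>),
     add = (\<lambda>f g. \<lambda>b\<in>B. f b \<oplus>\<^bsub>R\<^esub> g b),
     smult = (\<lambda>r f. \<lambda>b\<in>B. r \<otimes>\<^bsub>R\<^esub> f b)\<rparr>"

text \<open>
  A module is projective if it is (isomorphic to) a direct summand of a free module, i.e. if
  there are homomorphisms \<open>s : P \<rightarrow> F\<close> and \<open>p : F \<rightarrow> P\<close> with \<open>F\<close> free and \<open>p s = id\<close>.
  Taking the basis \<open>B\<close> of \<open>F\<close> inside the type of \<open>P\<close> is no restriction: if \<open>P\<close> is a direct
  summand of any free module, then the canonical surjection from the free module
  on the set \<open>carrier P\<close> onto \<open>P\<close> splits.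
\<close>

definition projective_module ::
    "('a, 'r) ring_scheme \<Rightarrow> ('a, 'b, 'd) module_scheme \<Rightarrow> bool" where
  "projective_module R P \<longleftrightarrow>
    module R P \<and>
    (\<exists>B :: 'b set. \<exists>s\<in>module_homs R P (free_module R B). \<exists>p\<in>module_homs R (free_module R B) P.
      \<forall>x\<in>carrier P. p (s x) = x)"


section \<open>Depth\<close>

definition nonzerodivisor_on :: "('a, 'b, 'd) module_scheme \<Rightarrow> 'a \<Rightarrow> bool" where
  "nonzerodivisor_on M r \<longleftrightarrow> (\<forall>x\<in>carrier M. r \<odot>\<^bsub>M\<^esub> x = \<zero>\<^bsub>M\<^esub> \<longrightarrow> x = \<zero>\<^bsub>M\<^esub>)"

text \<open>\<open>M / (rs) M\<close>\<close>

definition quotient_by_elements ::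
    "('a, 'r) ring_scheme \<Rightarrow> ('a, 'b, 'd) module_scheme \<Rightarrow> 'a list \<Rightarrow> ('a, 'b set) module" where
  "quotient_by_elements R M rs =
    quotient_module M (generated_submodule R M {r \<odot>\<^bsub>M\<^esub> x | r x. r \<in> set rs \<and> x \<in> carrier M})"

definition regular_sequence ::
    "('a, 'r) ring_scheme \<Rightarrow> ('a, 'b, 'd) module_scheme \<Rightarrow> 'a list \<Rightarrow> bool" where
  "regular_sequence R M rs \<longleftrightarrow>
    set rs \<subseteq> carrier R \<and>
    (\<forall>i<length rs. nonzerodivisor_on (quotient_by_elements R M (take i rs)) (rs ! i)) \<and>
    \<not> zero_module (quotient_by_elements R M rs)"

text \<open>
  For a finitely generated module over a Noetherian local ring: the supremum of the lengths
  of regular sequences in the maximal ideal; the zero module has depth \<open>\<infinity>\<close>.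
\<close>

definition depth ::
    "('a, 'r) ring_scheme \<Rightarrow> ('a, 'b, 'd) module_scheme \<Rightarrow> ereal" where
  "depth R M =
    (if zero_module M then \<infinity>
     else Sup {ereal (real (length rs)) | rs. regular_sequence R M rs \<and> set rs \<subseteq> max_ideal R})"


section \<open>Complexes and quasi-projective dimension\<close>

record ('a, 'p) complex_data =
  obj :: "int \<Rightarrow> ('a, 'p) module"
  differential :: "int \<Rightarrow> 'p \<Rightarrow> 'p"

text \<open>Homological indexing: \<open>differential C i\<close> maps \<open>obj C i\<close> to \<open>obj C (i - 1)\<close>.\<close>

definition is_complex :: "('a, 'r) ring_scheme \<Rightarrow> ('a, 'p) complex_data \<Rightarrow> bool" where
  "is_complex R C \<longleftrightarrow>
    (\<forall>i. module R (obj C i)) \<and>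
    (\<forall>i. differential C i \<in> module_homs R (obj C i) (obj C (i - 1))) \<and>
    (\<forall>i. \<forall>x\<in>carrier (obj C (i + 1)). differential C i (differential C (i + 1) x) = \<zero>\<^bsub>obj C (i - 1)\<^esub>)"

definition homology :: "('a, 'p) complex_data \<Rightarrow> int \<Rightarrow> ('a, 'p set) module" where
  "homology C i =
    quotient_module
      ((obj C i)\<lparr>carrier := a_kernel (obj C i) (obj C (i - 1)) (differential C i)\<rparr>)
      (differential C (i + 1) ` carrier (obj C (i + 1)))"

text \<open>Suprema and infima are taken in \<^typ>\<open>ereal\<close>, so \<open>sup = -\<infinity>\<close> and \<open>inf = \<infinity>\<close> for the zero complex.\<close>

definition csup :: "('a, 'p) complex_data \<Rightarrow> ereal" where
  "csup C = Sup {ereal (real_of_int i) | i. \<not> zero_module (obj C i)}"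

definition cinf :: "('a, 'p) complex_data \<Rightarrow> ereal" where
  "cinf C = Inf {ereal (real_of_int i) | i. \<not> zero_module (obj C i)}"

definition hsup :: "('a, 'p) complex_data \<Rightarrow> ereal" where
  "hsup C = Sup {ereal (real_of_int i) | i. \<not> zero_module (homology C i)}"

definition bounded_below :: "('a, 'p) complex_data \<Rightarrow> bool" where
  "bounded_below C \<longleftrightarrow> (\<exists>l. \<forall>i<l. zero_module (obj C i))"

definition bounded_above :: "('a, 'p) complex_data \<Rightarrow> bool" where
  "bounded_above C \<longleftrightarrow> (\<exists>u. \<forall>i>u. zero_module (obj C i))"

definition quasi_projective_resolution ::
    "('a, 'r) ring_scheme \<Rightarrow> ('a, 'b, 'd) module_scheme \<Rightarrow> ('a, 'p) complex_data \<Rightarrow> bool" where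
  "quasi_projective_resolution R M P \<longleftrightarrow>
    is_complex R P \<and> bounded_below P \<and> (\<forall>i. projective_module R (obj P i)) \<and>
    (\<exists>a :: int \<Rightarrow> nat.
      (\<forall>i. cinf P \<le> ereal (real_of_int i) \<longrightarrow> module_iso R (homology P i) (direct_power M (a i))) \<and>
      (\<exists>i. cinf P \<le> ereal (real_of_int i) \<and> a i \<noteq> 0))"

definition finite_quasi_projective_resolution ::
    "('a, 'r) ring_scheme \<Rightarrow> ('a, 'b, 'd) module_scheme \<Rightarrow> ('a, 'p) complex_data \<Rightarrow> bool" where
  "finite_quasi_projective_resolution R M P \<longleftrightarrow>
    quasi_projective_resolution R M P \<and> bounded_above P"

text \<open>
  The type \<open>'p\<close> is the universe in which the modules of the resolutions live. The
  infimum is over integers, hence attained by a single complex whenever it is finite, so for a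
  large enough \<open>'p\<close> it is the infimum over all finite quasi-projective resolutions.
\<close>

definition qpd ::
    "('a, 'r) ring_scheme \<Rightarrow> ('a, 'b, 'd) module_scheme \<Rightarrow> 'p itself \<Rightarrow> ereal" where
  "qpd R M (_ :: 'p itself) =
    (if zero_module M then - \<infinity>
     else Inf {csup P - hsup P | P :: ('a, 'p) complex_data.
                 finite_quasi_projective_resolution R M P})"

end

theory Submission
  imports Defs
begin

text \<open>
  The rank of the modules in a quasi-projective resolution is arbitrary, so the Auslander-Buchsbaum
  formula cannot be used for the syzygies of the resolution.  Instead, let \<open>x\<^sub>1, \<dots>, x\<^sub>n\<close> generate the
  maximal ideal and let \<open>H\<^sup>p\<close> be Koszul cohomology: \<open>depth M\<close> is the least \<open>p\<close> with \<open>H\<^sup>p(M) \<noteq> 0\<close>.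
  Let \<open>P\<close> be a resolution with \<open>sup P = c\<close> and \<open>hsup P = s\<close>, and write \<open>r = depth R\<close>, \<open>e = depth M\<close>.
  In the double complex of Koszul cochains with values in \<open>P\<close> the rows are exact in degrees below \<open>r\<close>
  and the homology of the columns has vanishing Koszul cohomology in degrees below \<open>e\<close>.  A diagram
  chase starting from a nonzero class in \<open>H\<^sup>e(H\<^sub>s(P))\<close> gives \<open>r - e \<le> c - s\<close>.  If the inequality is
  strict, a second chase shows that \<open>H\<^sup>r(P\<^sub>c) \<rightarrow> H\<^sup>r(P\<^sub>c\<^sub>-\<^sub>1)\<close> is injective; since \<open>H\<^sup>r(R)\<close> is a nonzero
  vector space over the residue field, \<open>P\<^sub>c \<rightarrow> P\<^sub>c\<^sub>-\<^sub>1\<close> is injective modulo the maximal ideal.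
  As the homology is finitely generated, the identity of \<open>P\<close> is homotopic to maps with finitely
  generated image, which makes \<open>P\<^sub>c \<rightarrow> P\<^sub>c\<^sub>-\<^sub>1\<close> split.  Splitting it off decreases \<open>c\<close>, so for a
  resolution with minimal \<open>c - s\<close> equality holds.
\<close>

section \<open>Linear maps and generated submodules\<close>

text \<open>Injectivity modulo the maximal ideal does not split a map between free modules of
  infinite rank. Over a discrete valuation ring with uniformizer x, the map sending e_i to e_i - x
  e_(i+1) is the identity modulo x, yet its cokernel is the field of fractions, which is not
  projective. Finitely generated homology is what rules this out, and the retraction is therefore
  built in two pieces: the homotopy inverts the top differential up to an error with finitely
  generated image, and on that image linear algebra over the local ring finishes. Quotients such as
  M/(x_1, ..., x_i) and Z/B are treated as pairs of submodules of one fixed module, because genuine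
  quotients would change the type at every step of a regular sequence. In the same spirit a summand
  is split off by shrinking carriers: the shorter resolution then lives in the same type
  \<open>'p\<close>, the universe over which the infimum in \<open>qpd\<close> is taken.\<close>

lemma module_homsI:
  assumes "\<And>x. x \<in> carrier M \<Longrightarrow> f x \<in> carrier N"
    and "\<And>x y. x \<in> carrier M \<Longrightarrow> y \<in> carrier M \<Longrightarrow> f (x \<oplus>\<^bsub>M\<^esub> y) = f x \<oplus>\<^bsub>N\<^esub> f y"
    and "\<And>r x. r \<in> carrier R \<Longrightarrow> x \<in> carrier M \<Longrightarrow> f (r \<odot>\<^bsub>M\<^esub> x) = r \<odot>\<^bsub>N\<^esub> f x"
  shows "f \<in> module_homs R M N"
  using assms unfolding module_homs_def by auto

lemma module_homsD:
  assumes "f \<in> module_homs R M N"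
  shows "x \<in> carrier M \<Longrightarrow> f x \<in> carrier N"
    and "x \<in> carrier M \<Longrightarrow> y \<in> carrier M \<Longrightarrow> f (x \<oplus>\<^bsub>M\<^esub> y) = f x \<oplus>\<^bsub>N\<^esub> f y"
    and "r \<in> carrier R \<Longrightarrow> x \<in> carrier M \<Longrightarrow> f (r \<odot>\<^bsub>M\<^esub> x) = r \<odot>\<^bsub>N\<^esub> f x"
  using assms unfolding module_homs_def by auto

lemma module_minus_zero:
  assumes "module R M" "x \<in> carrier M"
  shows "x \<ominus>\<^bsub>M\<^esub> \<zero>\<^bsub>M\<^esub> = x"
proof -
  interpret M: module R M by fact
  have "\<ominus>\<^bsub>M\<^esub> \<zero>\<^bsub>M\<^esub> = \<zero>\<^bsub>M\<^esub>" by (rule M.minus_equality) auto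
  then show ?thesis using assms(2) by (simp add: a_minus_def)
qed

lemma module_homs_zero:
  assumes "module R M" "module R N" "f \<in> module_homs R M N"
  shows "f \<zero>\<^bsub>M\<^esub> = \<zero>\<^bsub>N\<^esub>"
proof -
  interpret M: module R M by fact
  interpret N: module R N by fact
  have "f (\<zero>\<^bsub>R\<^esub> \<odot>\<^bsub>M\<^esub> \<zero>\<^bsub>M\<^esub>) = \<zero>\<^bsub>R\<^esub> \<odot>\<^bsub>N\<^esub> f \<zero>\<^bsub>M\<^esub>"
    using module_homsD[OF assms(3)] by blast
  then show ?thesis
    using module_homsD(1)[OF assms(3)] by simp
qed

lemma module_homs_inv:
  assumes "module R M" "module R N" "f \<in> module_homs R M N" "x \<in> carrier M"
  shows "f (\<ominus>\<^bsub>M\<^esub> x) = \<ominus>\<^bsub>N\<^esub> f x"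
proof -
  interpret M: module R M by fact
  interpret N: module R N by fact
  note [simp] = module_homsD(1)[OF assms(3)]
  have "f (\<ominus>\<^bsub>M\<^esub> x) \<oplus>\<^bsub>N\<^esub> f x = \<zero>\<^bsub>N\<^esub>"
    using module_homsD(2)[OF assms(3), of "\<ominus>\<^bsub>M\<^esub> x" x] assms(4) module_homs_zero[OF assms(1-3)]
    by (simp add: M.l_neg)
  then show ?thesis
    using assms(4) by (simp add: N.minus_equality)
qed

lemma module_homs_minus:
  assumes "module R M" "module R N" "f \<in> module_homs R M N" "x \<in> carrier M" "y \<in> carrier M"
  shows "f (x \<ominus>\<^bsub>M\<^esub> y) = f x \<ominus>\<^bsub>N\<^esub> f y"
proof -
  interpret M: module R M by fact
  show ?thesis
    using assms by (simp add: a_minus_def module_homsD(2)[OF assms(3)] module_homs_inv)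
qed

lemma module_homs_compose:
  assumes "f \<in> module_homs R M N" "g \<in> module_homs R N L"
  shows "(\<lambda>x. g (f x)) \<in> module_homs R M L"
  using module_homsD[OF assms(1)] module_homsD[OF assms(2)] by (intro module_homsI) auto

lemma module_homs_add:
  assumes "module R M" "module R N" "f \<in> module_homs R M N" "g \<in> module_homs R M N"
  shows "(\<lambda>x. f x \<oplus>\<^bsub>N\<^esub> g x) \<in> module_homs R M N"
proof -
  interpret M: module R M by fact
  interpret N: module R N by fact
  note [simp] = module_homsD[OF assms(3)] module_homsD[OF assms(4)]
  show ?thesis
    by (intro module_homsI) (auto simp: N.smult_r_distr N.a_ac)
qed

lemma module_homs_diff:
  assumes "module R M" "module R N" "f \<in> module_homs R M N" "g \<in> module_homs R M N"
  shows "(\<lambda>x. f x \<ominus>\<^bsub>N\<^esub> g x) \<in> module_homs R M N"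
proof -
  interpret M: module R M by fact
  interpret N: module R N by fact
  note [simp] = module_homsD[OF assms(3)] module_homsD[OF assms(4)]
  show ?thesis
    by (intro module_homsI)
      (auto simp: N.smult_r_distr N.a_ac a_minus_def N.minus_add N.smult_r_minus)
qed

lemma module_homs_smult:
  assumes "module R M" "module R N" "f \<in> module_homs R M N" "r \<in> carrier R"
  shows "(\<lambda>x. r \<odot>\<^bsub>N\<^esub> f x) \<in> module_homs R M N"
proof -
  interpret M: module R M by fact
  interpret N: module R N by fact
  note [simp] = module_homsD[OF assms(3)]
  have "r \<odot>\<^bsub>N\<^esub> (a \<odot>\<^bsub>N\<^esub> f x) = a \<odot>\<^bsub>N\<^esub> (r \<odot>\<^bsub>N\<^esub> f x)" if "a \<in> carrier R" "x \<in> carrier M" for a x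
    using that assms(4) N.smult_assoc1[of r a "f x"] N.smult_assoc1[of a r "f x"]
    by (simp add: M.R.m_comm)
  then show ?thesis
    using assms(4) by (intro module_homsI) (auto simp: N.smult_r_distr)
qed

lemma module_homs_id: "(\<lambda>x. x) \<in> module_homs R M M"
  by (intro module_homsI) auto

lemma module_homs_const_zero:
  assumes "module R N"
  shows "(\<lambda>x. \<zero>\<^bsub>N\<^esub>) \<in> module_homs R M N"
proof -
  interpret N: module R N by fact
  show ?thesis by (intro module_homsI) auto
qed

text \<open>Negation is the action of the scalar -1, which yields the subgroup axiom on
  inverses.\<close>

lemma submodule_iff:
  assumes "module R M"
  shows "submodule H R M \<longleftrightarrow> H \<subseteq> carrier M \<and> \<zero>\<^bsub>M\<^esub> \<in> H \<and>
    (\<forall>x\<in>H. \<forall>y\<in>H. x \<oplus>\<^bsub>M\<^esub> y \<in> H) \<and> (\<forall>r\<in>carrier R. \<forall>x\<in>H. r \<odot>\<^bsub>M\<^esub> x \<in> H)"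
    (is "?L \<longleftrightarrow> ?R")
proof
  interpret M: module R M by fact
  show "?L \<Longrightarrow> ?R"
    using M.submoduleE[of H] submodule.axioms(1)[of H R M] subgroup.one_closed[of H "add_monoid M"]
    by auto
  assume R: ?R
  have "\<ominus>\<^bsub>M\<^esub> a \<in> H" if "a \<in> H" for a
  proof -
    have "(\<ominus>\<^bsub>R\<^esub> \<one>\<^bsub>R\<^esub>) \<odot>\<^bsub>M\<^esub> a \<in> H" using R that by blast
    moreover have "a \<in> carrier M" using R that by blast
    ultimately show ?thesis by (simp add: M.smult_l_minus)
  qed
  with R show ?L by (intro M.submoduleI) auto
qed

lemma submoduleD:
  assumes "module R M" "submodule H R M"
  shows "x \<in> H \<Longrightarrow> x \<in> carrier M"
    and "\<zero>\<^bsub>M\<^esub> \<in> H"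
    and "x \<in> H \<Longrightarrow> y \<in> H \<Longrightarrow> x \<oplus>\<^bsub>M\<^esub> y \<in> H"
    and "r \<in> carrier R \<Longrightarrow> x \<in> H \<Longrightarrow> r \<odot>\<^bsub>M\<^esub> x \<in> H"
    and "x \<in> H \<Longrightarrow> \<ominus>\<^bsub>M\<^esub> x \<in> H"
    and "x \<in> H \<Longrightarrow> y \<in> H \<Longrightarrow> x \<ominus>\<^bsub>M\<^esub> y \<in> H"
proof -
  interpret M: module R M by fact
  show "x \<in> H \<Longrightarrow> x \<in> carrier M"
    and "\<zero>\<^bsub>M\<^esub> \<in> H"
    and "x \<in> H \<Longrightarrow> y \<in> H \<Longrightarrow> x \<oplus>\<^bsub>M\<^esub> y \<in> H"
    and "r \<in> carrier R \<Longrightarrow> x \<in> H \<Longrightarrow> r \<odot>\<^bsub>M\<^esub> x \<in> H"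
    using assms(2) unfolding submodule_iff[OF assms(1)] by auto
  show "x \<in> H \<Longrightarrow> \<ominus>\<^bsub>M\<^esub> x \<in> H" for x using M.submoduleE[OF assms(2)] by auto
  then show "x \<in> H \<Longrightarrow> y \<in> H \<Longrightarrow> x \<ominus>\<^bsub>M\<^esub> y \<in> H"
    using M.submoduleE[OF assms(2)] by (simp add: a_minus_def)
qed

lemma submodule_zero:
  assumes "module R M"
  shows "submodule {\<zero>\<^bsub>M\<^esub>} R M"
proof -
  interpret M: module R M by fact
  show ?thesis unfolding submodule_iff[OF assms] by auto
qed

lemma submodule_carrier:
  assumes "module R M"
  shows "submodule (carrier M) R M"
  using module.carrier_is_submodule[OF assms] .

lemma submodule_image:
  assumes "module R M" "module R N" "f \<in> module_homs R M N" "submodule H R M"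
  shows "submodule (f ` H) R N"
proof -
  note h = module_homsD[OF assms(3)] and s = submoduleD[OF assms(1,4)]
  show ?thesis
    unfolding submodule_iff[OF assms(2)]
  proof (intro conjI ballI)
    show "f ` H \<subseteq> carrier N" using h(1) s(1) by auto
    show "\<zero>\<^bsub>N\<^esub> \<in> f ` H" using module_homs_zero[OF assms(1-3)] s(2) by (metis imageI)
    fix x y assume "x \<in> f ` H" "y \<in> f ` H"
    then show "x \<oplus>\<^bsub>N\<^esub> y \<in> f ` H" using h(2) s(1,3) by (auto simp: image_iff) metis
  next
    fix r x assume "r \<in> carrier R" "x \<in> f ` H"
    then show "r \<odot>\<^bsub>N\<^esub> x \<in> f ` H" using h(3) s(1,4) by (auto simp: image_iff) metis
  qed
qed

lemma submodule_vimage: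
  assumes "module R M" "module R N" "f \<in> module_homs R M N" "submodule H R N"
  shows "submodule {x \<in> carrier M. f x \<in> H} R M"
proof -
  interpret M: module R M by fact
  note h = module_homsD[OF assms(3)] module_homs_zero[OF assms(1-3)]
    and s = submoduleD[OF assms(2,4)]
  show ?thesis unfolding submodule_iff[OF assms(1)] using h s by auto
qed

lemma submodule_Int:
  assumes "module R M" "submodule H R M" "submodule K R M"
  shows "submodule (H \<inter> K) R M"
  using assms(2,3) unfolding submodule_iff[OF assms(1)] by auto

lemma submodule_restrict:
  assumes "module R M" "submodule Z R M" "submodule H R M" "H \<subseteq> Z"
  shows "submodule H R (M\<lparr>carrier := Z\<rparr>)"
  using assms(3,4) submodule_iff[OF assms(1)] submodule_iff[OF submodule.submodule_is_module[OF assms(2,1)]]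
  by auto

lemma generated_submodule_props:
  assumes "module R M" "S \<subseteq> carrier M"
  shows generated_submodule_is_submodule: "submodule (generated_submodule R M S) R M"
    and generated_submodule_superset: "S \<subseteq> generated_submodule R M S"
proof -
  have "carrier M \<in> {N. submodule N R M \<and> S \<subseteq> N}"
    using submodule_carrier[OF assms(1)] assms(2) by simp
  then show "submodule (generated_submodule R M S) R M"
    unfolding submodule_iff[OF assms(1)] generated_submodule_def by blast
  show "S \<subseteq> generated_submodule R M S" unfolding generated_submodule_def by blast
qed

lemma generated_submodule_minimal:
  assumes "submodule H R M" "S \<subseteq> H"
  shows "generated_submodule R M S \<subseteq> H"
  using assms unfolding generated_submodule_def by blast

lemma generated_submodule_mono:
  assumes "S \<subseteq> T"
  shows "generated_submodule R M S \<subseteq> generated_submodule R M T"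
  using assms unfolding generated_submodule_def by blast

lemma generated_submodule_empty:
  assumes "module R M"
  shows "generated_submodule R M {} = {\<zero>\<^bsub>M\<^esub>}"
  using generated_submodule_minimal[OF submodule_zero[OF assms], of "{}"]
    submoduleD(2)[OF assms generated_submodule_is_submodule[OF assms, of "{}"]] by auto

lemma submodule_add_multiples:
  assumes "module R M" "submodule H R M" "t \<in> carrier M"
  shows "submodule {r \<odot>\<^bsub>M\<^esub> t \<oplus>\<^bsub>M\<^esub> y | r y. r \<in> carrier R \<and> y \<in> H} R M"
proof -
  interpret M: module R M by fact
  note s = submoduleD[OF assms(1,2)]
  show ?thesis
    unfolding submodule_iff[OF assms(1)]
  proof (intro conjI ballI)
    show "{r \<odot>\<^bsub>M\<^esub> t \<oplus>\<^bsub>M\<^esub> y |r y. r \<in> carrier R \<and> y \<in> H} \<subseteq> carrier M"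
      using assms(3) s(1) by auto
    have "\<zero>\<^bsub>M\<^esub> = \<zero>\<^bsub>R\<^esub> \<odot>\<^bsub>M\<^esub> t \<oplus>\<^bsub>M\<^esub> \<zero>\<^bsub>M\<^esub>" using assms(3) by simp
    then show "\<zero>\<^bsub>M\<^esub> \<in> {r \<odot>\<^bsub>M\<^esub> t \<oplus>\<^bsub>M\<^esub> y |r y. r \<in> carrier R \<and> y \<in> H}"
      using s(2) by blast
  next
    fix a b assume "a \<in> {r \<odot>\<^bsub>M\<^esub> t \<oplus>\<^bsub>M\<^esub> y |r y. r \<in> carrier R \<and> y \<in> H}"
      "b \<in> {r \<odot>\<^bsub>M\<^esub> t \<oplus>\<^bsub>M\<^esub> y |r y. r \<in> carrier R \<and> y \<in> H}"
    then obtain r y r' y' where *: "r \<in> carrier R" "r' \<in> carrier R" "y \<in> H" "y' \<in> H"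
      "a = r \<odot>\<^bsub>M\<^esub> t \<oplus>\<^bsub>M\<^esub> y" "b = r' \<odot>\<^bsub>M\<^esub> t \<oplus>\<^bsub>M\<^esub> y'" by auto
    then have "a \<oplus>\<^bsub>M\<^esub> b = (r \<oplus>\<^bsub>R\<^esub> r') \<odot>\<^bsub>M\<^esub> t \<oplus>\<^bsub>M\<^esub> (y \<oplus>\<^bsub>M\<^esub> y')"
      using assms(3) s(1) by (simp add: M.smult_l_distr M.a_ac)
    then show "a \<oplus>\<^bsub>M\<^esub> b \<in> {r \<odot>\<^bsub>M\<^esub> t \<oplus>\<^bsub>M\<^esub> y |r y. r \<in> carrier R \<and> y \<in> H}"
      using * s(3) by blast
  next
    fix c a assume c: "c \<in> carrier R"
      and "a \<in> {r \<odot>\<^bsub>M\<^esub> t \<oplus>\<^bsub>M\<^esub> y |r y. r \<in> carrier R \<and> y \<in> H}"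
    then obtain r y where *: "r \<in> carrier R" "y \<in> H" "a = r \<odot>\<^bsub>M\<^esub> t \<oplus>\<^bsub>M\<^esub> y" by auto
    then have "c \<odot>\<^bsub>M\<^esub> a = (c \<otimes>\<^bsub>R\<^esub> r) \<odot>\<^bsub>M\<^esub> t \<oplus>\<^bsub>M\<^esub> c \<odot>\<^bsub>M\<^esub> y"
      using assms(3) s(1) c by (simp add: M.smult_r_distr M.smult_assoc1)
    then show "c \<odot>\<^bsub>M\<^esub> a \<in> {r \<odot>\<^bsub>M\<^esub> t \<oplus>\<^bsub>M\<^esub> y |r y. r \<in> carrier R \<and> y \<in> H}"
      using * s(4) c by blast
  qed
qed

text \<open>Splitting off one generator prepares the induction on the number of generators in the
  Noetherian argument.\<close>

lemma generated_submodule_insert: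
  assumes "module R M" "T \<subseteq> carrier M" "t \<in> carrier M"
  shows "generated_submodule R M (insert t T) =
    {r \<odot>\<^bsub>M\<^esub> t \<oplus>\<^bsub>M\<^esub> y | r y. r \<in> carrier R \<and> y \<in> generated_submodule R M T}" (is "?L = ?R")
proof
  interpret M: module R M by fact
  have T: "submodule (generated_submodule R M T) R M" "T \<subseteq> generated_submodule R M T"
    using generated_submodule_props[OF assms(1,2)] by auto
  have L: "submodule ?L R M" "insert t T \<subseteq> ?L"
    using generated_submodule_props[OF assms(1), of "insert t T"] assms by auto
  have "t = \<one>\<^bsub>R\<^esub> \<odot>\<^bsub>M\<^esub> t \<oplus>\<^bsub>M\<^esub> \<zero>\<^bsub>M\<^esub>" using assms(3) by simp
  then have "t \<in> ?R" using submoduleD(2)[OF assms(1) T(1)] M.R.one_closed by blast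
  moreover have "y \<in> ?R" if "y \<in> T" for y
  proof -
    have "y = \<zero>\<^bsub>R\<^esub> \<odot>\<^bsub>M\<^esub> t \<oplus>\<^bsub>M\<^esub> y" using assms(2,3) that by (simp add: subset_iff)
    then show ?thesis using T(2) that M.R.zero_closed by blast
  qed
  ultimately have "insert t T \<subseteq> ?R" by blast
  then show "?L \<subseteq> ?R"
    by (rule generated_submodule_minimal[OF submodule_add_multiples[OF assms(1) T(1) assms(3)]])
  have TL: "generated_submodule R M T \<subseteq> ?L" by (rule generated_submodule_mono) auto
  have "r \<odot>\<^bsub>M\<^esub> t \<oplus>\<^bsub>M\<^esub> y \<in> ?L" if "r \<in> carrier R" "y \<in> generated_submodule R M T" for r y
    using that TL L(2) submoduleD(3)[OF assms(1) L(1)] submoduleD(4)[OF assms(1) L(1)]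
    by (meson insert_subset subsetD)
  then show "?R \<subseteq> ?L" by blast
qed

section \<open>Noetherian modules\<close>

lemma (in cring) idealI_cring:
  assumes "I \<subseteq> carrier R" "\<zero> \<in> I"
    and add: "\<And>a b. a \<in> I \<Longrightarrow> b \<in> I \<Longrightarrow> a \<oplus> b \<in> I"
    and mult: "\<And>a c. a \<in> I \<Longrightarrow> c \<in> carrier R \<Longrightarrow> c \<otimes> a \<in> I"
  shows "ideal I R"
proof (rule idealI)
  show "ring R" by (rule ring_axioms)
  show "subgroup I (add_monoid R)"
  proof (rule add.subgroupI)
    show "\<ominus> a \<in> I" if "a \<in> I" for a
      using mult[OF that, of "\<ominus> \<one>"] that assms(1) by (simp add: l_minus subset_iff)
  qed (use assms in auto)
  show "x \<otimes> a \<in> I" "a \<otimes> x \<in> I" if "a \<in> I" "x \<in> carrier R" for a x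
    using mult[OF that] that assms(1) by (auto simp: m_comm subset_iff)
qed

text \<open>The analogue of the ideal of leading coefficients in Hilbert's basis theorem: it
  collects the coefficients of t in elements of X, read modulo G.\<close>

lemma ideal_of_coefficients:
  assumes M: "module R M" and G: "submodule G R M" and X: "submodule X R M" and t: "t \<in> carrier M"
  shows "ideal {r \<in> carrier R. \<exists>y\<in>G. r \<odot>\<^bsub>M\<^esub> t \<oplus>\<^bsub>M\<^esub> y \<in> X} R" (is "ideal ?I R")
proof -
  interpret M: module R M by fact
  note g = submoduleD[OF M G] and x = submoduleD[OF M X]
  show ?thesis
  proof (rule M.R.idealI_cring)
    show "?I \<subseteq> carrier R" by auto
    have "\<zero>\<^bsub>R\<^esub> \<odot>\<^bsub>M\<^esub> t \<oplus>\<^bsub>M\<^esub> \<zero>\<^bsub>M\<^esub> \<in> X" using t x by simp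
    then show "\<zero>\<^bsub>R\<^esub> \<in> ?I" using g(2) by blast
  next
    fix a b assume "a \<in> ?I" "b \<in> ?I"
    then obtain y z where y: "a \<in> carrier R" "y \<in> G" "a \<odot>\<^bsub>M\<^esub> t \<oplus>\<^bsub>M\<^esub> y \<in> X"
      "b \<in> carrier R" "z \<in> G" "b \<odot>\<^bsub>M\<^esub> t \<oplus>\<^bsub>M\<^esub> z \<in> X" by auto
    have "(a \<odot>\<^bsub>M\<^esub> t \<oplus>\<^bsub>M\<^esub> y) \<oplus>\<^bsub>M\<^esub> (b \<odot>\<^bsub>M\<^esub> t \<oplus>\<^bsub>M\<^esub> z) = (a \<oplus>\<^bsub>R\<^esub> b) \<odot>\<^bsub>M\<^esub> t \<oplus>\<^bsub>M\<^esub> (y \<oplus>\<^bsub>M\<^esub> z)"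
      using y t g(1) by (simp add: M.smult_l_distr M.a_ac)
    then have "(a \<oplus>\<^bsub>R\<^esub> b) \<odot>\<^bsub>M\<^esub> t \<oplus>\<^bsub>M\<^esub> (y \<oplus>\<^bsub>M\<^esub> z) \<in> X" using x(3) y by metis
    then show "a \<oplus>\<^bsub>R\<^esub> b \<in> ?I" using y g(3) by auto
  next
    fix a c assume "a \<in> ?I" and c: "c \<in> carrier R"
    then obtain y where y: "a \<in> carrier R" "y \<in> G" "a \<odot>\<^bsub>M\<^esub> t \<oplus>\<^bsub>M\<^esub> y \<in> X" by auto
    have "c \<odot>\<^bsub>M\<^esub> (a \<odot>\<^bsub>M\<^esub> t \<oplus>\<^bsub>M\<^esub> y) = (c \<otimes>\<^bsub>R\<^esub> a) \<odot>\<^bsub>M\<^esub> t \<oplus>\<^bsub>M\<^esub> c \<odot>\<^bsub>M\<^esub> y"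
      using y t c g(1) by (simp add: M.smult_r_distr M.smult_assoc1)
    then have "(c \<otimes>\<^bsub>R\<^esub> a) \<odot>\<^bsub>M\<^esub> t \<oplus>\<^bsub>M\<^esub> c \<odot>\<^bsub>M\<^esub> y \<in> X" using x(4) y c by metis
    then show "c \<otimes>\<^bsub>R\<^esub> a \<in> ?I" using y c g(4) by auto
  qed
qed

text \<open>Induction on the number of generators: inside Rt + G a submodule X is controlled by its
  ideal of coefficients at t and by X \<inter> G. The first is finitely generated because R is
  Noetherian, the second by induction.\<close>

lemma noetherian_submodule_finitely_generated:
  assumes R: "noetherian_ring R" and M: "module R M"
    and T: "finite T" "T \<subseteq> carrier M"
    and X: "submodule X R M" "X \<subseteq> generated_submodule R M T"
  shows "\<exists>S. finite S \<and> S \<subseteq> X \<and> X = generated_submodule R M S"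
  using T X
proof (induction T arbitrary: X rule: finite_induct)
  case empty
  then have "X = {\<zero>\<^bsub>M\<^esub>}"
    using generated_submodule_empty[OF M] submoduleD(2)[OF M] by auto
  then show ?case using generated_submodule_empty[OF M] by (intro exI[of _ "{}"]) auto
next
  case (insert t T)
  interpret M: module R M by fact
  interpret R: noetherian_ring R by fact
  define G where "G = generated_submodule R M T"
  have T: "T \<subseteq> carrier M" "t \<in> carrier M" using insert by auto
  have G: "submodule G R M" unfolding G_def by (rule generated_submodule_is_submodule[OF M T(1)])
  note g = submoduleD[OF M G] and x = submoduleD[OF M insert.prems(2)]
  define I where "I = {r \<in> carrier R. \<exists>y\<in>G. r \<odot>\<^bsub>M\<^esub> t \<oplus>\<^bsub>M\<^esub> y \<in> X}"
  have "ideal I R" unfolding I_def by (rule ideal_of_coefficients[OF M G insert.prems(2) T(2)])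
  then obtain A where A: "A \<subseteq> carrier R" "finite A" "I = Idl\<^bsub>R\<^esub> A"
    using R.finetely_gen by blast
  have "\<forall>a\<in>A. \<exists>y\<in>G. a \<odot>\<^bsub>M\<^esub> t \<oplus>\<^bsub>M\<^esub> y \<in> X"
    using M.R.genideal_self[OF A(1)] unfolding A(3)[symmetric] I_def by auto
  then obtain y where y: "\<And>a. a \<in> A \<Longrightarrow> y a \<in> G" "\<And>a. a \<in> A \<Longrightarrow> a \<odot>\<^bsub>M\<^esub> t \<oplus>\<^bsub>M\<^esub> y a \<in> X"
    by metis
  have "submodule (X \<inter> G) R M" by (rule submodule_Int[OF M insert.prems(2) G])
  then obtain S where S: "finite S" "S \<subseteq> X \<inter> G" "X \<inter> G = generated_submodule R M S"
    using insert.IH[of "X \<inter> G"] T unfolding G_def by (metis inf_le2)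
  define S' where "S' = (\<lambda>a. a \<odot>\<^bsub>M\<^esub> t \<oplus>\<^bsub>M\<^esub> y a) ` A \<union> S"
  have S': "finite S'" "S' \<subseteq> X" unfolding S'_def using A S y by auto
  then have S'c: "S' \<subseteq> carrier M" using x(1) by auto
  define Y where "Y = generated_submodule R M S'"
  have Y: "submodule Y R M" "S' \<subseteq> Y"
    unfolding Y_def using generated_submodule_props[OF M S'c] by auto
  note yy = submoduleD[OF M Y(1)]
  have "Y \<subseteq> X" unfolding Y_def by (rule generated_submodule_minimal[OF insert.prems(2) S'(2)])
  have XG: "X \<inter> G \<subseteq> Y"
    unfolding S(3) Y_def by (rule generated_submodule_mono) (auto simp: S'_def)
  \<comment> \<open>The ideal of coefficients of the candidate \<open>Y\<close>. It contains the
    generators \<open>A\<close> of \<open>I\<close>, so every coefficient that occurs in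
    \<open>X\<close> also occurs in \<open>Y\<close>.\<close>
  define J where "J = {r \<in> carrier R. \<exists>u\<in>G. r \<odot>\<^bsub>M\<^esub> t \<oplus>\<^bsub>M\<^esub> u \<in> Y}"
  have "ideal J R" unfolding J_def by (rule ideal_of_coefficients[OF M G Y(1) T(2)])
  moreover have "A \<subseteq> J" unfolding J_def using A(1) y(1) Y(2) unfolding S'_def by blast
  ultimately have IJ: "I \<subseteq> J" unfolding A(3) by (rule M.R.genideal_minimal)
  have "X \<subseteq> Y"
  proof
    fix z assume z: "z \<in> X"
    then obtain r u where ru: "r \<in> carrier R" "u \<in> G" "z = r \<odot>\<^bsub>M\<^esub> t \<oplus>\<^bsub>M\<^esub> u"
      using insert.prems(3) generated_submodule_insert[OF M T] unfolding G_def by auto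
    then have "r \<in> I" unfolding I_def using z by auto
    then obtain v where v: "v \<in> G" "r \<odot>\<^bsub>M\<^esub> t \<oplus>\<^bsub>M\<^esub> v \<in> Y" using IJ unfolding J_def by auto
    have zc: "z \<in> carrier M" "r \<odot>\<^bsub>M\<^esub> t \<oplus>\<^bsub>M\<^esub> v \<in> carrier M" "u \<in> carrier M" "v \<in> carrier M"
      using z x(1) yy(1) v ru g(1) by auto
    \<comment> \<open>Subtracting an element of \<open>Y\<close> with the same coefficient at
      \<open>t\<close> leaves an element of X \<inter> G, and these are already known to lie in
      \<open>Y\<close>.\<close>
    have "z \<ominus>\<^bsub>M\<^esub> (r \<odot>\<^bsub>M\<^esub> t \<oplus>\<^bsub>M\<^esub> v) = u \<ominus>\<^bsub>M\<^esub> v"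
      using zc T(2) ru by (simp add: a_minus_def M.minus_add M.a_ac M.r_neg M.r_neg1 M.r_neg2)
    moreover have "z \<ominus>\<^bsub>M\<^esub> (r \<odot>\<^bsub>M\<^esub> t \<oplus>\<^bsub>M\<^esub> v) \<in> X" using z v \<open>Y \<subseteq> X\<close> x(6) by auto
    moreover have "u \<ominus>\<^bsub>M\<^esub> v \<in> G" using ru v g(6) by auto
    ultimately have "z \<ominus>\<^bsub>M\<^esub> (r \<odot>\<^bsub>M\<^esub> t \<oplus>\<^bsub>M\<^esub> v) \<in> Y" using XG by auto
    then have "(z \<ominus>\<^bsub>M\<^esub> (r \<odot>\<^bsub>M\<^esub> t \<oplus>\<^bsub>M\<^esub> v)) \<oplus>\<^bsub>M\<^esub> (r \<odot>\<^bsub>M\<^esub> t \<oplus>\<^bsub>M\<^esub> v) \<in> Y" using v yy(3) by auto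
    moreover have "(z \<ominus>\<^bsub>M\<^esub> (r \<odot>\<^bsub>M\<^esub> t \<oplus>\<^bsub>M\<^esub> v)) \<oplus>\<^bsub>M\<^esub> (r \<odot>\<^bsub>M\<^esub> t \<oplus>\<^bsub>M\<^esub> v) = z"
      using zc by (simp add: a_minus_def M.a_assoc M.l_neg)
    ultimately show "z \<in> Y" by simp
  qed
  with \<open>Y \<subseteq> X\<close> S' show ?case unfolding Y_def by (intro exI[of _ S']) auto
qed

text \<open>Zorn's lemma applies because the union of a chain is finitely generated: a finite
  generating set lies in a single member of the chain, which is then the union.\<close>

lemma noetherian_maximal_submodule:
  fixes R :: "('a, 'r) ring_scheme" and M :: "('a, 'b, 'd) module_scheme"
  assumes R: "noetherian_ring R" and M: "module R M" and fg: "finitely_generated R M"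
    and X: "\<X> \<noteq> {}" "\<And>X. X \<in> \<X> \<Longrightarrow> submodule X R M"
  shows "\<exists>X\<in>\<X>. \<forall>Y\<in>\<X>. X \<subseteq> Y \<longrightarrow> Y = X"
proof (rule subset_Zorn_nonempty[OF X(1)])
  fix \<C> assume C: "\<C> \<noteq> {}" "subset.chain \<X> \<C>"
  have CX: "\<And>Y. Y \<in> \<C> \<Longrightarrow> Y \<in> \<X>" and Ch: "\<And>Y Z. Y \<in> \<C> \<Longrightarrow> Z \<in> \<C> \<Longrightarrow> Y \<subseteq> Z \<or> Z \<subseteq> Y"
    using C(2) unfolding subset.chain_def by auto
  obtain T where T: "finite T" "T \<subseteq> carrier M" "generated_submodule R M T = carrier M"
    using fg unfolding finitely_generated_def by auto
  have sub: "Y \<subseteq> carrier M" "\<zero>\<^bsub>M\<^esub> \<in> Y" "x \<in> Y \<Longrightarrow> y \<in> Y \<Longrightarrow> x \<oplus>\<^bsub>M\<^esub> y \<in> Y"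
    "r \<in> carrier R \<Longrightarrow> x \<in> Y \<Longrightarrow> r \<odot>\<^bsub>M\<^esub> x \<in> Y" if "Y \<in> \<C>" for Y x y r
    using submoduleD[OF M X(2)[OF CX[OF that]]] by auto
  have U: "submodule (\<Union>\<C>) R M"
    unfolding submodule_iff[OF M]
  proof (intro conjI ballI)
    show "\<Union>\<C> \<subseteq> carrier M" using sub(1) by blast
    show "\<zero>\<^bsub>M\<^esub> \<in> \<Union>\<C>" using sub(2) C(1) by blast
    show "x \<oplus>\<^bsub>M\<^esub> y \<in> \<Union>\<C>" if "x \<in> \<Union>\<C>" "y \<in> \<Union>\<C>" for x y
    proof -
      from that obtain Y Z where YZ: "Y \<in> \<C>" "x \<in> Y" "Z \<in> \<C>" "y \<in> Z" by auto
      with Ch[of Y Z] show ?thesis using sub(3)[of Y x y] sub(3)[of Z x y] by blast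
    qed
    show "r \<odot>\<^bsub>M\<^esub> y \<in> \<Union>\<C>" if "r \<in> carrier R" "y \<in> \<Union>\<C>" for r y
      using that sub(4) by blast
  qed
  then have "\<Union>\<C> \<subseteq> generated_submodule R M T" using T submoduleD(1)[OF M U] by auto
  then obtain S where S: "finite S" "S \<subseteq> \<Union>\<C>" "\<Union>\<C> = generated_submodule R M S"
    using noetherian_submodule_finitely_generated[OF R M T(1,2) U] by auto
  have "\<exists>Y\<in>\<C>. S \<subseteq> Y" using S(1,2)
  proof (induction S rule: finite_induct)
    case empty
    then show ?case using C(1) by blast
  next
    case (insert s S)
    then obtain Y Z where "Y \<in> \<C>" "S \<subseteq> Y" "Z \<in> \<C>" "s \<in> Z" by blast
    then show ?case using Ch[of Y Z] by (meson insert_subset subset_trans subsetD)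
  qed
  then obtain Y where Y: "Y \<in> \<C>" "S \<subseteq> Y" by blast
  have "\<Union>\<C> \<subseteq> Y"
    unfolding S(3) by (rule generated_submodule_minimal[OF X(2)[OF CX[OF Y(1)]] Y(2)])
  then have "\<Union>\<C> = Y" using Y(1) by blast
  then show "\<Union>\<C> \<in> \<X>" using CX[OF Y(1)] by simp
qed

section \<open>Zero divisors in the maximal ideal\<close>

lemma module_residual_ideal:
  assumes M: "module R M" and U: "submodule U R M" and a: "a \<in> carrier M"
  shows "ideal {r \<in> carrier R. r \<odot>\<^bsub>M\<^esub> a \<in> U} R"
proof -
  interpret M: module R M by fact
  note u = submoduleD[OF M U]
  show ?thesis
    by (rule M.R.idealI_cring) (use a u in \<open>auto simp: M.smult_l_distr M.smult_assoc1\<close>)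
qed

lemma (in ideal) ideal_minus_closed:
  assumes "a \<in> I" "b \<in> I"
  shows "a \<ominus> b \<in> I"
  using assms by (simp add: a_minus_def a_closed additive_subgroup.a_inv_closed[OF is_additive_subgroup])

section \<open>Prime avoidance\<close>

context cring
begin

text \<open>A product of elements picked from the ideals q outside p lies in every q, and it stays
  outside p because p is prime.\<close>

lemma primeideal_finite_avoid:
  assumes "primeideal p R" "finite \<Q>"
    and "\<And>q. q \<in> \<Q> \<Longrightarrow> ideal q R" "\<And>q. q \<in> \<Q> \<Longrightarrow> \<not> q \<subseteq> p"
  shows "\<exists>z\<in>carrier R. z \<notin> p \<and> (\<forall>q\<in>\<Q>. z \<in> q)"
  using assms(2-)
proof (induction \<Q> rule: finite_induct)
  case empty
  interpret p: primeideal p R by fact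
  have "\<one> \<notin> p" using p.one_imp_carrier p.I_notcarr by auto
  then show ?case by auto
next
  case (insert q \<Q>)
  interpret p: primeideal p R by fact
  obtain z where z: "z \<in> carrier R" "z \<notin> p" "\<forall>q\<in>\<Q>. z \<in> q" using insert by auto
  have q: "ideal q R" using insert by auto
  obtain y where y: "y \<in> q" "y \<notin> p" using insert.prems(2) by blast
  have yc: "y \<in> carrier R" using ideal.Icarr[OF q y(1)] .
  have "y \<otimes> z \<notin> p" using p.I_prime[OF yc z(1)] y z by auto
  moreover have "\<forall>q'\<in>insert q \<Q>. y \<otimes> z \<in> q'"
    using ideal.I_r_closed[OF q y(1) z(1)] ideal.I_l_closed[OF insert.prems(1) _ yc] z(3) by auto
  ultimately show ?case using yc z(1) by blast
qed

text \<open>Incomparability makes the induction direct: if the element x that avoids the earlier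
  primes falls into p, it is replaced by x + y z, where y lies in I but not in p, and z lies in all
  earlier primes but not in p.\<close>

lemma prime_avoidance:
  assumes "finite \<P>" "ideal I R" "\<And>p. p \<in> \<P> \<Longrightarrow> primeideal p R"
    and "\<And>p. p \<in> \<P> \<Longrightarrow> \<not> I \<subseteq> p"
    and "\<And>p q. p \<in> \<P> \<Longrightarrow> q \<in> \<P> \<Longrightarrow> p \<subseteq> q \<Longrightarrow> p = q"
  shows "\<exists>x\<in>I. \<forall>p\<in>\<P>. x \<notin> p"
  using assms(1,3-)
proof (induction \<P> rule: finite_induct)
  case empty
  then show ?case using additive_subgroup.zero_closed[OF ideal.axioms(1)[OF assms(2)]] by auto
next
  case (insert p \<P>)
  interpret I: ideal I R by fact
  interpret p: primeideal p R using insert by auto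
  have "\<exists>x\<in>I. \<forall>q\<in>\<P>. x \<notin> q" by (rule insert.IH) (use insert.prems in auto)
  then obtain x where x: "x \<in> I" "\<And>q. q \<in> \<P> \<Longrightarrow> x \<notin> q" by blast
  show ?case
  proof (cases "x \<in> p")
    case False
    with x show ?thesis by auto
  next
    case True
    obtain y where y: "y \<in> I" "y \<notin> p" using insert.prems(2) by blast
    have ideals: "ideal q R" if "q \<in> \<P>" for q
      using insert.prems(1)[of q] that primeideal.axioms(1) by auto
    have "\<not> q \<subseteq> p" if "q \<in> \<P>" for q
      using insert.prems(3)[of q p] insert.hyps(2) that by auto
    then obtain z where z: "z \<in> carrier R" "z \<notin> p" "\<forall>q\<in>\<P>. z \<in> q"
      using primeideal_finite_avoid[OF p.primeideal insert.hyps(1) ideals] by blast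
    have yc: "y \<in> carrier R" and xc: "x \<in> carrier R" using x y I.Icarr by auto
    have sum: "x = (x \<oplus> y \<otimes> z) \<ominus> y \<otimes> z" "y \<otimes> z = (x \<oplus> y \<otimes> z) \<ominus> x"
      using xc yc z(1) by algebra+
    have "x \<oplus> y \<otimes> z \<notin> p"
    proof
      assume "x \<oplus> y \<otimes> z \<in> p"
      then have "y \<otimes> z \<in> p" using sum(2) True p.ideal_minus_closed by metis
      then show False using p.I_prime[OF yc z(1)] y z by auto
    qed
    moreover have "x \<oplus> y \<otimes> z \<notin> q" if q: "q \<in> \<P>" for q
    proof
      interpret q: ideal q R by (rule ideals[OF q])
      assume "x \<oplus> y \<otimes> z \<in> q"
      moreover have "y \<otimes> z \<in> q" using z(3) q q.I_l_closed yc by auto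
      ultimately have "x \<in> q" using sum(1) q.ideal_minus_closed by metis
      then show False using x(2)[OF q] by auto
    qed
    moreover have "x \<oplus> y \<otimes> z \<in> I" using x y z I.I_r_closed I.a_closed by auto
    ultimately show ?thesis by auto
  qed
qed

end

section \<open>Noetherian local rings: units, Nakayama's lemma, socles\<close>

locale noetherian_local_ring =
  fixes R (structure)
  assumes noetherian: "noetherian_ring R" and local_ring: "local_ring R"
begin

sublocale cring R
  using local_ring unfolding local_ring_def by auto

sublocale noetherian_ring R
  by (rule noetherian)

abbreviation "\<mm> \<equiv> max_ideal R"

lemma maximalideal_max_ideal: "maximalideal \<mm> R"
  and maximalideal_unique: "maximalideal I R \<Longrightarrow> I = \<mm>"
proof -
  have ex: "\<exists>!I. maximalideal I R" using local_ring unfolding local_ring_def by auto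
  show "maximalideal \<mm> R" unfolding max_ideal_def by (rule theI'[OF ex])
  then show "maximalideal I R \<Longrightarrow> I = \<mm>" using ex by auto
qed

sublocale mm: maximalideal \<mm> R
  by (rule maximalideal_max_ideal)

lemma one_notin_max_ideal: "\<one> \<notin> \<mm>"
  using mm.one_imp_carrier mm.I_notcarr by auto

text \<open>In a Noetherian ring the union of a chain of ideals belongs to the chain. The family is
  arbitrary because both proper ideals and annihilators are inserted for it.\<close>

lemma maximal_ideal_in_family:
  assumes "I \<in> \<I>" "\<And>J. J \<in> \<I> \<Longrightarrow> ideal J R"
  shows "\<exists>J\<in>\<I>. I \<subseteq> J \<and> (\<forall>K\<in>\<I>. J \<subseteq> K \<longrightarrow> K = J)"
proof -
  have "\<exists>J\<in>{J \<in> \<I>. I \<subseteq> J}. \<forall>K\<in>{J \<in> \<I>. I \<subseteq> J}. J \<subseteq> K \<longrightarrow> K = J"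
  proof (rule subset_Zorn_nonempty)
    show "{J \<in> \<I>. I \<subseteq> J} \<noteq> {}" using assms(1) by auto
    fix C assume C: "C \<noteq> {}" "subset.chain {J \<in> \<I>. I \<subseteq> J} C"
    have CI: "J \<in> \<I>" "I \<subseteq> J" if "J \<in> C" for J
      using C(2) that unfolding subset.chain_def by auto
    have "subset.chain {I. ideal I R} C"
      unfolding subset.chain_def using C(2)[unfolded subset.chain_def] assms(2)[OF CI(1)] by (simp add: subset_iff)
    then have "\<Union>C \<in> C" using ideal_chain_is_trivial C(1) by blast
    then show "\<Union>C \<in> {J \<in> \<I>. I \<subseteq> J}" using CI by simp
  qed
  then obtain J where J: "J \<in> \<I>" "I \<subseteq> J"
    "\<forall>K\<in>{J \<in> \<I>. I \<subseteq> J}. J \<subseteq> K \<longrightarrow> K = J" by blast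
  have "K = J" if "K \<in> \<I>" "J \<subseteq> K" for K
    using J(3)[rule_format, of K] that J(2) by simp
  with J(1,2) show ?thesis by (intro bexI[of _ J]) auto
qed

text \<open>Otherwise the principal ideal of r lies in some maximal ideal, which by locality is the
  given one.\<close>

lemma Units_of_notin_max_ideal:
  assumes "r \<in> carrier R" "r \<notin> \<mm>"
  shows "r \<in> Units R"
proof (rule ccontr)
  assume nu: "r \<notin> Units R"
  define \<I> where "\<I> = {J. ideal J R \<and> J \<noteq> carrier R}"
  have "PIdl r \<noteq> carrier R"
  proof
    assume "PIdl r = carrier R"
    then have "\<one> \<in> PIdl r" by simp
    then show False using nu assms(1) unfolding cgenideal_def Units_def by (auto simp: m_comm)
  qed
  then have "PIdl r \<in> \<I>" unfolding \<I>_def using cgenideal_ideal[OF assms(1)] by simp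
  moreover have \<I>: "ideal J R" if "J \<in> \<I>" for J using that unfolding \<I>_def by simp
  ultimately have "\<exists>J\<in>\<I>. PIdl r \<subseteq> J \<and> (\<forall>K\<in>\<I>. J \<subseteq> K \<longrightarrow> K = J)"
    by (rule maximal_ideal_in_family)
  then obtain J where J: "J \<in> \<I>" "PIdl r \<subseteq> J" "\<forall>K\<in>\<I>. J \<subseteq> K \<longrightarrow> K = J" by blast
  have "maximalideal J R"
  proof (rule maximalidealI[OF \<I>[OF J(1)]])
    show "carrier R \<noteq> J" using J(1) unfolding \<I>_def by auto
    show "K = J \<or> K = carrier R" if "ideal K R" "J \<subseteq> K" "K \<subseteq> carrier R" for K
      using that J(3) unfolding \<I>_def by auto
  qed
  then have "J = \<mm>" by (rule maximalideal_unique)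
  then show False using J(2) cgenideal_self[OF assms(1)] assms(2) by auto
qed

lemma Units_one_minus:
  assumes "x \<in> \<mm>"
  shows "\<one> \<ominus> x \<in> Units R"
proof (rule Units_of_notin_max_ideal)
  have xc: "x \<in> carrier R" using assms mm.Icarr by auto
  show "\<one> \<ominus> x \<in> carrier R" using xc by auto
  show "\<one> \<ominus> x \<notin> \<mm>"
  proof
    assume "\<one> \<ominus> x \<in> \<mm>"
    then have "(\<one> \<ominus> x) \<oplus> x \<in> \<mm>" using assms mm.a_closed by auto
    moreover have "(\<one> \<ominus> x) \<oplus> x = \<one>" using xc by algebra
    ultimately show False using one_notin_max_ideal by simp
  qed
qed

lemma unit_smult_mem:
  assumes "module R M" "submodule V R M" "c \<in> Units R" "a \<in> carrier M" "c \<odot>\<^bsub>M\<^esub> a \<in> V"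
  shows "a \<in> V"
proof -
  interpret M: module R M by fact
  have "inv c \<odot>\<^bsub>M\<^esub> (c \<odot>\<^bsub>M\<^esub> a) \<in> V"
    using submoduleD(4)[OF assms(1,2)] assms(3,5) by auto
  moreover have "inv c \<odot>\<^bsub>M\<^esub> (c \<odot>\<^bsub>M\<^esub> a) = a"
    using assms(3,4) by (simp add: M.smult_assoc1[symmetric] Units_closed)
  ultimately show ?thesis by simp
qed

text \<open>Let V be maximal among the proper submodules containing U. Then M = Ra + V for any a
  outside V, and expanding a = u + x b with b in Ra + V gives (1 - x t) a \<in> V. As 1 - x t is a
  unit, a would lie in V.\<close>

lemma nakayama:
  assumes M: "module R M" and fg: "finitely_generated R M" and U: "submodule U R M"
    and x: "x \<in> \<mm>" and gen: "\<And>a. a \<in> carrier M \<Longrightarrow> \<exists>u\<in>U. \<exists>b\<in>carrier M. a = u \<oplus>\<^bsub>M\<^esub> x \<odot>\<^bsub>M\<^esub> b"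
  shows "U = carrier M"
proof (rule ccontr)
  interpret M: module R M by fact
  assume neq: "U \<noteq> carrier M"
  define \<X> where "\<X> = {V. submodule V R M \<and> U \<subseteq> V \<and> V \<noteq> carrier M}"
  have "U \<in> \<X>" unfolding \<X>_def using U neq by simp
  then have "\<X> \<noteq> {}" by auto
  moreover have "submodule V R M" if "V \<in> \<X>" for V using that unfolding \<X>_def by simp
  ultimately have "\<exists>V\<in>\<X>. \<forall>W\<in>\<X>. V \<subseteq> W \<longrightarrow> W = V"
    by (rule noetherian_maximal_submodule[OF noetherian M fg])
  then obtain V where V: "V \<in> \<X>" "\<And>W. W \<in> \<X> \<Longrightarrow> V \<subseteq> W \<Longrightarrow> W = V" by auto
  have Vs: "submodule V R M" "U \<subseteq> V" "V \<noteq> carrier M" using V(1) unfolding \<X>_def by auto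
  note v = submoduleD[OF M Vs(1)]
  have xc: "x \<in> carrier R" using x mm.Icarr by auto
  obtain a where a: "a \<in> carrier M" "a \<notin> V" using Vs(3) v(1) by blast
  define W where "W = {r \<odot>\<^bsub>M\<^esub> a \<oplus>\<^bsub>M\<^esub> y | r y. r \<in> carrier R \<and> y \<in> V}"
  have W: "submodule W R M" unfolding W_def by (rule submodule_add_multiples[OF M Vs(1) a(1)])
  have VW: "V \<subseteq> W"
  proof
    fix y assume y: "y \<in> V"
    then have "y = \<zero> \<odot>\<^bsub>M\<^esub> a \<oplus>\<^bsub>M\<^esub> y" using v(1) a by simp
    then show "y \<in> W" unfolding W_def using y by blast
  qed
  have "a = \<one> \<odot>\<^bsub>M\<^esub> a \<oplus>\<^bsub>M\<^esub> \<zero>\<^bsub>M\<^esub>" using a by simp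
  then have "a \<in> W" unfolding W_def using v(2) by blast
  then have "W = carrier M" using V(2)[of W] W VW a(2) Vs(2) unfolding \<X>_def by auto
  moreover obtain u b where ub: "u \<in> U" "b \<in> carrier M" "a = u \<oplus>\<^bsub>M\<^esub> x \<odot>\<^bsub>M\<^esub> b"
    using gen[OF a(1)] by blast
  ultimately obtain t y where ty: "t \<in> carrier R" "y \<in> V" "b = t \<odot>\<^bsub>M\<^esub> a \<oplus>\<^bsub>M\<^esub> y"
    unfolding W_def by blast
  have uc: "u \<in> V" "u \<in> carrier M" "y \<in> carrier M" using ub(1) Vs(2) v(1) ty(2) by auto
  have "x \<odot>\<^bsub>M\<^esub> b = (x \<otimes> t) \<odot>\<^bsub>M\<^esub> a \<oplus>\<^bsub>M\<^esub> x \<odot>\<^bsub>M\<^esub> y"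
    unfolding ty(3) using ty(1) uc xc a(1) by (simp add: M.smult_r_distr M.smult_assoc1)
  with ub(3) have "a = u \<oplus>\<^bsub>M\<^esub> ((x \<otimes> t) \<odot>\<^bsub>M\<^esub> a \<oplus>\<^bsub>M\<^esub> x \<odot>\<^bsub>M\<^esub> y)"
    by metis
  also have "\<dots> = (x \<otimes> t) \<odot>\<^bsub>M\<^esub> a \<oplus>\<^bsub>M\<^esub> (u \<oplus>\<^bsub>M\<^esub> x \<odot>\<^bsub>M\<^esub> y)"
    using ty(1) uc xc a by (simp add: M.a_ac)
  finally have e: "a = (x \<otimes> t) \<odot>\<^bsub>M\<^esub> a \<oplus>\<^bsub>M\<^esub> (u \<oplus>\<^bsub>M\<^esub> x \<odot>\<^bsub>M\<^esub> y)" .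
  have "(\<one> \<ominus> x \<otimes> t) \<odot>\<^bsub>M\<^esub> a = a \<ominus>\<^bsub>M\<^esub> (x \<otimes> t) \<odot>\<^bsub>M\<^esub> a"
    using a ty(1) xc by (simp add: a_minus_def M.smult_l_distr M.smult_l_minus)
  also have "\<dots> = (u \<oplus>\<^bsub>M\<^esub> x \<odot>\<^bsub>M\<^esub> y)"
    using ty(1) uc xc a by (subst (1) e) (simp add: a_minus_def M.a_ac M.r_neg1 M.r_neg2 M.r_neg)
  also have "\<dots> \<in> V" using uc(1) ty(2) v(3,4) xc by auto
  finally have "(\<one> \<ominus> x \<otimes> t) \<odot>\<^bsub>M\<^esub> a \<in> V" .
  moreover have "\<one> \<ominus> x \<otimes> t \<in> Units R"
    using Units_one_minus[OF mm.I_r_closed[OF x ty(1)]] .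
  ultimately have "a \<in> V" using unit_smult_mem[OF M Vs(1) _ a(1)] by blast
  then show False using a(2) by simp
qed

text \<open>The maximal ideal is an associated prime of M/U. The maximal annihilators of nonzero
  classes are prime and finite in number, and by hypothesis they cover the maximal ideal; prime
  avoidance puts the maximal ideal inside one of them.\<close>

lemma socle_of_zero_divisors:
  assumes M: "module R M" and fg: "finitely_generated R M" and U: "submodule U R M"
    and zd: "\<And>x. x \<in> \<mm> \<Longrightarrow> \<exists>a\<in>carrier M. a \<notin> U \<and> x \<odot>\<^bsub>M\<^esub> a \<in> U"
  shows "\<exists>u\<in>carrier M. u \<notin> U \<and> (\<forall>x\<in>\<mm>. x \<odot>\<^bsub>M\<^esub> u \<in> U)"
proof -
  interpret M: module R M by fact
  note u = submoduleD[OF M U]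
  define ann where "ann a = {r \<in> carrier R. r \<odot>\<^bsub>M\<^esub> a \<in> U}" for a
  have ann_ideal: "ideal (ann a) R" if "a \<in> carrier M" for a
    unfolding ann_def by (rule module_residual_ideal[OF M U that])
  define \<A> where "\<A> = ann ` {a \<in> carrier M. a \<notin> U}"
  define A where "A = {a \<in> carrier M. a \<notin> U \<and> (\<forall>K\<in>\<A>. ann a \<subseteq> K \<longrightarrow> K = ann a)}"
  have Amax: "K = ann a" if "a \<in> A" "K \<in> \<A>" "ann a \<subseteq> K" for a K
    using that unfolding A_def by auto
  have AD: "a \<in> carrier M" "a \<notin> U" "ann a \<in> \<A>" if "a \<in> A" for a
    using that unfolding A_def \<A>_def by auto
  have ideals: "ideal J R" if "J \<in> \<A>" for J using that ann_ideal unfolding \<A>_def by auto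
  have prime: "primeideal (ann a) R" if a: "a \<in> A" for a
  proof (rule primeidealI)
    note ac = AD(1,2)[OF a]
    show "ideal (ann a) R" "cring R" using ann_ideal ac is_cring by auto
    have "\<one> \<notin> ann a" using ac unfolding ann_def by simp
    then show "carrier R \<noteq> ann a" by auto
    fix r s assume rs: "r \<in> carrier R" "s \<in> carrier R" "r \<otimes> s \<in> ann a"
    show "r \<in> ann a \<or> s \<in> ann a"
    proof (cases "s \<in> ann a")
      case False
      then have s: "s \<odot>\<^bsub>M\<^esub> a \<in> carrier M" "s \<odot>\<^bsub>M\<^esub> a \<notin> U" using rs ac unfolding ann_def by auto
      have "ann a \<subseteq> ann (s \<odot>\<^bsub>M\<^esub> a)"
      proof
        fix t assume t: "t \<in> ann a"
        then have "s \<odot>\<^bsub>M\<^esub> (t \<odot>\<^bsub>M\<^esub> a) \<in> U" using u(4) rs unfolding ann_def by auto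
        moreover have "s \<odot>\<^bsub>M\<^esub> (t \<odot>\<^bsub>M\<^esub> a) = t \<odot>\<^bsub>M\<^esub> (s \<odot>\<^bsub>M\<^esub> a)"
          using t rs ac unfolding ann_def by (simp add: M.smult_assoc1[symmetric] m_comm)
        ultimately show "t \<in> ann (s \<odot>\<^bsub>M\<^esub> a)" using t unfolding ann_def by simp
      qed
      moreover have "ann (s \<odot>\<^bsub>M\<^esub> a) \<in> \<A>" using s unfolding \<A>_def by auto
      ultimately have "ann (s \<odot>\<^bsub>M\<^esub> a) = ann a" using Amax[OF a] by auto
      moreover have "r \<in> ann (s \<odot>\<^bsub>M\<^esub> a)"
        using rs ac unfolding ann_def by (simp add: M.smult_assoc1)
      ultimately show ?thesis by simp
    qed simp
  qed
  \<comment> \<open>Among the submodules generated by \<open>U\<close> and finitely many members of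
    \<open>A\<close> there is a maximal one, and it contains all of \<open>A\<close>.\<close>
  have "\<exists>F. finite F \<and> F \<subseteq> A \<and> (\<forall>a\<in>A. a \<in> generated_submodule R M (U \<union> F))"
  proof -
    define \<X> where "\<X> = {generated_submodule R M (U \<union> F) | F. finite F \<and> F \<subseteq> A}"
    have Ac: "A \<subseteq> carrier M" "U \<subseteq> carrier M" using u(1) unfolding A_def by auto
    have sub: "submodule (generated_submodule R M (U \<union> F)) R M" if "F \<subseteq> A" for F
      using generated_submodule_is_submodule[OF M, of "U \<union> F"] Ac that by blast
    have "\<exists>X\<in>\<X>. \<forall>Y\<in>\<X>. X \<subseteq> Y \<longrightarrow> Y = X"
    proof (rule noetherian_maximal_submodule[OF noetherian M fg])
      show "\<X> \<noteq> {}" unfolding \<X>_def by blast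
      show "submodule X R M" if "X \<in> \<X>" for X using that sub unfolding \<X>_def by blast
    qed
    then obtain X where X: "X \<in> \<X>" "\<And>Y. Y \<in> \<X> \<Longrightarrow> X \<subseteq> Y \<Longrightarrow> Y = X" by auto
    obtain F where F: "finite F" "F \<subseteq> A" "X = generated_submodule R M (U \<union> F)"
      using X(1) unfolding \<X>_def by auto
    have "a \<in> generated_submodule R M (U \<union> F)" if a: "a \<in> A" for a
    proof -
      have "generated_submodule R M (U \<union> insert a F) \<in> \<X>"
        unfolding \<X>_def mem_Collect_eq using F(1,2) a by (intro exI[of _ "insert a F"]) auto
      moreover have "generated_submodule R M (U \<union> F) \<subseteq> generated_submodule R M (U \<union> insert a F)"
        by (rule generated_submodule_mono) auto
      ultimately have "generated_submodule R M (U \<union> insert a F) = generated_submodule R M (U \<union> F)"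
        by (rule X(2)[unfolded F(3)])
      moreover have "U \<union> insert a F \<subseteq> generated_submodule R M (U \<union> insert a F)"
        using Ac F(2) a by (intro generated_submodule_superset[OF M]) auto
      ultimately show ?thesis by blast
    qed
    with F(1,2) show ?thesis by (intro exI[of _ F]) auto
  qed
  then obtain F where F: "finite F" "F \<subseteq> A" "\<And>a. a \<in> A \<Longrightarrow> a \<in> generated_submodule R M (U \<union> F)"
    by blast
  have Fc: "F \<subseteq> carrier M" using F(2) AD(1) by auto
  have in_F: "ann a \<in> ann ` F" if a: "a \<in> A" for a
  proof (rule ccontr)
    \<comment> \<open>If the annihilator of \<open>a\<close> were a further one, some z outside it
      would lie in the annihilators of all members of \<open>F\<close>. Such a z kills the classes
      of \<open>F\<close>, hence also the class of \<open>a\<close>, which they generate.\<close>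
    assume nin: "ann a \<notin> ann ` F"
    have "\<not> q \<subseteq> ann a" if "q \<in> ann ` F" for q
    proof
      assume "q \<subseteq> ann a"
      moreover obtain f where f: "f \<in> F" "q = ann f" using \<open>q \<in> ann ` F\<close> by blast
      ultimately have "ann a = q" using Amax[of f "ann a"] AD(3)[OF a] F(2) by auto
      then show False using nin that by simp
    qed
    moreover have "ideal q R" if "q \<in> ann ` F" for q using that ann_ideal Fc by blast
    ultimately obtain z where z: "z \<in> carrier R" "z \<notin> ann a" "\<forall>q\<in>ann ` F. z \<in> q"
      using primeideal_finite_avoid[OF prime[OF a], of "ann ` F"] F(1) by blast
    have "(\<lambda>y. z \<odot>\<^bsub>M\<^esub> y) \<in> module_homs R M M"
      by (rule module_homs_smult[OF M M module_homs_id z(1)])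
    from submodule_vimage[OF M M this U]
    have "submodule {y \<in> carrier M. z \<odot>\<^bsub>M\<^esub> y \<in> U} R M" .
    moreover have "U \<union> F \<subseteq> {y \<in> carrier M. z \<odot>\<^bsub>M\<^esub> y \<in> U}"
      using u(1,4) z(1,3) Fc unfolding ann_def by auto
    ultimately have "generated_submodule R M (U \<union> F) \<subseteq> {y \<in> carrier M. z \<odot>\<^bsub>M\<^esub> y \<in> U}"
      by (rule generated_submodule_minimal)
    then have "z \<in> ann a" using F(3)[OF a] z(1) unfolding ann_def by auto
    then show False using z(2) by simp
  qed
  have maximal: "\<exists>a\<in>A. J \<subseteq> ann a" if J: "J \<in> \<A>" for J
  proof -
    obtain K where K: "K \<in> \<A>" "J \<subseteq> K" "\<forall>L\<in>\<A>. K \<subseteq> L \<longrightarrow> L = K"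
      using maximal_ideal_in_family[OF J ideals] by auto
    then obtain a where "a \<in> carrier M" "a \<notin> U" "K = ann a" unfolding \<A>_def by auto
    then show ?thesis using K unfolding A_def by (intro bexI[of _ a]) auto
  qed
  have "\<exists>p\<in>ann ` F. \<mm> \<subseteq> p"
  proof (rule ccontr)
    assume "\<not> (\<exists>p\<in>ann ` F. \<mm> \<subseteq> p)"
    moreover have "p = q" if "p \<in> ann ` F" "q \<in> ann ` F" "p \<subseteq> q" for p q
    proof -
      obtain f g where "f \<in> A" "p = ann f" "g \<in> A" "q = ann g"
        using F(2) \<open>p \<in> ann ` F\<close> \<open>q \<in> ann ` F\<close> by auto
      then show ?thesis using \<open>p \<subseteq> q\<close> Amax[of f q] AD(3)[of g] by auto
    qed
    moreover have "primeideal p R" if "p \<in> ann ` F" for p using that F(2) prime by blast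
    moreover have "finite (ann ` F)" using F(1) by simp
    ultimately have "\<exists>x\<in>\<mm>. \<forall>p\<in>ann ` F. x \<notin> p"
      by (intro prime_avoidance[OF _ mm.ideal_axioms]) blast+
    then obtain x where x: "x \<in> \<mm>" "\<forall>p\<in>ann ` F. x \<notin> p" by blast
    obtain a where a: "a \<in> carrier M" "a \<notin> U" "x \<odot>\<^bsub>M\<^esub> a \<in> U" using zd[OF x(1)] by blast
    then have "ann a \<in> \<A>" "x \<in> ann a" unfolding \<A>_def ann_def using mm.Icarr[OF x(1)] by auto
    then obtain b where "b \<in> A" "x \<in> ann b" using maximal by blast
    then show False using in_F x(2) by blast
  qed
  then obtain f where f: "f \<in> F" "\<mm> \<subseteq> ann f" by auto
  then show ?thesis using AD(1,2)[of f] F(2) unfolding ann_def by (intro bexI[of _ f]) auto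
qed

end

section \<open>Koszul cochains\<close>

text \<open>The common ambient module of all cochain groups, so that their closure under sums,
  multiples and negatives becomes a statement about submodules.\<close>

definition fun_module :: "('a, 'b, 'd) module_scheme \<Rightarrow> ('a, 'i \<Rightarrow> 'b) module" where
  "fun_module M =
    \<lparr>carrier = {f. \<forall>i. f i \<in> carrier M}, monoid.mult = undefined, one = undefined,
     ring.zero = (\<lambda>_. \<zero>\<^bsub>M\<^esub>), add = (\<lambda>f g i. f i \<oplus>\<^bsub>M\<^esub> g i), smult = (\<lambda>r f i. r \<odot>\<^bsub>M\<^esub> f i)\<rparr>"

lemma fun_module_simps [simp]:
  "f \<in> carrier (fun_module M) \<longleftrightarrow> (\<forall>i. f i \<in> carrier M)"
  "\<zero>\<^bsub>fun_module M\<^esub> = (\<lambda>_. \<zero>\<^bsub>M\<^esub>)"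
  "f \<oplus>\<^bsub>fun_module M\<^esub> g = (\<lambda>i. f i \<oplus>\<^bsub>M\<^esub> g i)"
  "r \<odot>\<^bsub>fun_module M\<^esub> f = (\<lambda>i. r \<odot>\<^bsub>M\<^esub> f i)"
  unfolding fun_module_def by auto

lemma module_fun_module:
  fixes M :: "('a, 'b, 'd) module_scheme"
  assumes "module R M"
  shows "module R (fun_module M :: ('a, 'i \<Rightarrow> 'b) module)"
proof -
  interpret M: module R M by fact
  show ?thesis
  proof (rule moduleI)
    show "cring R" by (rule M.R.is_cring)
    show "abelian_group (fun_module M :: ('a, 'i \<Rightarrow> 'b) module)"
    proof (rule abelian_groupI)
      fix f assume "f \<in> carrier (fun_module M :: ('a, 'i \<Rightarrow> 'b) module)"
      then show "\<exists>g\<in>carrier (fun_module M). g \<oplus>\<^bsub>fun_module M\<^esub> f = \<zero>\<^bsub>fun_module M\<^esub>"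
        by (intro bexI[of _ "\<lambda>i. \<ominus>\<^bsub>M\<^esub> f i"]) (auto simp: M.l_neg)
    qed (auto simp: M.a_ac)
  qed (auto simp: M.smult_l_distr M.smult_r_distr M.smult_assoc1)
qed

lemma fun_module_inv:
  fixes M :: "('a, 'b, 'd) module_scheme" and f :: "'i \<Rightarrow> 'b"
  assumes "module R M" "f \<in> carrier (fun_module M)"
  shows "\<ominus>\<^bsub>fun_module M\<^esub> f = (\<lambda>i. \<ominus>\<^bsub>M\<^esub> f i)"
proof -
  interpret M: module R M by fact
  interpret F: module R "fun_module M :: ('a, 'i \<Rightarrow> 'b) module" by (rule module_fun_module) fact
  show ?thesis
    by (rule F.M.minus_equality) (use assms(2) in \<open>auto simp: M.l_neg\<close>)
qed

lemma fun_module_minus: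
  assumes "module R M" "f \<in> carrier (fun_module M)" "g \<in> carrier (fun_module M)"
  shows "f \<ominus>\<^bsub>fun_module M\<^esub> g = (\<lambda>i. f i \<ominus>\<^bsub>M\<^esub> g i)"
  using assms by (simp add: a_minus_def fun_module_inv)

text \<open>
  A set of positions in \<open>xs\<close> is encoded as a \<^typ>\<open>bool list\<close> of the same length, so a Koszul cochain of
  degree \<open>p\<close> is a function supported on the lists of that length with \<open>p\<close> entries \<^const>\<open>True\<close>.
\<close>

primrec koszul_diff :: "('a, 'b, 'd) module_scheme \<Rightarrow> 'a list \<Rightarrow> (bool list \<Rightarrow> 'b) \<Rightarrow> bool list \<Rightarrow> 'b" where
  "koszul_diff M [] f bs = \<zero>\<^bsub>M\<^esub>"
| "koszul_diff M (x # xs) f bs =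
    (case bs of [] \<Rightarrow> \<zero>\<^bsub>M\<^esub>
     | b # cs \<Rightarrow> if b then x \<odot>\<^bsub>M\<^esub> f (False # cs) \<ominus>\<^bsub>M\<^esub> koszul_diff M xs (\<lambda>c. f (True # c)) cs
                else koszul_diff M xs (\<lambda>c. f (False # c)) cs)"

text \<open>Contraction with the \<open>i\<close>-th basis vector. The sign in the
  \<open>Suc\<close> case arises from moving past the first basis vector when that is
  present.\<close>

primrec koszul_homotopy :: "('a, 'b, 'd) module_scheme \<Rightarrow> nat \<Rightarrow> (bool list \<Rightarrow> 'b) \<Rightarrow> bool list \<Rightarrow> 'b" where
  "koszul_homotopy M 0 f bs =
    (case bs of [] \<Rightarrow> \<zero>\<^bsub>M\<^esub> | b # cs \<Rightarrow> if b then \<zero>\<^bsub>M\<^esub> else f (True # cs))"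
| "koszul_homotopy M (Suc i) f bs =
    (case bs of [] \<Rightarrow> \<zero>\<^bsub>M\<^esub>
     | b # cs \<Rightarrow> if b then \<ominus>\<^bsub>M\<^esub> koszul_homotopy M i (\<lambda>c. f (True # c)) cs
                else koszul_homotopy M i (\<lambda>c. f (False # c)) cs)"

text \<open>Values off the support are zero, so that cocycle conditions are plain equalities of
  functions. The degree is an integer: the group in degree -1 is then zero, and arguments that pass
  from \<open>p\<close> to \<open>p - 1\<close> run without a case distinction at 0.\<close>

definition cochains :: "('a, 'b, 'd) module_scheme \<Rightarrow> nat \<Rightarrow> int \<Rightarrow> 'b set \<Rightarrow> (bool list \<Rightarrow> 'b) set" where
  "cochains M n p U =
    {f. \<forall>bs. f bs \<in> (if length bs = n \<and> int (count_list bs True) = p then U else {\<zero>\<^bsub>M\<^esub>})}"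

lemma cochainsD:
  assumes "f \<in> cochains M n p U"
  shows "length bs = n \<Longrightarrow> int (count_list bs True) = p \<Longrightarrow> f bs \<in> U"
    and "length bs \<noteq> n \<or> int (count_list bs True) \<noteq> p \<Longrightarrow> f bs = \<zero>\<^bsub>M\<^esub>"
  using assms unfolding cochains_def by (auto split: if_splits dest: spec[of _ bs])

lemma cochains_mem:
  assumes "f \<in> cochains M n p U" "\<zero>\<^bsub>M\<^esub> \<in> U"
  shows "f bs \<in> U"
  using cochainsD[OF assms(1), of bs] assms(2) by metis

lemma cochainsI:
  assumes "\<And>bs. f bs \<in> U"
    and "\<And>bs. length bs \<noteq> n \<or> int (count_list bs True) \<noteq> p \<Longrightarrow> f bs = \<zero>\<^bsub>M\<^esub>"
  shows "f \<in> cochains M n p U"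
  using assms unfolding cochains_def by auto

lemma cochains_iff:
  assumes "\<zero>\<^bsub>M\<^esub> \<in> U"
  shows "f \<in> cochains M n p U \<longleftrightarrow> (\<forall>bs. f bs \<in> U) \<and>
    (\<forall>bs. length bs \<noteq> n \<or> int (count_list bs True) \<noteq> p \<longrightarrow> f bs = \<zero>\<^bsub>M\<^esub>)"
  using assms cochainsI[of f U n p M] cochainsD(2)[of f M n p U] cochains_mem[of f M n p U] by metis

lemma cochains_mono:
  assumes "f \<in> cochains M n p U" "U \<subseteq> V"
  shows "f \<in> cochains M n p V"
  using assms unfolding cochains_def by (force split: if_splits)

lemma cochains_negative:
  assumes "p < 0"
  shows "f \<in> cochains M n p U \<longleftrightarrow> f = (\<lambda>_. \<zero>\<^bsub>M\<^esub>)"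
  using assms unfolding cochains_def by auto

lemma cochains_zero_iff:
  "f \<in> cochains M n p {\<zero>\<^bsub>M\<^esub>} \<longleftrightarrow> f = (\<lambda>_. \<zero>\<^bsub>M\<^esub>)"
  unfolding cochains_def by auto

lemma cochains_submodule:
  assumes "module R M" "submodule U R M"
  shows "submodule (cochains M n p U) R (fun_module M)"
proof -
  interpret M: module R M by fact
  show ?thesis
    unfolding submodule_iff[OF module_fun_module[OF assms(1)]]
    using submoduleD[OF assms] by (auto simp: cochains_iff[of M U, OF submoduleD(2)[OF assms]])
qed

text \<open>Lifts a cochain value by value along the relation \<open>Q\<close>. The relation has to
  hold between the zeros, since both cochains vanish off the support.\<close>

lemma cochains_choice:
  assumes "f \<in> cochains M n p W" and "\<And>w. w \<in> W \<Longrightarrow> \<exists>c\<in>B. Q w c" and "Q \<zero>\<^bsub>M\<^esub> \<zero>\<^bsub>N\<^esub>" "\<zero>\<^bsub>N\<^esub> \<in> B"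
  shows "\<exists>g\<in>cochains N n p B. \<forall>bs. Q (f bs) (g bs)"
proof -
  have "\<forall>w\<in>W. \<exists>c. c \<in> B \<and> Q w c" using assms(2) by blast
  then obtain h where h: "\<And>w. w \<in> W \<Longrightarrow> h w \<in> B" "\<And>w. w \<in> W \<Longrightarrow> Q w (h w)" by metis
  define g where "g bs = (if length bs = n \<and> int (count_list bs True) = p then h (f bs) else \<zero>\<^bsub>N\<^esub>)" for bs
  have "g \<in> cochains N n p B"
    using h(1) cochainsD(1)[OF assms(1)] unfolding cochains_def g_def by auto
  moreover have "Q (f bs) (g bs)" for bs
    using h(2) cochainsD[OF assms(1), of bs] assms(3) unfolding g_def by auto
  ultimately show ?thesis by blast
qed

lemma cochains_hom:
  assumes "module R M" "module R N" "\<phi> \<in> module_homs R M N"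
    and "f \<in> cochains M n p U" "\<And>u. u \<in> U \<Longrightarrow> \<phi> u \<in> V"
  shows "(\<lambda>bs. \<phi> (f bs)) \<in> cochains N n p V"
  using assms(4,5) module_homs_zero[OF assms(1-3)] unfolding cochains_def
  by (auto split: if_splits)

lemma cochains_tail:
  assumes "f \<in> cochains M (Suc n) p U"
  shows "(\<lambda>c. f (False # c)) \<in> cochains M n p U" "(\<lambda>c. f (True # c)) \<in> cochains M n (p - 1) U"
proof -
  show "(\<lambda>c. f (False # c)) \<in> cochains M n p U"
    unfolding cochains_def
  proof (intro CollectI allI)
    fix bs show "f (False # bs) \<in> (if length bs = n \<and> int (count_list bs True) = p then U else {\<zero>\<^bsub>M\<^esub>})"
      using cochainsD[OF assms, of "False # bs"] by auto
  qed
  show "(\<lambda>c. f (True # c)) \<in> cochains M n (p - 1) U"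
    unfolding cochains_def
  proof (intro CollectI allI)
    fix bs show "f (True # bs) \<in> (if length bs = n \<and> int (count_list bs True) = p - 1 then U else {\<zero>\<^bsub>M\<^esub>})"
      using cochainsD[OF assms, of "True # bs"] by auto
  qed
qed

lemma cochains_ConsI:
  assumes "f [] = \<zero>\<^bsub>M\<^esub>"
    and "(\<lambda>c. f (False # c)) \<in> cochains M n p U" "(\<lambda>c. f (True # c)) \<in> cochains M n (p - 1) U"
  shows "f \<in> cochains M (Suc n) p U"
  unfolding cochains_def
proof (intro CollectI allI)
  fix bs show "f bs \<in> (if length bs = Suc n \<and> int (count_list bs True) = p then U else {\<zero>\<^bsub>M\<^esub>})"
  proof (cases bs)
    case Nil
    then show ?thesis using assms(1) by auto
  next
    case (Cons b c)
    show ?thesis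
    proof (cases b)
      case True
      then show ?thesis using Cons cochainsD[OF assms(3), of c] by auto
    next
      case False
      then show ?thesis using Cons cochainsD[OF assms(2), of c] by auto
    qed
  qed
qed

section \<open>The Koszul differential and its contracting homotopies\<close>

lemma koszul_diff_closed:
  assumes "module R M" "set xs \<subseteq> carrier R" "\<And>bs. f bs \<in> carrier M"
  shows "koszul_diff M xs f bs \<in> carrier M"
proof -
  interpret M: module R M by fact
  show ?thesis using assms(2,3)
    by (induction xs arbitrary: f bs) (auto split: list.splits intro!: M.minus_closed)
qed

text \<open>Besides maps between different modules, this is applied to multiplication by a ring
  element and to negation, which makes the differential compatible with scalars and signs.\<close>

lemma koszul_diff_natural:
  assumes "module R M" "module R N" "\<phi> \<in> module_homs R M N"
    and "set xs \<subseteq> carrier R" "\<And>bs. f bs \<in> carrier M"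
  shows "\<phi> (koszul_diff M xs f bs) = koszul_diff N xs (\<lambda>b. \<phi> (f b)) bs"
  using assms(4,5)
proof (induction xs arbitrary: f bs)
  case Nil
  then show ?case using module_homs_zero[OF assms(1-3)] by simp
next
  case (Cons x xs)
  interpret M: module R M by fact
  have "koszul_diff M xs (\<lambda>c. f (True # c)) cs \<in> carrier M" for cs
    by (rule koszul_diff_closed[OF assms(1)]) (use Cons in auto)
  then show ?case
    using Cons module_homs_zero[OF assms(1-3)]
    by (auto split: list.splits simp: module_homs_minus[OF assms(1-3)] module_homsD(3)[OF assms(3)])
qed

lemma koszul_diff_hom:
  assumes "module R M" "set xs \<subseteq> carrier R"
  shows "koszul_diff M xs \<in> module_homs R (fun_module M) (fun_module M)"
proof -
  interpret M: module R M by fact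
  note cl = koszul_diff_closed[OF assms(1)]
  have cl': "koszul_diff M xs (\<lambda>c. f (b # c)) cs \<in> carrier M"
    if "set xs \<subseteq> carrier R" "\<And>bs. f bs \<in> carrier M" for xs f b cs
    by (rule cl) (use that in auto)
  have add: "koszul_diff M xs (\<lambda>i. f i \<oplus>\<^bsub>M\<^esub> g i) bs = koszul_diff M xs f bs \<oplus>\<^bsub>M\<^esub> koszul_diff M xs g bs"
    if "set xs \<subseteq> carrier R" "\<And>bs. f bs \<in> carrier M" "\<And>bs. g bs \<in> carrier M" for f g bs xs
    using that
  proof (induction xs arbitrary: f g bs)
    case (Cons x xs)
    then show ?case
      using cl'[of xs f] cl'[of xs g]
      by (auto split: list.splits simp: M.smult_r_distr a_minus_def M.minus_add M.a_ac)
  qed simp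
  have sm: "koszul_diff M xs (\<lambda>i. r \<odot>\<^bsub>M\<^esub> f i) bs = r \<odot>\<^bsub>M\<^esub> koszul_diff M xs f bs"
    if "set xs \<subseteq> carrier R" "\<And>bs. f bs \<in> carrier M" "r \<in> carrier R" for f r bs xs
  proof -
    have "(\<lambda>x. r \<odot>\<^bsub>M\<^esub> x) \<in> module_homs R M M"
      by (rule module_homs_smult[OF assms(1) assms(1) module_homs_id that(3)])
    from koszul_diff_natural[OF assms(1) assms(1) this that(1,2)] show ?thesis by simp
  qed
  show ?thesis
    by (rule module_homsI) (use assms cl add sm in \<open>auto simp: fun_eq_iff\<close>)
qed

lemma koszul_diff_minus:
  assumes "module R M" "set xs \<subseteq> carrier R" "\<And>bs. f bs \<in> carrier M" "\<And>bs. g bs \<in> carrier M"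
  shows "koszul_diff M xs (\<lambda>i. f i \<ominus>\<^bsub>M\<^esub> g i) bs = koszul_diff M xs f bs \<ominus>\<^bsub>M\<^esub> koszul_diff M xs g bs"
  using module_homs_minus[OF module_fun_module[OF assms(1)] module_fun_module[OF assms(1)]
      koszul_diff_hom[OF assms(1,2)], of f g] assms koszul_diff_closed[OF assms(1,2)]
  by (simp add: fun_module_minus[OF assms(1)] fun_eq_iff)

lemma koszul_diff_zero:
  assumes "module R M" "set xs \<subseteq> carrier R"
  shows "koszul_diff M xs (\<lambda>_. \<zero>\<^bsub>M\<^esub>) bs = \<zero>\<^bsub>M\<^esub>"
  using module_homs_zero[OF module_fun_module[OF assms(1)] module_fun_module[OF assms(1)]
      koszul_diff_hom[OF assms(1,2)]] by (simp add: fun_eq_iff)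

text \<open>The complex for \<open>x # xs\<close> is, up to shift and signs, the cone of
  multiplication by x on the complex for \<open>xs\<close>. Its differential squares to zero because
  the smaller differential does and commutes with x.\<close>

lemma koszul_diff_diff:
  assumes "module R M" "set xs \<subseteq> carrier R" "\<And>bs. f bs \<in> carrier M"
  shows "koszul_diff M xs (koszul_diff M xs f) bs = \<zero>\<^bsub>M\<^esub>"
  using assms(2,3)
proof (induction xs arbitrary: f bs)
  case (Cons x xs)
  interpret M: module R M by fact
  have xs: "set xs \<subseteq> carrier R" "x \<in> carrier R" using Cons by auto
  define F where "F = (\<lambda>c. f (False # c))"
  define T where "T = (\<lambda>c. f (True # c))"
  have FT: "\<And>b. F b \<in> carrier M" "\<And>b. T b \<in> carrier M" unfolding F_def T_def using Cons by auto
  note [simp] = koszul_diff_closed[OF assms(1) xs(1) FT(1)] koszul_diff_closed[OF assms(1) xs(1) FT(2)]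
    Cons.IH[OF xs(1) FT(1)] Cons.IH[OF xs(1) FT(2)] FT
  have "koszul_diff M xs (\<lambda>c. x \<odot>\<^bsub>M\<^esub> F c \<ominus>\<^bsub>M\<^esub> koszul_diff M xs T c) cs
      = koszul_diff M xs (\<lambda>c. x \<odot>\<^bsub>M\<^esub> F c) cs" for cs
    by (subst koszul_diff_minus[OF assms(1) xs(1)])
      (use xs in \<open>auto simp: a_minus_def koszul_diff_closed[OF assms(1) xs(1)]\<close>)
  also have "koszul_diff M xs (\<lambda>c. x \<odot>\<^bsub>M\<^esub> F c) cs = x \<odot>\<^bsub>M\<^esub> koszul_diff M xs F cs" for cs
    using koszul_diff_natural[OF assms(1) assms(1)
        module_homs_smult[OF assms(1) assms(1) module_homs_id xs(2)] xs(1) FT(1)] by simp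
  finally have e: "koszul_diff M xs (\<lambda>c. x \<odot>\<^bsub>M\<^esub> F c \<ominus>\<^bsub>M\<^esub> koszul_diff M xs T c) cs
      = x \<odot>\<^bsub>M\<^esub> koszul_diff M xs F cs" for cs .
  show ?case
  proof (cases bs)
    case (Cons b cs)
    have *: "koszul_diff M (x # xs) (koszul_diff M (x # xs) f) (b # cs) =
      (if b then x \<odot>\<^bsub>M\<^esub> koszul_diff M xs F cs
          \<ominus>\<^bsub>M\<^esub> koszul_diff M xs (\<lambda>c. x \<odot>\<^bsub>M\<^esub> F c \<ominus>\<^bsub>M\<^esub> koszul_diff M xs T c) cs
       else koszul_diff M xs (koszul_diff M xs F) cs)"
      by (simp add: F_def T_def)
    show ?thesis unfolding Cons * by (simp add: e xs) (simp add: xs a_minus_def M.r_neg)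
  qed simp
qed simp

text \<open>Each term of the differential carries a factor from \<open>xs\<close>, so values in Z
  turn into values in U once \<open>xs\<close> maps Z into U. For Z = U this is the usual degree
  shift on a cochain group; for Z the preimage of the socle of M/U it makes cochains with values in
  Z cocycles modulo U.\<close>

lemma koszul_diff_cochains_socle:
  assumes "module R M" "set xs \<subseteq> carrier R" "submodule Z R M" "submodule U R M"
    and "\<And>x z. x \<in> set xs \<Longrightarrow> z \<in> Z \<Longrightarrow> x \<odot>\<^bsub>M\<^esub> z \<in> U"
    and "f \<in> cochains M (length xs) p Z"
  shows "koszul_diff M xs f \<in> cochains M (length xs) (p + 1) U"
  using assms(2,5,6)
proof (induction xs arbitrary: f p)
  interpret M: module R M by fact
  case Nil
  then show ?case using submoduleD(2)[OF assms(1,4)] by (auto simp: cochains_def)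
next
  interpret M: module R M by fact
  case (Cons x xs)
  note t = cochains_tail[OF Cons.prems(3)[simplified]]
  have F: "koszul_diff M xs (\<lambda>c. f (False # c)) \<in> cochains M (length xs) (p + 1) U"
    by (rule Cons.IH) (use Cons t in auto)
  have "koszul_diff M xs (\<lambda>c. f (True # c)) \<in> cochains M (length xs) (p - 1 + 1) U"
    by (rule Cons.IH) (use Cons t in auto)
  moreover have "(\<lambda>c. x \<odot>\<^bsub>M\<^esub> f (False # c)) \<in> cochains M (length xs) p U"
    by (rule cochains_hom[OF assms(1) assms(1) module_homs_smult[OF assms(1) assms(1) module_homs_id] t(1)])
      (use Cons in auto)
  ultimately have "(\<lambda>c. x \<odot>\<^bsub>M\<^esub> f (False # c)) \<ominus>\<^bsub>fun_module M\<^esub> koszul_diff M xs (\<lambda>c. f (True # c))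
      \<in> cochains M (length xs) p U"
    using submoduleD(6)[OF module_fun_module[OF assms(1)] cochains_submodule[OF assms(1,4)]] by simp
  moreover have "(\<lambda>c. x \<odot>\<^bsub>M\<^esub> f (False # c)) \<ominus>\<^bsub>fun_module M\<^esub> koszul_diff M xs (\<lambda>c. f (True # c))
      = (\<lambda>c. x \<odot>\<^bsub>M\<^esub> f (False # c) \<ominus>\<^bsub>M\<^esub> koszul_diff M xs (\<lambda>c. f (True # c)) c)"
  proof (rule fun_module_minus[OF assms(1)])
    have fc: "\<And>bs. f bs \<in> carrier M"
      using cochains_mem[OF Cons.prems(3) submoduleD(2)[OF assms(1,3)]] submoduleD(1)[OF assms(1,3)] by blast
    then show "(\<lambda>c. x \<odot>\<^bsub>M\<^esub> f (False # c)) \<in> carrier (fun_module M)" using Cons by auto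
    show "koszul_diff M xs (\<lambda>c. f (True # c)) \<in> carrier (fun_module M)"
      using koszul_diff_closed[OF assms(1)] Cons.prems(1) fc by auto
  qed
  ultimately show ?case
    unfolding length_Cons using F by (intro cochains_ConsI) auto
qed

lemma koszul_diff_cochains:
  assumes "module R M" "set xs \<subseteq> carrier R" "submodule U R M"
    and "f \<in> cochains M (length xs) p U"
  shows "koszul_diff M xs f \<in> cochains M (length xs) (p + 1) U"
  by (rule koszul_diff_cochains_socle[OF assms(1-3) assms(3) _ assms(4)])
    (use submoduleD(4)[OF assms(1,3)] assms(2) in auto)

lemma koszul_homotopy_cochains:
  assumes "module R M" "submodule U R M" "i < n" "f \<in> cochains M n p U"
  shows "koszul_homotopy M i f \<in> cochains M n (p - 1) U"
  using assms(3,4)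
proof (induction i arbitrary: f n p)
  case 0
  then obtain n' where n: "n = Suc n'" by (cases n) auto
  note t = cochains_tail[OF 0(2)[unfolded n]]
  have "(\<lambda>_. \<zero>\<^bsub>M\<^esub>) \<in> cochains M n' (p - 1 - 1) U"
    unfolding cochains_def using submoduleD(2)[OF assms(1,2)] by simp
  then show ?case
    unfolding n using t by (intro cochains_ConsI) auto
next
  case (Suc i)
  then obtain n' where n: "n = Suc n'" "i < n'" by (cases n) auto
  note t = cochains_tail[OF Suc.prems(2)[unfolded n]]
  have "koszul_homotopy M i (\<lambda>c. f (True # c)) \<in> cochains M n' (p - 1 - 1) U" (is "?h \<in> _")
    by (rule Suc.IH[OF n(2) t(2)])
  from submoduleD(5)[OF module_fun_module[OF assms(1)] cochains_submodule[OF assms(1,2)] this]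
  have "\<ominus>\<^bsub>fun_module M\<^esub> ?h \<in> cochains M n' (p - 1 - 1) U" .
  moreover have "\<ominus>\<^bsub>fun_module M\<^esub> ?h = (\<lambda>c. \<ominus>\<^bsub>M\<^esub> ?h c)"
  proof (rule fun_module_inv[OF assms(1)])
    have "?h bs \<in> U" for bs
      by (rule cochains_mem[OF \<open>?h \<in> _\<close> submoduleD(2)[OF assms(1,2)]])
    then show "?h \<in> carrier (fun_module M)" using submoduleD(1)[OF assms(1,2)] by auto
  qed
  ultimately show ?case
    unfolding n(1) using Suc.IH[OF n(2) t(1)] by (intro cochains_ConsI) auto
qed

lemma koszul_homotopy_closed:
  assumes "module R M" "\<And>bs. f bs \<in> carrier M"
  shows "koszul_homotopy M i f bs \<in> carrier M"
proof -
  interpret M: module R M by fact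
  show ?thesis using assms(2)
    by (induction i arbitrary: f bs) (auto split: list.splits)
qed

text \<open>The cancellation behind the homotopy identity on lists starting with
  \<open>True\<close>: the two terms with a factor x drop out.\<close>

lemma (in abelian_group) minus_minus_cancel:
  assumes "p \<in> carrier G" "q \<in> carrier G" "t \<in> carrier G"
  shows "(p \<ominus> \<ominus> q) \<oplus> \<ominus> (p \<ominus> t) = q \<oplus> t"
proof -
  have "(p \<ominus> \<ominus> q) \<oplus> \<ominus> (p \<ominus> t) = (p \<oplus> \<ominus> p) \<oplus> (q \<oplus> t)"
    using assms by (simp add: a_minus_def minus_add a_ac)
  then show ?thesis using assms by (simp add: r_neg)
qed

text \<open>Cartan's formula: contraction with the i-th basis vector is a homotopy from
  multiplication by x_i to zero. The support condition on f enters at lists of length at most i,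
  where both terms on the left vanish.\<close>

lemma koszul_homotopy_identity:
  assumes "module R M" "set xs \<subseteq> carrier R" "\<And>bs. f bs \<in> carrier M"
    and "i < length xs" "\<And>bs. length bs \<noteq> length xs \<Longrightarrow> f bs = \<zero>\<^bsub>M\<^esub>"
  shows "koszul_diff M xs (koszul_homotopy M i f) bs \<oplus>\<^bsub>M\<^esub> koszul_homotopy M i (koszul_diff M xs f) bs
    = (xs ! i) \<odot>\<^bsub>M\<^esub> f bs"
  using assms(2-)
proof (induction i arbitrary: f bs xs)
  interpret M: module R M by fact
  case 0
  then obtain x ys where xs: "xs = x # ys" by (cases xs) auto
  have x: "x \<in> carrier R" "set ys \<subseteq> carrier R" using 0 xs by auto
  have cl: "koszul_diff M ys (\<lambda>c. f (b # c)) cs \<in> carrier M" for b cs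
    by (rule koszul_diff_closed[OF assms(1) x(2)]) (use 0 in auto)
  have f0: "f [] = \<zero>\<^bsub>M\<^esub>" using 0(4)[of "[]"] xs by simp
  show ?case
    unfolding xs using f0 x 0(2) cl koszul_diff_zero[OF assms(1) x(2)]
    by (auto split: list.splits simp: a_minus_def M.a_ac M.r_neg1 M.r_neg2 M.r_neg)
next
  interpret M: module R M by fact
  case (Suc i)
  then obtain x ys where xs: "xs = x # ys" by (cases xs) auto
  have x: "x \<in> carrier R" "set ys \<subseteq> carrier R" "i < length ys" "ys ! i \<in> carrier R" using Suc.prems xs by auto
  define F where "F = (\<lambda>c. f (False # c))"
  define T where "T = (\<lambda>c. f (True # c))"
  have FT: "\<And>b. F b \<in> carrier M" "\<And>b. T b \<in> carrier M" unfolding F_def T_def using Suc.prems by auto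
  have f0: "f [] = \<zero>\<^bsub>M\<^esub>" using Suc.prems(4)[of "[]"] xs by simp
  have sup: "length bs \<noteq> length ys \<Longrightarrow> F bs = \<zero>\<^bsub>M\<^esub>" "length bs \<noteq> length ys \<Longrightarrow> T bs = \<zero>\<^bsub>M\<^esub>" for bs
    unfolding F_def T_def using Suc.prems(4) xs by auto
  have IHF: "koszul_diff M ys (koszul_homotopy M i F) cs \<oplus>\<^bsub>M\<^esub> koszul_homotopy M i (koszul_diff M ys F) cs
      = ys ! i \<odot>\<^bsub>M\<^esub> F cs" for cs
    by (rule Suc.IH[OF x(2) _ x(3)]) (use FT sup in auto)
  have IHT: "koszul_diff M ys (koszul_homotopy M i T) cs \<oplus>\<^bsub>M\<^esub> koszul_homotopy M i (koszul_diff M ys T) cs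
      = ys ! i \<odot>\<^bsub>M\<^esub> T cs" for cs
    by (rule Suc.IH[OF x(2) _ x(3)]) (use FT sup in auto)
  note hc = koszul_homotopy_closed[OF assms(1)] and dc = koszul_diff_closed[OF assms(1) x(2)]
  have hd: "koszul_homotopy M i (\<lambda>c. x \<odot>\<^bsub>M\<^esub> F c \<ominus>\<^bsub>M\<^esub> koszul_diff M ys T c) cs
      = x \<odot>\<^bsub>M\<^esub> koszul_homotopy M i F cs \<ominus>\<^bsub>M\<^esub> koszul_homotopy M i (koszul_diff M ys T) cs" for cs
  proof -
    have mz: "\<ominus>\<^bsub>M\<^esub> \<zero>\<^bsub>M\<^esub> = \<zero>\<^bsub>M\<^esub>" by (rule M.minus_equality) auto
    have gen: "koszul_homotopy M j (\<lambda>c. x \<odot>\<^bsub>M\<^esub> g c \<ominus>\<^bsub>M\<^esub> h c) cs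
      = x \<odot>\<^bsub>M\<^esub> koszul_homotopy M j g cs \<ominus>\<^bsub>M\<^esub> koszul_homotopy M j h cs"
      if "\<And>b. g b \<in> carrier M" "\<And>b. h b \<in> carrier M" for j g h cs
      using that
    proof (induction j arbitrary: g h cs)
      case 0
      then show ?case using x by (auto split: list.splits simp: a_minus_def mz)
    next
      case (Suc j)
      have *: "koszul_homotopy M j (\<lambda>c. g (b # c)) cs \<in> carrier M"
        "koszul_homotopy M j (\<lambda>c. h (b # c)) cs \<in> carrier M" for b cs
        by (rule hc, use Suc.prems in auto)+
      show ?case
        using Suc.IH[of "\<lambda>c. g (True # c)" "\<lambda>c. h (True # c)"] x *
          Suc.IH[of "\<lambda>c. g (False # c)" "\<lambda>c. h (False # c)"] Suc.prems
        by (auto split: list.splits simp: a_minus_def M.minus_add M.smult_r_minus mz)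
    qed
    show ?thesis by (rule gen) (use FT dc in auto)
  qed
  have dm: "koszul_diff M ys (\<lambda>c. \<ominus>\<^bsub>M\<^esub> koszul_homotopy M i T c) cs
      = \<ominus>\<^bsub>M\<^esub> koszul_diff M ys (koszul_homotopy M i T) cs" for cs
  proof -
    have "(\<lambda>c. \<ominus>\<^bsub>M\<^esub> c) \<in> module_homs R M M"
      by (rule module_homsI) (auto simp: M.minus_add M.smult_r_minus M.a_ac)
    from koszul_diff_natural[OF assms(1) assms(1) this x(2), of "koszul_homotopy M i T" cs] hc[of T] FT
    show ?thesis by simp
  qed
  have c: "koszul_homotopy M i F cs \<in> carrier M" "koszul_homotopy M i T cs \<in> carrier M"
      "koszul_diff M ys (koszul_homotopy M i T) cs \<in> carrier M"
      "koszul_diff M ys (koszul_homotopy M i F) cs \<in> carrier M"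
      "koszul_homotopy M i (koszul_diff M ys T) cs \<in> carrier M"
      "koszul_homotopy M i (koszul_diff M ys F) cs \<in> carrier M" for cs
    using hc dc FT by blast+
  have "x \<odot>\<^bsub>M\<^esub> koszul_homotopy M i F cs \<ominus>\<^bsub>M\<^esub> \<ominus>\<^bsub>M\<^esub> koszul_diff M ys (koszul_homotopy M i T) cs \<oplus>\<^bsub>M\<^esub>
      \<ominus>\<^bsub>M\<^esub> (x \<odot>\<^bsub>M\<^esub> koszul_homotopy M i F cs \<ominus>\<^bsub>M\<^esub> koszul_homotopy M i (koszul_diff M ys T) cs)
     = koszul_diff M ys (koszul_homotopy M i T) cs \<oplus>\<^bsub>M\<^esub> koszul_homotopy M i (koszul_diff M ys T) cs" for cs
    by (rule M.minus_minus_cancel) (use c[of cs] x in auto)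
  note calc = this
  show ?case
  proof (cases bs)
    case (Cons b cs)
    have "koszul_diff M (x # ys) (koszul_homotopy M (Suc i) f) (b # cs) =
      (if b then x \<odot>\<^bsub>M\<^esub> koszul_homotopy M i F cs
          \<ominus>\<^bsub>M\<^esub> koszul_diff M ys (\<lambda>c. \<ominus>\<^bsub>M\<^esub> koszul_homotopy M i T c) cs
       else koszul_diff M ys (koszul_homotopy M i F) cs)"
      by (simp add: F_def T_def)
    moreover have "koszul_homotopy M (Suc i) (koszul_diff M (x # ys) f) (b # cs) =
      (if b then \<ominus>\<^bsub>M\<^esub> koszul_homotopy M i (\<lambda>c. x \<odot>\<^bsub>M\<^esub> F c \<ominus>\<^bsub>M\<^esub> koszul_diff M ys T c) cs
       else koszul_homotopy M i (koszul_diff M ys F) cs)"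
      by (simp add: F_def T_def)
    moreover have "f (b # cs) = (if b then T cs else F cs)" by (simp add: F_def T_def)
    ultimately show ?thesis
      unfolding xs Cons by (cases b) (simp_all only: hd dm calc IHF IHT if_True if_False nth_Cons_Suc)
  qed (use f0 x in \<open>simp add: xs\<close>)
qed

lemma cochains_carrier:
  assumes "module R M" "submodule U R M" "f \<in> cochains M n p U"
  shows "\<forall>bs. f bs \<in> carrier M"
  using cochains_mem[OF assms(3) submoduleD(2)[OF assms(1,2)]] submoduleD(1)[OF assms(1,2)] by blast

lemma cochains_add:
  assumes "module R M" "submodule U R M" "f \<in> cochains M n p U" "g \<in> cochains M n p U"
  shows "(\<lambda>bs. f bs \<oplus>\<^bsub>M\<^esub> g bs) \<in> cochains M n p U"
  using submoduleD(3)[OF module_fun_module[OF assms(1)] cochains_submodule[OF assms(1,2)] assms(3,4)] by simp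

lemma cochains_smult:
  assumes "module R M" "submodule U R M" "f \<in> cochains M n p U" "r \<in> carrier R"
  shows "(\<lambda>bs. r \<odot>\<^bsub>M\<^esub> f bs) \<in> cochains M n p U"
  using submoduleD(4)[OF module_fun_module[OF assms(1)] cochains_submodule[OF assms(1,2)] assms(4,3)] by simp

lemma cochains_minus:
  assumes "module R M" "submodule U R M" "f \<in> cochains M n p U" "g \<in> cochains M n p U"
  shows "(\<lambda>bs. f bs \<ominus>\<^bsub>M\<^esub> g bs) \<in> cochains M n p U"
  using submoduleD(6)[OF module_fun_module[OF assms(1)] cochains_submodule[OF assms(1,2)] assms(3,4)]
    fun_module_minus[OF assms(1), of f g] cochains_carrier[OF assms(1,2)] assms(3,4) by simp

lemma cochains_restrict:
  assumes "f \<in> cochains M n p U" "\<And>bs. f bs \<in> V"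
  shows "f \<in> cochains M n p V"
  by (rule cochainsI) (use assms cochainsD(2)[OF assms(1)] in auto)

lemma koszul_diff_add:
  assumes "module R M" "set xs \<subseteq> carrier R" "\<And>bs. f bs \<in> carrier M" "\<And>bs. g bs \<in> carrier M"
  shows "koszul_diff M xs (\<lambda>i. f i \<oplus>\<^bsub>M\<^esub> g i) bs = koszul_diff M xs f bs \<oplus>\<^bsub>M\<^esub> koszul_diff M xs g bs"
  using module_homsD(2)[OF koszul_diff_hom[OF assms(1,2)], of f g] assms(3,4) by simp

lemma koszul_diff_smult:
  assumes "module R M" "set xs \<subseteq> carrier R" "\<And>bs. f bs \<in> carrier M" "r \<in> carrier R"
  shows "koszul_diff M xs (\<lambda>i. r \<odot>\<^bsub>M\<^esub> f i) bs = r \<odot>\<^bsub>M\<^esub> koszul_diff M xs f bs"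
  using module_homsD(3)[OF koszul_diff_hom[OF assms(1,2)], of r f] assms(3,4) by simp

section \<open>Koszul cohomology for generators of the maximal ideal\<close>

locale koszul_local_ring = noetherian_local_ring +
  fixes xs
  assumes xs_carrier: "set xs \<subseteq> carrier R" and xs_generate: "Idl (set xs) = \<mm>"
begin

abbreviation "D M \<equiv> koszul_diff M xs"
abbreviation "C M \<equiv> cochains M (length xs)"

lemma D_closed: "module R M \<Longrightarrow> \<forall>bs. f bs \<in> carrier M \<Longrightarrow> D M f bs \<in> carrier M"
  by (rule koszul_diff_closed[OF _ xs_carrier]) auto

lemma D_add:
  "module R M \<Longrightarrow> \<forall>bs. f bs \<in> carrier M \<Longrightarrow> \<forall>bs. g bs \<in> carrier M \<Longrightarrow>
    D M (\<lambda>bs. f bs \<oplus>\<^bsub>M\<^esub> g bs) bs = D M f bs \<oplus>\<^bsub>M\<^esub> D M g bs"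
  by (rule koszul_diff_add[OF _ xs_carrier]) auto

lemma D_minus:
  "module R M \<Longrightarrow> \<forall>bs. f bs \<in> carrier M \<Longrightarrow> \<forall>bs. g bs \<in> carrier M \<Longrightarrow>
    D M (\<lambda>bs. f bs \<ominus>\<^bsub>M\<^esub> g bs) bs = D M f bs \<ominus>\<^bsub>M\<^esub> D M g bs"
  by (rule koszul_diff_minus[OF _ xs_carrier]) auto

lemma D_smult:
  "module R M \<Longrightarrow> \<forall>bs. f bs \<in> carrier M \<Longrightarrow> r \<in> carrier R \<Longrightarrow>
    D M (\<lambda>bs. r \<odot>\<^bsub>M\<^esub> f bs) bs = r \<odot>\<^bsub>M\<^esub> D M f bs"
  by (rule koszul_diff_smult[OF _ xs_carrier]) auto

lemma D_D: "module R M \<Longrightarrow> \<forall>bs. f bs \<in> carrier M \<Longrightarrow> D M (D M f) bs = \<zero>\<^bsub>M\<^esub>"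
  by (rule koszul_diff_diff[OF _ xs_carrier]) auto

text \<open>Vanishing of the \<open>p\<close>-th Koszul cohomology of \<open>Z / U\<close>, without forming the quotient.\<close>

definition vanishes :: "('a, 'c, 'd) module_scheme \<Rightarrow> int \<Rightarrow> 'c set \<Rightarrow> 'c set \<Rightarrow> bool" where
  "vanishes M p Z U \<longleftrightarrow>
    (\<forall>f\<in>C M p Z. D M f \<in> C M (p + 1) U \<longrightarrow>
      (\<exists>g\<in>C M (p - 1) Z. \<exists>u\<in>C M p U. \<forall>bs. f bs = D M g bs \<oplus>\<^bsub>M\<^esub> u bs))"

lemma vanishes_negative:
  assumes "module R M" "p < 0"
  shows "vanishes M p Z U"
proof -
  interpret M: module R M by fact
  show ?thesis
    unfolding vanishes_def using assms(2)
    by (auto simp: cochains_negative koszul_diff_zero[OF assms(1) xs_carrier])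
qed

text \<open>The scalars r for which r f is a boundary modulo U form an ideal, and the homotopies put
  every element of \<open>xs\<close> into it.\<close>

lemma max_ideal_kills_cohomology:
  assumes M: "module R M" and Z: "submodule Z R M" and U: "submodule U R M"
    and f: "f \<in> C M p Z" "D M f \<in> C M (p + 1) U" and r: "r \<in> \<mm>"
  shows "\<exists>g\<in>C M (p - 1) Z. \<exists>u\<in>C M p U. \<forall>bs. r \<odot>\<^bsub>M\<^esub> f bs = D M g bs \<oplus>\<^bsub>M\<^esub> u bs"
proof -
  interpret M: module R M by fact
  note Zc = cochains_carrier[OF M Z] and Uc = cochains_carrier[OF M U]
  note fc = Zc[OF f(1)]
  define I where "I = {r \<in> carrier R. \<exists>g\<in>C M (p - 1) Z. \<exists>u\<in>C M p U. \<forall>bs. r \<odot>\<^bsub>M\<^esub> f bs = D M g bs \<oplus>\<^bsub>M\<^esub> u bs}"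
  have II: "r \<in> I" if "r \<in> carrier R" "g \<in> C M (p - 1) Z" "u \<in> C M p U"
    "\<And>bs. r \<odot>\<^bsub>M\<^esub> f bs = D M g bs \<oplus>\<^bsub>M\<^esub> u bs" for r g u
    using that unfolding I_def by auto
  have zero: "(\<lambda>_. \<zero>\<^bsub>M\<^esub>) \<in> C M q V" if "submodule V R M" for q V
    using submoduleD(2)[OF M that] unfolding cochains_def by simp
  note Dc = D_closed[OF M]
  have "ideal I R"
  proof (rule idealI_cring)
    show "I \<subseteq> carrier R" unfolding I_def by auto
    show "\<zero> \<in> I"
      by (rule II[OF _ zero[OF Z] zero[OF U]]) (use fc in \<open>auto simp: koszul_diff_zero[OF M xs_carrier]\<close>)
  next
    fix a b assume "a \<in> I" "b \<in> I"
    then obtain g u g' u' where *: "a \<in> carrier R" "b \<in> carrier R" "g \<in> C M (p - 1) Z" "u \<in> C M p U"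
      "\<And>bs. a \<odot>\<^bsub>M\<^esub> f bs = D M g bs \<oplus>\<^bsub>M\<^esub> u bs" "g' \<in> C M (p - 1) Z" "u' \<in> C M p U"
      "\<And>bs. b \<odot>\<^bsub>M\<^esub> f bs = D M g' bs \<oplus>\<^bsub>M\<^esub> u' bs" unfolding I_def by auto
    have cl: "D M g bs \<in> carrier M" "u bs \<in> carrier M" "D M g' bs \<in> carrier M" "u' bs \<in> carrier M" for bs
      using Dc[OF Zc[OF *(3)]] Dc[OF Zc[OF *(6)]] Uc[OF *(4)] Uc[OF *(7)] by auto
    show "a \<oplus> b \<in> I"
    proof (rule II[OF _ cochains_add[OF M Z *(3,6)] cochains_add[OF M U *(4,7)]])
      show "(a \<oplus> b) \<odot>\<^bsub>M\<^esub> f bs = D M (\<lambda>bs. g bs \<oplus>\<^bsub>M\<^esub> g' bs) bs \<oplus>\<^bsub>M\<^esub> (u bs \<oplus>\<^bsub>M\<^esub> u' bs)" for bs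
        using *(1,2) fc cl[of bs] *(5,8)[of bs] Zc[OF *(3)] Zc[OF *(6)]
        by (simp add: M.smult_l_distr D_add[OF M] M.a_ac)
    qed (use * in auto)
  next
    fix a c assume "a \<in> I" and c: "c \<in> carrier R"
    then obtain g u where *: "a \<in> carrier R" "g \<in> C M (p - 1) Z" "u \<in> C M p U"
      "\<And>bs. a \<odot>\<^bsub>M\<^esub> f bs = D M g bs \<oplus>\<^bsub>M\<^esub> u bs" unfolding I_def by auto
    have cl: "D M g bs \<in> carrier M" "u bs \<in> carrier M" for bs
      using Dc[OF Zc[OF *(2)]] Uc[OF *(3)] by auto
    show "c \<otimes> a \<in> I"
    proof (rule II[OF _ cochains_smult[OF M Z *(2) c] cochains_smult[OF M U *(3) c]])
      show "(c \<otimes> a) \<odot>\<^bsub>M\<^esub> f bs = D M (\<lambda>bs. c \<odot>\<^bsub>M\<^esub> g bs) bs \<oplus>\<^bsub>M\<^esub> c \<odot>\<^bsub>M\<^esub> u bs" for bs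
        using *(1) c fc cl[of bs] *(4)[of bs] Zc[OF *(2)]
        by (simp add: M.smult_assoc1 D_smult[OF M] M.smult_r_distr)
    qed (use * c in auto)
  qed
  moreover have "set xs \<subseteq> I"
  proof
    fix x assume x: "x \<in> set xs"
    then obtain i where i: "i < length xs" "xs ! i = x" by (auto simp: in_set_conv_nth)
    show "x \<in> I"
    proof (rule II)
      show "koszul_homotopy M i f \<in> C M (p - 1) Z" by (rule koszul_homotopy_cochains[OF M Z i(1) f(1)])
      show "koszul_homotopy M i (D M f) \<in> C M p U"
        using koszul_homotopy_cochains[OF M U i(1) f(2)] by simp
      show "x \<odot>\<^bsub>M\<^esub> f bs = D M (koszul_homotopy M i f) bs \<oplus>\<^bsub>M\<^esub> koszul_homotopy M i (D M f) bs" for bs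
        using koszul_homotopy_identity[OF M xs_carrier _ i(1), of f bs] fc cochainsD(2)[OF f(1)] i(2) by simp
    qed (use x xs_carrier in auto)
  qed
  ultimately have "\<mm> \<subseteq> I" using genideal_minimal xs_generate by metis
  then show ?thesis using r unfolding I_def by auto
qed

section \<open>Reduction modulo a nonzerodivisor\<close>

definition extend_by :: "('a, 'c, 'd) module_scheme \<Rightarrow> 'c set \<Rightarrow> 'a \<Rightarrow> 'c set" where
  "extend_by M U x = {u \<oplus>\<^bsub>M\<^esub> x \<odot>\<^bsub>M\<^esub> b | u b. u \<in> U \<and> b \<in> carrier M}"

lemma extend_byI:
  "u \<in> U \<Longrightarrow> b \<in> carrier M \<Longrightarrow> u \<oplus>\<^bsub>M\<^esub> x \<odot>\<^bsub>M\<^esub> b \<in> extend_by M U x"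
  unfolding extend_by_def by auto

lemma extend_byE:
  assumes "w \<in> extend_by M U x"
  obtains u b where "u \<in> U" "b \<in> carrier M" "w = u \<oplus>\<^bsub>M\<^esub> x \<odot>\<^bsub>M\<^esub> b"
  using assms unfolding extend_by_def by auto

lemma submodule_extend_by:
  assumes M: "module R M" and U: "submodule U R M" and x: "x \<in> carrier R"
  shows "submodule (extend_by M U x) R M" "U \<subseteq> extend_by M U x"
    "\<And>b. b \<in> carrier M \<Longrightarrow> x \<odot>\<^bsub>M\<^esub> b \<in> extend_by M U x"
proof -
  interpret M: module R M by fact
  note u = submoduleD[OF M U]
  show sub: "U \<subseteq> extend_by M U x"
  proof
    fix a assume "a \<in> U"
    with extend_byI[OF this M.zero_closed, of x] u(1) x show "a \<in> extend_by M U x" by simp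
  qed
  show "x \<odot>\<^bsub>M\<^esub> b \<in> extend_by M U x" if "b \<in> carrier M" for b
    using extend_byI[OF u(2) that, of x] that x by simp
  show "submodule (extend_by M U x) R M"
    unfolding submodule_iff[OF M]
  proof (intro conjI ballI)
    show "extend_by M U x \<subseteq> carrier M" unfolding extend_by_def using u(1) x by auto
    show "\<zero>\<^bsub>M\<^esub> \<in> extend_by M U x" using sub u(2) by auto
    fix v w assume "v \<in> extend_by M U x" "w \<in> extend_by M U x"
    then obtain a b a' b' where *: "a \<in> U" "b \<in> carrier M" "v = a \<oplus>\<^bsub>M\<^esub> x \<odot>\<^bsub>M\<^esub> b"
      "a' \<in> U" "b' \<in> carrier M" "w = a' \<oplus>\<^bsub>M\<^esub> x \<odot>\<^bsub>M\<^esub> b'" by (metis extend_byE)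
    have "v \<oplus>\<^bsub>M\<^esub> w = (a \<oplus>\<^bsub>M\<^esub> a') \<oplus>\<^bsub>M\<^esub> x \<odot>\<^bsub>M\<^esub> (b \<oplus>\<^bsub>M\<^esub> b')"
      using * x u(1) by (simp add: M.smult_r_distr M.a_ac)
    moreover have "a \<oplus>\<^bsub>M\<^esub> a' \<in> U" "b \<oplus>\<^bsub>M\<^esub> b' \<in> carrier M" using * u(3) by auto
    ultimately show "v \<oplus>\<^bsub>M\<^esub> w \<in> extend_by M U x" using extend_byI by metis
  next
    fix r w assume r: "r \<in> carrier R" and "w \<in> extend_by M U x"
    then obtain a b where *: "a \<in> U" "b \<in> carrier M" "w = a \<oplus>\<^bsub>M\<^esub> x \<odot>\<^bsub>M\<^esub> b" by (metis extend_byE)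
    have "r \<odot>\<^bsub>M\<^esub> w = r \<odot>\<^bsub>M\<^esub> a \<oplus>\<^bsub>M\<^esub> x \<odot>\<^bsub>M\<^esub> (r \<odot>\<^bsub>M\<^esub> b)"
      using * x u(1) r by (simp add: M.smult_r_distr M.smult_assoc1[symmetric] m_comm)
    moreover have "r \<odot>\<^bsub>M\<^esub> a \<in> U" "r \<odot>\<^bsub>M\<^esub> b \<in> carrier M" using * u(4) r by auto
    ultimately show "r \<odot>\<^bsub>M\<^esub> w \<in> extend_by M U x" using extend_byI by metis
  qed
qed

lemma cochains_extend_by:
  assumes M: "module R M" and U: "submodule U R M" and x: "x \<in> carrier R"
    and w: "w \<in> C M p (extend_by M U x)"
  shows "\<exists>u\<in>C M p U. \<exists>b\<in>C M p (carrier M). \<forall>bs. w bs = u bs \<oplus>\<^bsub>M\<^esub> x \<odot>\<^bsub>M\<^esub> b bs"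
proof -
  interpret M: module R M by fact
  note u = submoduleD[OF M U] and W = submodule_extend_by[OF M U x]
  have "\<exists>b\<in>C M p (carrier M). \<forall>bs. w bs \<ominus>\<^bsub>M\<^esub> x \<odot>\<^bsub>M\<^esub> b bs \<in> U"
  proof (rule cochains_choice[OF w])
    fix v assume "v \<in> extend_by M U x"
    then obtain a b where *: "a \<in> U" "b \<in> carrier M" "v = a \<oplus>\<^bsub>M\<^esub> x \<odot>\<^bsub>M\<^esub> b" by (metis extend_byE)
    have "v \<ominus>\<^bsub>M\<^esub> x \<odot>\<^bsub>M\<^esub> b = a" using * x u(1) by (simp add: a_minus_def M.a_assoc M.r_neg)
    then show "\<exists>b\<in>carrier M. v \<ominus>\<^bsub>M\<^esub> x \<odot>\<^bsub>M\<^esub> b \<in> U" using *(1,2) by metis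
  next
    have "\<zero>\<^bsub>M\<^esub> \<ominus>\<^bsub>M\<^esub> x \<odot>\<^bsub>M\<^esub> \<zero>\<^bsub>M\<^esub> = \<zero>\<^bsub>M\<^esub>" using x M.r_neg[OF M.zero_closed] by (simp add: a_minus_def)
    then show "\<zero>\<^bsub>M\<^esub> \<ominus>\<^bsub>M\<^esub> x \<odot>\<^bsub>M\<^esub> \<zero>\<^bsub>M\<^esub> \<in> U" using u(2) by simp
  qed auto
  then obtain b where b: "b \<in> C M p (carrier M)" "\<And>bs. w bs \<ominus>\<^bsub>M\<^esub> x \<odot>\<^bsub>M\<^esub> b bs \<in> U" by auto
  have wc: "w \<in> C M p (carrier M)"
    using cochains_mono[OF w] submoduleD(1)[OF M W(1)] by blast
  have "(\<lambda>bs. w bs \<ominus>\<^bsub>M\<^esub> x \<odot>\<^bsub>M\<^esub> b bs) \<in> C M p (carrier M)"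
    by (intro cochains_minus[OF M submodule_carrier[OF M] wc] cochains_smult[OF M submodule_carrier[OF M] b(1) x])
  then have "(\<lambda>bs. w bs \<ominus>\<^bsub>M\<^esub> x \<odot>\<^bsub>M\<^esub> b bs) \<in> C M p U" by (rule cochains_restrict) (rule b(2))
  moreover have "w bs = (w bs \<ominus>\<^bsub>M\<^esub> x \<odot>\<^bsub>M\<^esub> b bs) \<oplus>\<^bsub>M\<^esub> x \<odot>\<^bsub>M\<^esub> b bs" for bs
    using cochains_carrier[OF M submodule_carrier[OF M] wc] cochains_carrier[OF M submodule_carrier[OF M] b(1)] x
    by (simp add: a_minus_def M.a_assoc M.l_neg)
  ultimately show ?thesis using b(1) by (intro bexI[of _ "\<lambda>bs. w bs \<ominus>\<^bsub>M\<^esub> x \<odot>\<^bsub>M\<^esub> b bs"] bexI[of _ b]) auto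
qed

definition nonzerodivisor_mod :: "('a, 'c, 'd) module_scheme \<Rightarrow> 'c set \<Rightarrow> 'a \<Rightarrow> bool" where
  "nonzerodivisor_mod M U x \<longleftrightarrow> (\<forall>a\<in>carrier M. x \<odot>\<^bsub>M\<^esub> a \<in> U \<longrightarrow> a \<in> U)"

text \<open>A piece of the long exact sequence of multiplication by x on M/U: H^p(M/(U + xM)) maps
  onto the kernel of x on H^(p+1)(M/U), and that kernel is everything because the maximal ideal
  annihilates cohomology.\<close>

lemma vanishes_Suc_of_extend_by:
  assumes M: "module R M" and U: "submodule U R M" and x: "x \<in> \<mm>" "nonzerodivisor_mod M U x"
    and van: "vanishes M p (carrier M) (extend_by M U x)"
  shows "vanishes M (p + 1) (carrier M) U"
  unfolding vanishes_def
proof (intro ballI impI)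
  interpret M: module R M by fact
  note cM = submodule_carrier[OF M]
  have xc: "x \<in> carrier R" using x(1) mm.Icarr by auto
  note W = submodule_extend_by[OF M U xc]
  note Mc = cochains_carrier[OF M cM] and Uc = cochains_carrier[OF M U] and Dc = D_closed[OF M]
  fix f assume f: "f \<in> C M (p + 1) (carrier M)" "D M f \<in> C M (p + 1 + 1) U"
  obtain g u where gu: "g \<in> C M p (carrier M)" "u \<in> C M (p + 1) U"
    "\<And>bs. x \<odot>\<^bsub>M\<^esub> f bs = D M g bs \<oplus>\<^bsub>M\<^esub> u bs"
    using max_ideal_kills_cohomology[OF M cM U f x(1)] by auto
  have Dg: "D M g bs = (\<ominus>\<^bsub>M\<^esub> u bs) \<oplus>\<^bsub>M\<^esub> x \<odot>\<^bsub>M\<^esub> f bs" for bs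
    using Dc[OF Mc[OF gu(1)], of bs] Uc[OF gu(2)] unfolding gu(3)
    by (simp add: M.a_ac M.r_neg1 M.r_neg2)
  \<comment> \<open>The relation x f = D g + u, read modulo U + xM, makes \<open>g\<close> a cocycle
    there, to which the hypothesis in degree \<open>p\<close> applies.\<close>
  have "D M g bs \<in> extend_by M U x" for bs
    unfolding Dg
    by (intro extend_byI submoduleD(5)[OF M U] spec[OF Mc[OF f(1)]] cochains_mem[OF gu(2)] submoduleD(2)[OF M U])
  then have "D M g \<in> C M (p + 1) (extend_by M U x)"
    using cochains_restrict[OF koszul_diff_cochains[OF M xs_carrier cM gu(1)]] by blast
  then obtain h w where hw: "h \<in> C M (p - 1) (carrier M)" "w \<in> C M p (extend_by M U x)"
    "\<And>bs. g bs = D M h bs \<oplus>\<^bsub>M\<^esub> w bs"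
    using van gu(1) unfolding vanishes_def by blast
  obtain u' b where ub: "u' \<in> C M p U" "b \<in> C M p (carrier M)"
    "\<And>bs. w bs = u' bs \<oplus>\<^bsub>M\<^esub> x \<odot>\<^bsub>M\<^esub> b bs"
    using cochains_extend_by[OF M U xc hw(2)] by blast
  note cl = Mc[OF f(1)] Uc[OF gu(2)] Mc[OF hw(1)] Uc[OF ub(1)] Mc[OF ub(2)]
  have xb: "\<forall>bs. x \<odot>\<^bsub>M\<^esub> b bs \<in> carrier M" using cl xc by auto
  have wc: "\<forall>bs. w bs \<in> carrier M" using ub(3) cl xc by auto
  have "g = (\<lambda>bs. D M h bs \<oplus>\<^bsub>M\<^esub> w bs)" using hw(3) by auto
  moreover have "D M (\<lambda>bs. D M h bs \<oplus>\<^bsub>M\<^esub> w bs) bs = D M (D M h) bs \<oplus>\<^bsub>M\<^esub> D M w bs" for bs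
    by (rule D_add[OF M]) (use Dc[OF cl(3)] wc in auto)
  ultimately have "D M g bs = D M w bs" for bs
    using D_D[OF M cl(3)] Dc[OF wc] by simp
  moreover have "w = (\<lambda>bs. u' bs \<oplus>\<^bsub>M\<^esub> x \<odot>\<^bsub>M\<^esub> b bs)" using ub(3) by auto
  then have "D M w bs = D M u' bs \<oplus>\<^bsub>M\<^esub> x \<odot>\<^bsub>M\<^esub> D M b bs" for bs
    using D_add[OF M cl(4) xb, of bs] D_smult[OF M cl(5) xc, of bs] by simp
  ultimately have Dg2: "D M g bs = D M u' bs \<oplus>\<^bsub>M\<^esub> x \<odot>\<^bsub>M\<^esub> D M b bs" for bs by simp
  \<comment> \<open>The difference \<open>v\<close> has x v = D u' + u in U, and x can be cancelled
    modulo U. Hence \<open>f\<close> is the boundary of \<open>b\<close> up to values in U.\<close>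
  define v where "v bs = f bs \<ominus>\<^bsub>M\<^esub> D M b bs" for bs
  have vC: "v \<in> C M (p + 1) (carrier M)"
    unfolding v_def using cochains_minus[OF M cM f(1) koszul_diff_cochains[OF M xs_carrier cM ub(2)]] .
  have "v bs \<in> U" for bs
  proof -
    have Db: "D M b bs \<in> carrier M" "D M u' bs \<in> carrier M" using Dc[OF cl(4)] Dc[OF cl(5)] by auto
    have "x \<odot>\<^bsub>M\<^esub> v bs = x \<odot>\<^bsub>M\<^esub> f bs \<ominus>\<^bsub>M\<^esub> x \<odot>\<^bsub>M\<^esub> D M b bs"
      unfolding v_def using xc cl Db by (simp add: a_minus_def M.smult_r_distr M.smult_r_minus)
    also have "\<dots> = D M u' bs \<oplus>\<^bsub>M\<^esub> u bs"
      unfolding gu(3) Dg2 using xc cl Db by (simp add: a_minus_def M.a_ac M.r_neg1 M.r_neg2 M.r_neg)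
    also have "\<dots> \<in> U"
      by (intro submoduleD(3)[OF M U] cochains_mem[OF gu(2)]
          cochains_mem[OF koszul_diff_cochains[OF M xs_carrier U ub(1)]] submoduleD(2)[OF M U])
    finally show ?thesis using x(2) Mc[OF vC] unfolding nonzerodivisor_mod_def by blast
  qed
  then have "v \<in> C M (p + 1) U" using cochains_restrict[OF vC] by blast
  moreover have "f bs = D M b bs \<oplus>\<^bsub>M\<^esub> v bs" for bs
    unfolding v_def using cl Dc[OF cl(5)] by (simp add: a_minus_def M.a_ac M.r_neg1 M.r_neg2 M.r_neg)
  ultimately show "\<exists>g\<in>C M (p + 1 - 1) (carrier M). \<exists>u\<in>C M (p + 1) U. \<forall>bs. f bs = D M g bs \<oplus>\<^bsub>M\<^esub> u bs"
    using ub(2) by auto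
qed

text \<open>The neighbouring piece of the same sequence: H^p(M/(U + xM)) sits between H^p(M/U) and
  H^(p+1)(M/U), so it vanishes when both do.\<close>

lemma vanishes_extend_by:
  assumes M: "module R M" and U: "submodule U R M" and x: "x \<in> \<mm>" "nonzerodivisor_mod M U x"
    and van: "vanishes M p (carrier M) U" "vanishes M (p + 1) (carrier M) U"
  shows "vanishes M p (carrier M) (extend_by M U x)"
  unfolding vanishes_def
proof (intro ballI impI)
  interpret M: module R M by fact
  note cM = submodule_carrier[OF M]
  have xc: "x \<in> carrier R" using x(1) mm.Icarr by auto
  note W = submodule_extend_by[OF M U xc]
  note Mc = cochains_carrier[OF M cM] and Uc = cochains_carrier[OF M U] and Dc = D_closed[OF M]
  fix f assume f: "f \<in> C M p (carrier M)" "D M f \<in> C M (p + 1) (extend_by M U x)"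
  obtain u b where ub: "u \<in> C M (p + 1) U" "b \<in> C M (p + 1) (carrier M)"
    "\<And>bs. D M f bs = u bs \<oplus>\<^bsub>M\<^esub> x \<odot>\<^bsub>M\<^esub> b bs"
    using cochains_extend_by[OF M U xc f(2)] by blast
  note cl = Mc[OF f(1)] Uc[OF ub(1)] Mc[OF ub(2)]
  have xb: "\<forall>bs. x \<odot>\<^bsub>M\<^esub> b bs \<in> carrier M" using cl xc by auto
  have Db: "D M b \<in> C M (p + 1 + 1) (carrier M)" by (rule koszul_diff_cochains[OF M xs_carrier cM ub(2)])
  have Du: "D M u \<in> C M (p + 1 + 1) U" by (rule koszul_diff_cochains[OF M xs_carrier U ub(1)])
  \<comment> \<open>From D f = u + x b and D D f = 0 it follows that x D b lies in U, and cancelling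
    x makes \<open>b\<close> a cocycle modulo U. Its class is the image of \<open>f\<close> under
    the connecting map.\<close>
  have "D M b bs \<in> U" for bs
  proof -
    have "D M (D M f) bs = \<zero>\<^bsub>M\<^esub>" by (rule D_D[OF M cl(1)])
    moreover have "D M f = (\<lambda>bs. u bs \<oplus>\<^bsub>M\<^esub> x \<odot>\<^bsub>M\<^esub> b bs)" using ub(3) by auto
    ultimately have "D M u bs \<oplus>\<^bsub>M\<^esub> x \<odot>\<^bsub>M\<^esub> D M b bs = \<zero>\<^bsub>M\<^esub>"
      using D_add[OF M cl(2) xb, of bs] D_smult[OF M cl(3) xc, of bs] by simp
    then have "x \<odot>\<^bsub>M\<^esub> D M b bs = \<ominus>\<^bsub>M\<^esub> D M u bs"
      using Dc[OF cl(2), of bs] Dc[OF cl(3), of bs] xc M.minus_equality[of "x \<odot>\<^bsub>M\<^esub> D M b bs" "D M u bs"] by (simp add: M.a_comm)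
    also have "\<dots> \<in> U"
      by (intro submoduleD(5)[OF M U] cochains_mem[OF Du] submoduleD(2)[OF M U])
    finally show ?thesis using x(2) Dc[OF cl(3)] unfolding nonzerodivisor_mod_def by blast
  qed
  then have "D M b \<in> C M (p + 1 + 1) U" using cochains_restrict[OF Db] by blast
  then obtain c u' where c: "c \<in> C M p (carrier M)" "u' \<in> C M (p + 1) U"
    "\<And>bs. b bs = D M c bs \<oplus>\<^bsub>M\<^esub> u' bs"
    using van(2) ub(2) unfolding vanishes_def by auto
  note cl2 = Mc[OF c(1)] Uc[OF c(2)]
  have xcc: "\<forall>bs. x \<odot>\<^bsub>M\<^esub> c bs \<in> carrier M" using cl2 xc by auto
  \<comment> \<open>With \<open>c\<close> bounding \<open>b\<close> modulo U, subtracting x c turns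
    \<open>f\<close> into a cocycle modulo U and does not change it modulo U + xM.\<close>
  define e where "e = (\<lambda>bs. f bs \<ominus>\<^bsub>M\<^esub> x \<odot>\<^bsub>M\<^esub> c bs)"
  have eC: "e \<in> C M p (carrier M)"
    unfolding e_def by (rule cochains_minus[OF M cM f(1) cochains_smult[OF M cM c(1) xc]])
  have "D M e bs = u bs \<oplus>\<^bsub>M\<^esub> x \<odot>\<^bsub>M\<^esub> u' bs" for bs
  proof -
    have "D M e bs = D M f bs \<ominus>\<^bsub>M\<^esub> x \<odot>\<^bsub>M\<^esub> D M c bs"
      unfolding e_def using D_minus[OF M cl(1) xcc, of bs]
        D_smult[OF M cl2(1) xc, of bs] by simp
    then show ?thesis
      unfolding ub(3) c(3) using xc cl cl2 Dc[OF cl2(1), of bs]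
      by (simp add: a_minus_def M.smult_r_distr M.a_ac M.r_neg1 M.r_neg2 M.r_neg)
  qed
  moreover have "u bs \<oplus>\<^bsub>M\<^esub> x \<odot>\<^bsub>M\<^esub> u' bs \<in> U" for bs
    by (intro submoduleD(3,4)[OF M U] cochains_mem[OF ub(1)] cochains_mem[OF c(2)] submoduleD(2)[OF M U] xc)
  ultimately have "D M e \<in> C M (p + 1) U"
    using cochains_restrict[OF koszul_diff_cochains[OF M xs_carrier cM eC]] by simp
  then obtain g v where g: "g \<in> C M (p - 1) (carrier M)" "v \<in> C M p U" "\<And>bs. e bs = D M g bs \<oplus>\<^bsub>M\<^esub> v bs"
    using van(1) eC unfolding vanishes_def by blast
  have "(\<lambda>bs. v bs \<oplus>\<^bsub>M\<^esub> x \<odot>\<^bsub>M\<^esub> c bs) \<in> C M p (extend_by M U x)"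
  proof (rule cochains_restrict)
    show "(\<lambda>bs. v bs \<oplus>\<^bsub>M\<^esub> x \<odot>\<^bsub>M\<^esub> c bs) \<in> C M p (carrier M)"
      using cochains_mono[OF g(2)] submoduleD(1)[OF M U]
      by (intro cochains_add[OF M cM _ cochains_smult[OF M cM c(1) xc]]) blast
    show "v bs \<oplus>\<^bsub>M\<^esub> x \<odot>\<^bsub>M\<^esub> c bs \<in> extend_by M U x" for bs
      by (intro extend_byI spec[OF cl2(1)] cochains_mem[OF g(2)] submoduleD(2)[OF M U])
  qed
  moreover have "f bs = D M g bs \<oplus>\<^bsub>M\<^esub> (v bs \<oplus>\<^bsub>M\<^esub> x \<odot>\<^bsub>M\<^esub> c bs)" for bs
  proof -
    have cl3: "D M g bs \<in> carrier M" "v bs \<in> carrier M" "f bs \<in> carrier M" "x \<odot>\<^bsub>M\<^esub> c bs \<in> carrier M"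
      using Dc[OF Mc[OF g(1)]] Uc[OF g(2)] cl xcc by auto
    have "f bs = e bs \<oplus>\<^bsub>M\<^esub> x \<odot>\<^bsub>M\<^esub> c bs"
      unfolding e_def using cl3 by (simp add: a_minus_def M.a_assoc M.l_neg)
    then show ?thesis unfolding g(3) using cl3 by (simp add: M.a_assoc)
  qed
  ultimately show "\<exists>g\<in>C M (p - 1) (carrier M). \<exists>u\<in>C M p (extend_by M U x). \<forall>bs. f bs = D M g bs \<oplus>\<^bsub>M\<^esub> u bs"
    using g(1) by (intro bexI[of _ g] bexI[of _ "\<lambda>bs. v bs \<oplus>\<^bsub>M\<^esub> x \<odot>\<^bsub>M\<^esub> c bs"]) auto
qed

text \<open>Koszul cohomology of M/U in degree 0 is its socle: the cochain with the single value u
  is a cocycle modulo U, and there is no nonzero boundary in degree 0.\<close>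

lemma socle_not_vanishes:
  assumes M: "module R M" and U: "submodule U R M"
    and u: "u \<in> carrier M" "u \<notin> U" "\<And>x. x \<in> \<mm> \<Longrightarrow> x \<odot>\<^bsub>M\<^esub> u \<in> U"
  shows "\<not> vanishes M 0 (carrier M) U"
proof
  assume van: "vanishes M 0 (carrier M) U"
  interpret M: module R M by fact
  \<comment> \<open>The preimage in M of the socle of M/U.\<close>
  define Z where "Z = {z \<in> carrier M. \<forall>x\<in>\<mm>. x \<odot>\<^bsub>M\<^esub> z \<in> U}"
  note us = submoduleD[OF M U]
  have Z: "submodule Z R M"
    unfolding submodule_iff[OF M]
  proof (intro conjI ballI)
    show "Z \<subseteq> carrier M" unfolding Z_def by auto
    show "\<zero>\<^bsub>M\<^esub> \<in> Z" unfolding Z_def using us(2) mm.Icarr by auto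
    show "a \<oplus>\<^bsub>M\<^esub> b \<in> Z" if "a \<in> Z" "b \<in> Z" for a b
      using that us(3) mm.Icarr unfolding Z_def by (auto simp: M.smult_r_distr)
    show "r \<odot>\<^bsub>M\<^esub> b \<in> Z" if "r \<in> carrier R" "b \<in> Z" for r b
      using that mm.I_r_closed mm.Icarr unfolding Z_def by (auto simp: M.smult_assoc1[symmetric])
  qed
  have uZ: "u \<in> Z" unfolding Z_def using u by auto
  define f where "f bs = (if bs = replicate (length xs) False then u else \<zero>\<^bsub>M\<^esub>)" for bs
  have cnt: "count_list (replicate n False) True = 0" for n by (induction n) auto
  have cnt2: "bs = replicate (length bs) False" if "count_list bs True = 0" for bs
    using that by (induction bs) (auto split: if_splits)
  have f: "f \<in> C M 0 Z"
    unfolding f_def cochains_def using uZ submoduleD(2)[OF M Z] by (auto simp: cnt)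
  then have fM: "f \<in> C M 0 (carrier M)" using cochains_mono[OF f] submoduleD(1)[OF M Z] by blast
  have xm: "x \<in> \<mm>" if "x \<in> set xs" for x using genideal_self[OF xs_carrier] that xs_generate by auto
  have "D M f \<in> C M (0 + 1) U"
    by (rule koszul_diff_cochains_socle[OF M xs_carrier Z U _ f]) (use xm in \<open>auto simp: Z_def\<close>)
  then obtain g v where g: "g \<in> C M (0 - 1) (carrier M)" "v \<in> C M 0 U" "\<And>bs. f bs = D M g bs \<oplus>\<^bsub>M\<^esub> v bs"
    using van fM unfolding vanishes_def by blast
  have "g = (\<lambda>_. \<zero>\<^bsub>M\<^esub>)" using g(1) cochains_negative[of "0 - 1" g M] by simp
  then have "f (replicate (length xs) False) = v (replicate (length xs) False)"
    using g(3) koszul_diff_zero[OF M xs_carrier] cochains_carrier[OF M U g(2)] by simp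
  then have "u \<in> U" using cochains_mem[OF g(2) us(2)] unfolding f_def by auto
  then show False using u(2) by simp
qed

section \<open>Depth as the least degree of nonzero Koszul cohomology\<close>

definition cohomological_depth :: "('a, 'c, 'd) module_scheme \<Rightarrow> 'c set \<Rightarrow> int \<Rightarrow> bool" where
  "cohomological_depth M U e \<longleftrightarrow>
    (\<forall>p<e. vanishes M p (carrier M) U) \<and> \<not> vanishes M e (carrier M) U"

lemma cohomological_depth_unique:
  "cohomological_depth M U e \<Longrightarrow> cohomological_depth M U e' \<Longrightarrow> e = e'"
  unfolding cohomological_depth_def by (meson linorder_neqE)

lemma cohomological_depth_nonneg:
  "module R M \<Longrightarrow> cohomological_depth M U e \<Longrightarrow> e \<ge> 0"
  unfolding cohomological_depth_def using vanishes_negative by force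

text \<open>One piece of the long exact sequence gives the vanishing in degrees up to e. If degree e
  + 1 vanished as well, the other piece would force the cohomology of M/(U + xM) in degree e to
  vanish.\<close>

lemma cohomological_depth_extend_by:
  assumes M: "module R M" and U: "submodule U R M" and x: "x \<in> \<mm>" "nonzerodivisor_mod M U x"
    and e: "cohomological_depth M (extend_by M U x) e"
  shows "cohomological_depth M U (e + 1)"
  unfolding cohomological_depth_def
proof
  have v: "vanishes M p (carrier M) U" if "p < e + 1" for p
  proof -
    have "vanishes M (p - 1) (carrier M) (extend_by M U x)"
      using e that unfolding cohomological_depth_def by auto
    from vanishes_Suc_of_extend_by[OF M U x this] show ?thesis by simp
  qed
  then show "\<forall>p<e + 1. vanishes M p (carrier M) U" by blast
  show "\<not> vanishes M (e + 1) (carrier M) U"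
    using vanishes_extend_by[OF M U x v[of e]] e unfolding cohomological_depth_def by auto
qed

lemma extend_by_proper:
  assumes M: "module R M" and fg: "finitely_generated R M" and U: "submodule U R M" "U \<noteq> carrier M" and x: "x \<in> \<mm>"
  shows "extend_by M U x \<noteq> carrier M"
proof
  assume "extend_by M U x = carrier M"
  then have "U = carrier M"
    by (intro nakayama[OF M fg U(1) x]) (metis extend_byE)
  then show False using U(2) by simp
qed

text \<open>Noetherian induction on U. A nonzerodivisor x in the maximal ideal leads to U + xM,
  which is strictly larger than U and still proper by Nakayama's lemma; if there is none, the socle
  of M/U is nonzero and the depth is 0.\<close>

lemma cohomological_depth_exists:
  assumes M: "module R M" and fg: "finitely_generated R M" and U: "submodule U R M" "U \<noteq> carrier M"
  shows "\<exists>e. cohomological_depth M U e"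
proof (rule ccontr)
  assume no: "\<not> (\<exists>e. cohomological_depth M U e)"
  interpret M: module R M by fact
  define \<X> where "\<X> = {V. submodule V R M \<and> V \<noteq> carrier M \<and> \<not> (\<exists>e. cohomological_depth M V e)}"
  have "\<X> \<noteq> {}" using no U unfolding \<X>_def by auto
  moreover have "submodule V R M" if "V \<in> \<X>" for V using that unfolding \<X>_def by simp
  ultimately have "\<exists>V\<in>\<X>. \<forall>W\<in>\<X>. V \<subseteq> W \<longrightarrow> W = V"
    by (rule noetherian_maximal_submodule[OF noetherian M fg])
  then obtain V where V: "V \<in> \<X>" "\<And>W. W \<in> \<X> \<Longrightarrow> V \<subseteq> W \<Longrightarrow> W = V" by auto
  have Vs: "submodule V R M" "V \<noteq> carrier M" "\<And>e. \<not> cohomological_depth M V e" using V(1) unfolding \<X>_def by auto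
  note vs = submoduleD[OF M Vs(1)]
  show False
  proof (cases "\<exists>x\<in>\<mm>. nonzerodivisor_mod M V x")
    case True
    then obtain x where x: "x \<in> \<mm>" "nonzerodivisor_mod M V x" by auto
    note W = submodule_extend_by[OF M Vs(1) mm.Icarr[OF x(1)]]
    have "extend_by M V x \<notin> \<X>"
    proof
      assume "extend_by M V x \<in> \<X>"
      then have eq: "extend_by M V x = V" using V(2) W(2) by auto
      obtain a where a: "a \<in> carrier M" "a \<notin> V" using Vs(2) vs(1) by blast
      then have "x \<odot>\<^bsub>M\<^esub> a \<in> V" using W(3) eq by auto
      then show False using x(2) a unfolding nonzerodivisor_mod_def by auto
    qed
    then obtain e where "cohomological_depth M (extend_by M V x) e"
      using W(1) extend_by_proper[OF M fg Vs(1,2) x(1)] unfolding \<X>_def by auto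
    then show False using cohomological_depth_extend_by[OF M Vs(1) x] Vs(3) by blast
  next
    case False
    then have "\<exists>a\<in>carrier M. a \<notin> V \<and> x \<odot>\<^bsub>M\<^esub> a \<in> V" if "x \<in> \<mm>" for x
      using that unfolding nonzerodivisor_mod_def by auto
    then obtain u where u: "u \<in> carrier M" "u \<notin> V" "\<forall>x\<in>\<mm>. x \<odot>\<^bsub>M\<^esub> u \<in> V"
      using socle_of_zero_divisors[OF M fg Vs(1)] by blast
    then have "\<not> vanishes M 0 (carrier M) V" using socle_not_vanishes[OF M Vs(1)] by blast
    then have "cohomological_depth M V 0"
      unfolding cohomological_depth_def using vanishes_negative[OF M] by auto
    then show False using Vs(3) by blast
  qed
qed

text \<open>Without such an x the socle of M/U is nonzero, and then so is the cohomology in degree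
  0.\<close>

lemma nonzerodivisor_of_positive_depth:
  assumes M: "module R M" and fg: "finitely_generated R M" and U: "submodule U R M"
    and e: "cohomological_depth M U e" "e > 0"
  shows "\<exists>x\<in>\<mm>. nonzerodivisor_mod M U x"
proof (rule ccontr)
  assume "\<not> ?thesis"
  then have "\<exists>a\<in>carrier M. a \<notin> U \<and> x \<odot>\<^bsub>M\<^esub> a \<in> U" if "x \<in> \<mm>" for x
    using that unfolding nonzerodivisor_mod_def by auto
  then obtain u where u: "u \<in> carrier M" "u \<notin> U" "\<forall>x\<in>\<mm>. x \<odot>\<^bsub>M\<^esub> u \<in> U"
    using socle_of_zero_divisors[OF M fg U] by blast
  then have "\<not> vanishes M 0 (carrier M) U" using socle_not_vanishes[OF M U] by blast
  then show False using e unfolding cohomological_depth_def by auto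
qed

end

section \<open>Quotient modules\<close>

lemma coset_eq_iff:
  assumes M: "module R M" and U: "submodule U R M" and a: "a \<in> carrier M" and b: "b \<in> carrier M"
  shows "U +>\<^bsub>M\<^esub> a = U +>\<^bsub>M\<^esub> b \<longleftrightarrow> (\<exists>u\<in>U. a = u \<oplus>\<^bsub>M\<^esub> b)"
proof
  interpret M: module R M by fact
  note u = submoduleD[OF M U]
  show "\<exists>u\<in>U. a = u \<oplus>\<^bsub>M\<^esub> b" if "U +>\<^bsub>M\<^esub> a = U +>\<^bsub>M\<^esub> b"
  proof -
    have "\<zero>\<^bsub>M\<^esub> \<oplus>\<^bsub>M\<^esub> a \<in> U +>\<^bsub>M\<^esub> a" unfolding a_r_coset_def' using u(2) by blast
    then have "a \<in> U +>\<^bsub>M\<^esub> b" using a that by simp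
    then show ?thesis unfolding a_r_coset_def' by auto
  qed
  assume "\<exists>u\<in>U. a = u \<oplus>\<^bsub>M\<^esub> b"
  then obtain w where w: "w \<in> U" "a = w \<oplus>\<^bsub>M\<^esub> b" by auto
  have wc: "w \<in> carrier M" using u(1) w by auto
  show "U +>\<^bsub>M\<^esub> a = U +>\<^bsub>M\<^esub> b"
  proof (intro equalityI subsetI)
    fix x assume "x \<in> U +>\<^bsub>M\<^esub> a"
    then obtain v where v: "v \<in> U" "x = v \<oplus>\<^bsub>M\<^esub> a" unfolding a_r_coset_def' by auto
    have "x = (v \<oplus>\<^bsub>M\<^esub> w) \<oplus>\<^bsub>M\<^esub> b" using v w wc b u(1) by (simp add: M.a_assoc)
    then show "x \<in> U +>\<^bsub>M\<^esub> b" unfolding a_r_coset_def' using u(3)[OF v(1) w(1)] by blast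
  next
    fix x assume "x \<in> U +>\<^bsub>M\<^esub> b"
    then obtain v where v: "v \<in> U" "x = v \<oplus>\<^bsub>M\<^esub> b" unfolding a_r_coset_def' by auto
    have "x = (v \<ominus>\<^bsub>M\<^esub> w) \<oplus>\<^bsub>M\<^esub> a"
      using v w wc b u(1) by (simp add: a_minus_def M.a_ac M.r_neg M.r_neg1 M.r_neg2)
    then show "x \<in> U +>\<^bsub>M\<^esub> a" unfolding a_r_coset_def' using u(6)[OF v(1) w(1)] by blast
  qed
qed

lemma quotient_module_simps:
  assumes M: "module R M" and U: "submodule U R M"
  shows "carrier (quotient_module M U) = (\<lambda>a. U +>\<^bsub>M\<^esub> a) ` carrier M"
    and "\<zero>\<^bsub>quotient_module M U\<^esub> = U"
    and "a \<in> carrier M \<Longrightarrow> U +>\<^bsub>M\<^esub> a = U \<longleftrightarrow> a \<in> U"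
    and "a \<in> carrier M \<Longrightarrow> b \<in> carrier M \<Longrightarrow>
      (U +>\<^bsub>M\<^esub> a) \<oplus>\<^bsub>quotient_module M U\<^esub> (U +>\<^bsub>M\<^esub> b) = U +>\<^bsub>M\<^esub> (a \<oplus>\<^bsub>M\<^esub> b)"
    and "r \<in> carrier R \<Longrightarrow> a \<in> carrier M \<Longrightarrow>
      r \<odot>\<^bsub>quotient_module M U\<^esub> (U +>\<^bsub>M\<^esub> a) = U +>\<^bsub>M\<^esub> (r \<odot>\<^bsub>M\<^esub> a)"
proof -
  interpret M: module R M by fact
  note u = submoduleD[OF M U]
  show "carrier (quotient_module M U) = (\<lambda>a. U +>\<^bsub>M\<^esub> a) ` carrier M"
    unfolding quotient_module_def A_RCOSETS_def' by auto
  show "\<zero>\<^bsub>quotient_module M U\<^esub> = U" unfolding quotient_module_def by simp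
  have U0: "U +>\<^bsub>M\<^esub> \<zero>\<^bsub>M\<^esub> = U" unfolding a_r_coset_def' using u(1) by force
  show "U +>\<^bsub>M\<^esub> a = U \<longleftrightarrow> a \<in> U" if "a \<in> carrier M"
  proof -
    have "U +>\<^bsub>M\<^esub> a = U \<longleftrightarrow> (\<exists>v\<in>U. a = v \<oplus>\<^bsub>M\<^esub> \<zero>\<^bsub>M\<^esub>)"
      using coset_eq_iff[OF M U that M.zero_closed] U0 by simp
    also have "\<dots> \<longleftrightarrow> a \<in> U" using u(1) by auto
    finally show ?thesis .
  qed
  have as: "abelian_subgroup U M"
    using U M.abelian_group_axioms by (intro abelian_subgroupI3 additive_subgroup.intro) (auto simp: submodule_def)
  show "(U +>\<^bsub>M\<^esub> a) \<oplus>\<^bsub>quotient_module M U\<^esub> (U +>\<^bsub>M\<^esub> b) = U +>\<^bsub>M\<^esub> (a \<oplus>\<^bsub>M\<^esub> b)"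
    if "a \<in> carrier M" "b \<in> carrier M"
    using abelian_subgroup.a_rcos_sum[OF as that] by (simp add: quotient_module_def)
  show "r \<odot>\<^bsub>quotient_module M U\<^esub> (U +>\<^bsub>M\<^esub> a) = U +>\<^bsub>M\<^esub> (r \<odot>\<^bsub>M\<^esub> a)"
    if r: "r \<in> carrier R" and a: "a \<in> carrier M"
  proof -
    have "U +>\<^bsub>M\<^esub> (r \<odot>\<^bsub>M\<^esub> x) = U +>\<^bsub>M\<^esub> (r \<odot>\<^bsub>M\<^esub> a)" if x: "x \<in> U +>\<^bsub>M\<^esub> a" for x
    proof -
      obtain v where v: "v \<in> U" "x = v \<oplus>\<^bsub>M\<^esub> a" using x unfolding a_r_coset_def' by auto
      then have "r \<odot>\<^bsub>M\<^esub> x = r \<odot>\<^bsub>M\<^esub> v \<oplus>\<^bsub>M\<^esub> r \<odot>\<^bsub>M\<^esub> a" using r a u(1) by (simp add: M.smult_r_distr)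
      then show ?thesis
        using coset_eq_iff[OF M U, of "r \<odot>\<^bsub>M\<^esub> x" "r \<odot>\<^bsub>M\<^esub> a"] u(4)[OF r v(1)] v u(1) r a by auto
    qed
    moreover have "\<zero>\<^bsub>M\<^esub> \<oplus>\<^bsub>M\<^esub> a \<in> U +>\<^bsub>M\<^esub> a" unfolding a_r_coset_def' using u(2) by blast
    ultimately show ?thesis unfolding quotient_module_def by auto
  qed
qed

lemma zero_module_quotient_iff:
  assumes M: "module R M" and U: "submodule U R M"
  shows "zero_module (quotient_module M U) \<longleftrightarrow> U = carrier M"
proof -
  interpret M: module R M by fact
  note q = quotient_module_simps[OF M U] and u = submoduleD[OF M U]
  have "zero_module (quotient_module M U) \<longleftrightarrow> (\<forall>a\<in>carrier M. U +>\<^bsub>M\<^esub> a = U)"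
    unfolding zero_module_def q(1,2) using M.zero_closed by auto
  also have "\<dots> \<longleftrightarrow> (\<forall>a\<in>carrier M. a \<in> U)" using q(3) by auto
  also have "\<dots> \<longleftrightarrow> U = carrier M" using u(1) by auto
  finally show ?thesis .
qed

section \<open>Quotients isomorphic to direct powers, described by coordinates\<close>

lemma direct_power_simps:
  "f \<in> carrier (direct_power M n) \<longleftrightarrow> f \<in> {..<n} \<rightarrow>\<^sub>E carrier M"
  "\<zero>\<^bsub>direct_power M n\<^esub> = (\<lambda>i\<in>{..<n}. \<zero>\<^bsub>M\<^esub>)"
  "f \<oplus>\<^bsub>direct_power M n\<^esub> g = (\<lambda>i\<in>{..<n}. f i \<oplus>\<^bsub>M\<^esub> g i)"
  "r \<odot>\<^bsub>direct_power M n\<^esub> f = (\<lambda>i\<in>{..<n}. r \<odot>\<^bsub>M\<^esub> f i)"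
  unfolding direct_power_def by auto

text \<open>An isomorphism \<open>N / B \<cong> M\<^sup>n\<close>, given by its \<open>n\<close> coordinates as maps on \<open>N\<close>.\<close>

definition power_coordinates ::
    "('a, 'r) ring_scheme \<Rightarrow> ('a, 'b, 'd) module_scheme \<Rightarrow> 'b set \<Rightarrow> ('a, 'c, 'e) module_scheme \<Rightarrow> nat
      \<Rightarrow> (nat \<Rightarrow> 'b \<Rightarrow> 'c) \<Rightarrow> bool" where
  "power_coordinates R N B M n \<theta> \<longleftrightarrow>
    (\<forall>i<n. \<theta> i \<in> module_homs R N M) \<and>
    (\<forall>m. (\<forall>i<n. m i \<in> carrier M) \<longrightarrow> (\<exists>z\<in>carrier N. \<forall>i<n. \<theta> i z = m i)) \<and>
    (\<forall>z\<in>carrier N. (\<forall>i<n. \<theta> i z = \<zero>\<^bsub>M\<^esub>) \<longleftrightarrow> z \<in> B)"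

lemma power_coordinatesD:
  assumes "power_coordinates R N B M n \<theta>"
  shows "i < n \<Longrightarrow> \<theta> i \<in> module_homs R N M"
    and "(\<And>i. i < n \<Longrightarrow> m i \<in> carrier M) \<Longrightarrow> \<exists>z\<in>carrier N. \<forall>i<n. \<theta> i z = m i"
    and "z \<in> carrier N \<Longrightarrow> (\<forall>i<n. \<theta> i z = \<zero>\<^bsub>M\<^esub>) \<longleftrightarrow> z \<in> B"
  using assms unfolding power_coordinates_def by auto

lemma power_coordinates_of_iso:
  assumes N: "module R N" and B: "submodule B R N" and M: "module R M"
    and iso: "module_iso R (quotient_module N B) (direct_power M n)"
  shows "\<exists>\<theta>. power_coordinates R N B M n \<theta>"
proof -
  interpret N: module R N by fact
  interpret M: module R M by fact
  note q = quotient_module_simps[OF N B] and dp = direct_power_simps[where M = M and n = n]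
  obtain \<phi> where \<phi>: "\<phi> \<in> module_homs R (quotient_module N B) (direct_power M n)"
    "bij_betw \<phi> (carrier (quotient_module N B)) (carrier (direct_power M n))"
    using iso unfolding module_iso_def by auto
  note h = module_homsD[OF \<phi>(1)]
  have qc: "B +>\<^bsub>N\<^esub> z \<in> carrier (quotient_module N B)" if "z \<in> carrier N" for z
    using that unfolding q(1) by auto
  have \<phi>c: "\<phi> (B +>\<^bsub>N\<^esub> z) \<in> {..<n} \<rightarrow>\<^sub>E carrier M" if "z \<in> carrier N" for z
    using h(1)[OF qc[OF that]] unfolding dp(1) .
  have "\<phi> (B +>\<^bsub>N\<^esub> \<zero>\<^bsub>N\<^esub>) = (\<lambda>i\<in>{..<n}. \<zero>\<^bsub>R\<^esub> \<odot>\<^bsub>M\<^esub> \<phi> (B +>\<^bsub>N\<^esub> \<zero>\<^bsub>N\<^esub>) i)"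
    using h(3)[OF N.R.zero_closed qc[OF N.zero_closed]]
    unfolding q(5)[OF N.R.zero_closed N.zero_closed] dp(4) by simp
  also have "\<dots> = (\<lambda>i\<in>{..<n}. \<zero>\<^bsub>M\<^esub>)"
    by (rule restrict_ext) (use PiE_mem[OF \<phi>c[OF N.zero_closed]] in simp)
  finally have "\<phi> (B +>\<^bsub>N\<^esub> \<zero>\<^bsub>N\<^esub>) = (\<lambda>i\<in>{..<n}. \<zero>\<^bsub>M\<^esub>)" .
  then have \<phi>0: "\<phi> B = (\<lambda>i\<in>{..<n}. \<zero>\<^bsub>M\<^esub>)"
    using q(3)[OF N.zero_closed] submoduleD(2)[OF N B] by simp
  have "power_coordinates R N B M n (\<lambda>i z. \<phi> (B +>\<^bsub>N\<^esub> z) i)"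
    unfolding power_coordinates_def
  proof (intro conjI allI impI ballI)
    fix i assume i: "i < n"
    show "(\<lambda>z. \<phi> (B +>\<^bsub>N\<^esub> z) i) \<in> module_homs R N M"
    proof (rule module_homsI)
      show "\<phi> (B +>\<^bsub>N\<^esub> z) i \<in> carrier M" if "z \<in> carrier N" for z using \<phi>c[OF that] i by auto
      show "\<phi> (B +>\<^bsub>N\<^esub> (y \<oplus>\<^bsub>N\<^esub> z)) i = \<phi> (B +>\<^bsub>N\<^esub> y) i \<oplus>\<^bsub>M\<^esub> \<phi> (B +>\<^bsub>N\<^esub> z) i"
        if "y \<in> carrier N" "z \<in> carrier N" for y z
        using h(2)[OF qc[OF that(1)] qc[OF that(2)]] i unfolding q(4)[OF that] dp(3) by simp
      show "\<phi> (B +>\<^bsub>N\<^esub> (r \<odot>\<^bsub>N\<^esub> z)) i = r \<odot>\<^bsub>M\<^esub> \<phi> (B +>\<^bsub>N\<^esub> z) i"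
        if "r \<in> carrier R" "z \<in> carrier N" for r z
        using h(3)[OF that(1) qc[OF that(2)]] i unfolding q(5)[OF that] dp(4) by simp
    qed
  next
    fix m assume m: "\<forall>i<n. m i \<in> carrier M"
    then have "restrict m {..<n} \<in> carrier (direct_power M n)" unfolding dp(1) by auto
    then obtain X where X: "X \<in> carrier (quotient_module N B)" "\<phi> X = restrict m {..<n}"
      using \<phi>(2) unfolding bij_betw_def by (metis imageE)
    then obtain z where "z \<in> carrier N" "X = B +>\<^bsub>N\<^esub> z" unfolding q(1) by auto
    then show "\<exists>z\<in>carrier N. \<forall>i<n. \<phi> (B +>\<^bsub>N\<^esub> z) i = m i"
      using X(2) by (intro bexI[of _ z]) auto
  next
    fix z assume z: "z \<in> carrier N"
    have "(\<forall>i<n. \<phi> (B +>\<^bsub>N\<^esub> z) i = \<zero>\<^bsub>M\<^esub>) \<longleftrightarrow> \<phi> (B +>\<^bsub>N\<^esub> z) = (\<lambda>i\<in>{..<n}. \<zero>\<^bsub>M\<^esub>)"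
      using \<phi>c[OF z] by (auto simp: fun_eq_iff restrict_def PiE_iff extensional_def)
    also have "\<dots> \<longleftrightarrow> \<phi> (B +>\<^bsub>N\<^esub> z) = \<phi> B" using \<phi>0 by simp
    also have "\<dots> \<longleftrightarrow> B +>\<^bsub>N\<^esub> z = B"
      using \<phi>(2) qc[OF z] qc[OF N.zero_closed] q(3)[OF N.zero_closed] submoduleD(2)[OF N B]
      unfolding bij_betw_def inj_on_def by metis
    also have "\<dots> \<longleftrightarrow> z \<in> B" using q(3)[OF z] .
    finally show "(\<forall>i<n. \<phi> (B +>\<^bsub>N\<^esub> z) i = \<zero>\<^bsub>M\<^esub>) \<longleftrightarrow> z \<in> B" .
  qed
  then show ?thesis by blast
qed

lemma iso_of_power_coordinates:
  assumes N: "module R N" and B: "submodule B R N" and M: "module R M"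
    and \<theta>: "power_coordinates R N B M n \<theta>"
  shows "module_iso R (quotient_module N B) (direct_power M n)"
proof -
  interpret N: module R N by fact
  interpret M: module R M by fact
  note q = quotient_module_simps[OF N B] and dp = direct_power_simps[where M = M and n = n]
  note t = power_coordinatesD[OF \<theta>]
  note th = module_homsD[OF t(1)]
  have eq_iff: "B +>\<^bsub>N\<^esub> y = B +>\<^bsub>N\<^esub> z \<longleftrightarrow> (\<forall>i<n. \<theta> i y = \<theta> i z)"
    if y: "y \<in> carrier N" and z: "z \<in> carrier N" for y z
  proof -
    have "(\<exists>u\<in>B. y = u \<oplus>\<^bsub>N\<^esub> z) \<longleftrightarrow> y \<ominus>\<^bsub>N\<^esub> z \<in> B"
    proof
      assume "\<exists>u\<in>B. y = u \<oplus>\<^bsub>N\<^esub> z"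
      then obtain u where u: "u \<in> B" "y = u \<oplus>\<^bsub>N\<^esub> z" by auto
      then have "y \<ominus>\<^bsub>N\<^esub> z = u"
        using z submoduleD(1)[OF N B] by (simp add: a_minus_def N.a_assoc N.r_neg)
      with u show "y \<ominus>\<^bsub>N\<^esub> z \<in> B" by simp
    next
      assume "y \<ominus>\<^bsub>N\<^esub> z \<in> B"
      moreover have "y = (y \<ominus>\<^bsub>N\<^esub> z) \<oplus>\<^bsub>N\<^esub> z" using y z by (simp add: a_minus_def N.a_assoc N.l_neg)
      ultimately show "\<exists>u\<in>B. y = u \<oplus>\<^bsub>N\<^esub> z" by blast
    qed
    also have "\<dots> \<longleftrightarrow> (\<forall>i<n. \<theta> i (y \<ominus>\<^bsub>N\<^esub> z) = \<zero>\<^bsub>M\<^esub>)"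
      using t(3)[of "y \<ominus>\<^bsub>N\<^esub> z"] y z by simp
    also have "\<dots> \<longleftrightarrow> (\<forall>i<n. \<theta> i y \<ominus>\<^bsub>M\<^esub> \<theta> i z = \<zero>\<^bsub>M\<^esub>)"
      using module_homs_minus[OF N M t(1) y z] by auto
    also have "\<dots> \<longleftrightarrow> (\<forall>i<n. \<theta> i y = \<theta> i z)"
    proof -
      have "a \<ominus>\<^bsub>M\<^esub> b = \<zero>\<^bsub>M\<^esub> \<longleftrightarrow> a = b" if "a \<in> carrier M" "b \<in> carrier M" for a b
        using that M.r_neg M.minus_equality[of "a" "\<ominus>\<^bsub>M\<^esub> b"] by (auto simp: a_minus_def)
      then show ?thesis using th(1)[OF _ y] th(1)[OF _ z] by auto
    qed
    finally show ?thesis using coset_eq_iff[OF N B y z] by simp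
  qed
  \<comment> \<open>Any representative of the coset will do, since by \<open>eq_iff\<close> the
    coordinates depend on the coset alone.\<close>
  define rep where "rep X = (SOME z. z \<in> carrier N \<and> X = B +>\<^bsub>N\<^esub> z)" for X
  have rep: "rep X \<in> carrier N" "X = B +>\<^bsub>N\<^esub> rep X" if "X \<in> carrier (quotient_module N B)" for X
  proof -
    have "\<exists>z. z \<in> carrier N \<and> X = B +>\<^bsub>N\<^esub> z" using that unfolding q(1) by auto
    from someI_ex[OF this] show "rep X \<in> carrier N" "X = B +>\<^bsub>N\<^esub> rep X" unfolding rep_def by auto
  qed
  define \<phi> where "\<phi> X = (\<lambda>i\<in>{..<n}. \<theta> i (rep X))" for X
  have qc: "B +>\<^bsub>N\<^esub> z \<in> carrier (quotient_module N B)" if "z \<in> carrier N" for z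
    using that unfolding q(1) by auto
  have \<phi>: "\<phi> (B +>\<^bsub>N\<^esub> z) = (\<lambda>i\<in>{..<n}. \<theta> i z)" if z: "z \<in> carrier N" for z
    using eq_iff[OF z rep(1)[OF qc[OF z]]] rep(2)[OF qc[OF z]] unfolding \<phi>_def by auto
  have "\<phi> \<in> module_homs R (quotient_module N B) (direct_power M n)"
  proof (rule module_homsI)
    fix X assume "X \<in> carrier (quotient_module N B)"
    then obtain z where z: "z \<in> carrier N" "X = B +>\<^bsub>N\<^esub> z" unfolding q(1) by auto
    show "\<phi> X \<in> carrier (direct_power M n)" unfolding z(2) \<phi>[OF z(1)] dp(1) using th(1) z(1) by auto
  next
    fix X Y assume "X \<in> carrier (quotient_module N B)" "Y \<in> carrier (quotient_module N B)"
    then obtain y z where z: "z \<in> carrier N" "X = B +>\<^bsub>N\<^esub> z" "y \<in> carrier N" "Y = B +>\<^bsub>N\<^esub> y"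
      unfolding q(1) by auto
    show "\<phi> (X \<oplus>\<^bsub>quotient_module N B\<^esub> Y) = \<phi> X \<oplus>\<^bsub>direct_power M n\<^esub> \<phi> Y"
      unfolding z(2,4) q(4)[OF z(1,3)] dp(3) \<phi>[OF z(1)] \<phi>[OF z(3)] \<phi>[OF N.a_closed[OF z(1,3)]]
      using th(2) z by (auto simp: fun_eq_iff)
  next
    fix r X assume r: "r \<in> carrier R" and "X \<in> carrier (quotient_module N B)"
    then obtain z where z: "z \<in> carrier N" "X = B +>\<^bsub>N\<^esub> z" unfolding q(1) by auto
    show "\<phi> (r \<odot>\<^bsub>quotient_module N B\<^esub> X) = r \<odot>\<^bsub>direct_power M n\<^esub> \<phi> X"
      unfolding z(2) q(5)[OF r z(1)] dp(4) \<phi>[OF z(1)] \<phi>[OF N.smult_closed[OF r z(1)]]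
      using th(3) z r by (auto simp: fun_eq_iff)
  qed
  moreover have "bij_betw \<phi> (carrier (quotient_module N B)) (carrier (direct_power M n))"
    unfolding bij_betw_def
  proof
    show "inj_on \<phi> (carrier (quotient_module N B))"
    proof (rule inj_onI)
      fix X Y assume "X \<in> carrier (quotient_module N B)" "Y \<in> carrier (quotient_module N B)" and e: "\<phi> X = \<phi> Y"
      then obtain y z where z: "z \<in> carrier N" "X = B +>\<^bsub>N\<^esub> z" "y \<in> carrier N" "Y = B +>\<^bsub>N\<^esub> y"
        unfolding q(1) by auto
      from e have "\<theta> i z = \<theta> i y" if "i < n" for i
        using that unfolding z(2,4) \<phi>[OF z(1)] \<phi>[OF z(3)] by (metis lessThan_iff restrict_apply')
      then show "X = Y" unfolding z(2,4) using eq_iff[OF z(1,3)] by simp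
    qed
    show "\<phi> ` carrier (quotient_module N B) = carrier (direct_power M n)"
    proof (intro equalityI subsetI)
      fix f assume "f \<in> \<phi> ` carrier (quotient_module N B)"
      then show "f \<in> carrier (direct_power M n)"
        using module_homsD(1)[OF \<open>\<phi> \<in> module_homs R (quotient_module N B) (direct_power M n)\<close>] by auto
    next
      fix f assume f: "f \<in> carrier (direct_power M n)"
      then have "f i \<in> carrier M" if "i < n" for i using that unfolding dp(1) by auto
      then obtain z where z: "z \<in> carrier N" "\<forall>i<n. \<theta> i z = f i" using t(2)[of f] by blast
      have "\<phi> (B +>\<^bsub>N\<^esub> z) = f"
        unfolding \<phi>[OF z(1)] using z(2) f unfolding dp(1) by (auto simp: fun_eq_iff PiE_iff extensional_def)
      then show "f \<in> \<phi> ` carrier (quotient_module N B)" using qc[OF z(1)] by blast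
    qed
  qed
  ultimately show ?thesis unfolding module_iso_def by blast
qed

section \<open>Depth\<close>

context koszul_local_ring
begin

definition multiples_submodule :: "('a, 'c, 'd) module_scheme \<Rightarrow> 'a list \<Rightarrow> 'c set" where
  "multiples_submodule M rs = generated_submodule R M {r \<odot>\<^bsub>M\<^esub> x | r x. r \<in> set rs \<and> x \<in> carrier M}"

lemma multiples_submodule:
  assumes M: "module R M" and rs: "set rs \<subseteq> carrier R"
  shows "submodule (multiples_submodule M rs) R M"
    "r \<in> set rs \<Longrightarrow> x \<in> carrier M \<Longrightarrow> r \<odot>\<^bsub>M\<^esub> x \<in> multiples_submodule M rs"
proof -
  interpret M: module R M by fact
  have c: "{r \<odot>\<^bsub>M\<^esub> x | r x. r \<in> set rs \<and> x \<in> carrier M} \<subseteq> carrier M" using rs by auto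
  show "submodule (multiples_submodule M rs) R M"
    unfolding multiples_submodule_def by (rule generated_submodule_is_submodule[OF M c])
  show "r \<in> set rs \<Longrightarrow> x \<in> carrier M \<Longrightarrow> r \<odot>\<^bsub>M\<^esub> x \<in> multiples_submodule M rs"
    unfolding multiples_submodule_def using generated_submodule_superset[OF M c] by auto
qed

lemma multiples_submodule_Nil:
  assumes "module R M"
  shows "multiples_submodule M [] = {\<zero>\<^bsub>M\<^esub>}"
  unfolding multiples_submodule_def using generated_submodule_empty[OF assms] by simp

lemma multiples_submodule_snoc:
  assumes M: "module R M" and rs: "set rs \<subseteq> carrier R" "x \<in> carrier R"
  shows "multiples_submodule M (rs @ [x]) = extend_by M (multiples_submodule M rs) x"
proof (intro equalityI)
  interpret M: module R M by fact
  note U = multiples_submodule[OF M rs(1)]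
  have rsx: "set (rs @ [x]) \<subseteq> carrier R" using rs by auto
  note V = multiples_submodule[OF M rsx]
  note W = submodule_extend_by[OF M U(1) rs(2)]
  show "multiples_submodule M (rs @ [x]) \<subseteq> extend_by M (multiples_submodule M rs) x"
    unfolding multiples_submodule_def[of M "rs @ [x]"]
    by (rule generated_submodule_minimal[OF W(1)]) (use U(2) W(2,3) in auto)
  have UV: "multiples_submodule M rs \<subseteq> multiples_submodule M (rs @ [x])"
    unfolding multiples_submodule_def by (rule generated_submodule_mono) auto
  show "extend_by M (multiples_submodule M rs) x \<subseteq> multiples_submodule M (rs @ [x])"
  proof
    fix w assume "w \<in> extend_by M (multiples_submodule M rs) x"
    then obtain u b where "u \<in> multiples_submodule M rs" "b \<in> carrier M" "w = u \<oplus>\<^bsub>M\<^esub> x \<odot>\<^bsub>M\<^esub> b"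
      by (metis extend_byE)
    then show "w \<in> multiples_submodule M (rs @ [x])"
      using submoduleD(3)[OF M V(1)] V(2)[of x b] UV by auto
  qed
qed

lemma nonzerodivisor_on_quotient_iff:
  assumes M: "module R M" and U: "submodule U R M" and r: "r \<in> carrier R"
  shows "nonzerodivisor_on (quotient_module M U) r \<longleftrightarrow> nonzerodivisor_mod M U r"
proof -
  interpret M: module R M by fact
  note q = quotient_module_simps[OF M U]
  show ?thesis
    unfolding nonzerodivisor_on_def nonzerodivisor_mod_def q(1,2)
    using q(3,5) r by auto
qed

text \<open>All conditions become conditions on submodules of the one module M, in which form the
  results on reduction modulo a nonzerodivisor apply.\<close>

lemma regular_sequence_iff:
  assumes M: "module R M"
  shows "regular_sequence R M rs \<longleftrightarrow> set rs \<subseteq> carrier R \<and>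
    (\<forall>i<length rs. nonzerodivisor_mod M (multiples_submodule M (take i rs)) (rs ! i)) \<and>
    multiples_submodule M rs \<noteq> carrier M"
proof (cases "set rs \<subseteq> carrier R")
  case True
  have "nonzerodivisor_on (quotient_by_elements R M (take i rs)) (rs ! i) \<longleftrightarrow>
      nonzerodivisor_mod M (multiples_submodule M (take i rs)) (rs ! i)" if "i < length rs" for i
    unfolding quotient_by_elements_def multiples_submodule_def[symmetric]
    by (rule nonzerodivisor_on_quotient_iff[OF M multiples_submodule(1)[OF M]])
      (use True that in \<open>auto dest: in_set_takeD\<close>)
  moreover have "zero_module (quotient_by_elements R M rs) \<longleftrightarrow> multiples_submodule M rs = carrier M"
    unfolding quotient_by_elements_def multiples_submodule_def[symmetric]
    by (rule zero_module_quotient_iff[OF M multiples_submodule(1)[OF M True]])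
  ultimately show ?thesis unfolding regular_sequence_def by auto
qed (auto simp: regular_sequence_def)

text \<open>By Nakayama's lemma the quotient stays nonzero when an element of the maximal ideal is
  divided out, so nonvanishing of the longer quotient is inherited from the shorter one.\<close>

lemma regular_sequence_snoc_iff:
  assumes M: "module R M" and fg: "finitely_generated R M"
  shows "regular_sequence R M (rs @ [x]) \<and> set (rs @ [x]) \<subseteq> \<mm> \<longleftrightarrow>
    (regular_sequence R M rs \<and> set rs \<subseteq> \<mm>) \<and> x \<in> \<mm> \<and> nonzerodivisor_mod M (multiples_submodule M rs) x"
    (is "?L \<longleftrightarrow> ?R")
proof
  have xc: "x \<in> carrier R" if "x \<in> \<mm>" for x using that mm.Icarr by auto
  show "?L \<Longrightarrow> ?R"
  proof -
    assume L: ?L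
    then have L1: "set rs \<subseteq> carrier R" "x \<in> carrier R" "set rs \<subseteq> \<mm>" "x \<in> \<mm>"
      and L2: "\<And>i. i < Suc (length rs) \<Longrightarrow>
        nonzerodivisor_mod M (multiples_submodule M (take i (rs @ [x]))) ((rs @ [x]) ! i)"
      and L3: "multiples_submodule M (rs @ [x]) \<noteq> carrier M"
      unfolding regular_sequence_iff[OF M] by auto
    have "nonzerodivisor_mod M (multiples_submodule M (take i rs)) (rs ! i)" if "i < length rs" for i
      using L2[of i] that by (simp add: nth_append)
    moreover have "nonzerodivisor_mod M (multiples_submodule M rs) x" using L2[of "length rs"] by simp
    moreover have "multiples_submodule M rs \<noteq> carrier M"
      using L3 submodule_extend_by(1,2)[OF M multiples_submodule(1)[OF M L1(1)] L1(2)]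
        multiples_submodule_snoc[OF M L1(1,2)] submoduleD(1)[OF M] by blast
    ultimately show ?R unfolding regular_sequence_iff[OF M] using L1 by auto
  qed
  assume R: ?R
  then have R1: "set rs \<subseteq> carrier R" "x \<in> carrier R" "set rs \<subseteq> \<mm>" "x \<in> \<mm>"
    and R2: "\<And>i. i < length rs \<Longrightarrow> nonzerodivisor_mod M (multiples_submodule M (take i rs)) (rs ! i)"
    and R3: "multiples_submodule M rs \<noteq> carrier M" "nonzerodivisor_mod M (multiples_submodule M rs) x"
    using xc unfolding regular_sequence_iff[OF M] by auto
  have "multiples_submodule M (rs @ [x]) \<noteq> carrier M"
    using extend_by_proper[OF M fg multiples_submodule(1)[OF M R1(1)] R3(1) R1(4)]
    unfolding multiples_submodule_snoc[OF M R1(1,2)] .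
  moreover have "nonzerodivisor_mod M (multiples_submodule M (take i (rs @ [x]))) ((rs @ [x]) ! i)"
    if "i < length (rs @ [x])" for i
    using R2[of i] R3(2) that by (cases "i = length rs") (auto simp: nth_append)
  ultimately show ?L unfolding regular_sequence_iff[OF M] using R1 by auto
qed

text \<open>Each element of the sequence accounts for a shift of the depth by one, collected from
  the last element to the first.\<close>

lemma cohomological_depth_regular_sequence:
  assumes M: "module R M" and fg: "finitely_generated R M"
    and "regular_sequence R M rs" "set rs \<subseteq> \<mm>" "cohomological_depth M (multiples_submodule M rs) e"
  shows "cohomological_depth M {\<zero>\<^bsub>M\<^esub>} (e + int (length rs))"
  using assms(3-5)
proof (induction rs arbitrary: e rule: rev_induct)
  case Nil
  then show ?case using multiples_submodule_Nil[OF M] by simp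
next
  case (snoc x rs)
  then have R: "regular_sequence R M rs" "set rs \<subseteq> \<mm>" "x \<in> \<mm>" "nonzerodivisor_mod M (multiples_submodule M rs) x"
    using regular_sequence_snoc_iff[OF M fg, of rs x] by auto
  have c: "set rs \<subseteq> carrier R" "x \<in> carrier R" using R(2,3) mm.Icarr by auto
  have "cohomological_depth M (multiples_submodule M rs) (e + 1)"
    using cohomological_depth_extend_by[OF M multiples_submodule(1)[OF M c(1)] R(3,4)] snoc.prems(3)
    unfolding multiples_submodule_snoc[OF M c] by simp
  from snoc.IH[OF R(1,2) this] show ?case by (simp add: algebra_simps)
qed

text \<open>Positive depth of the quotient supplies one more nonzerodivisor, and dividing it out
  lowers the depth by one, until depth 0 is reached.\<close>

lemma regular_sequence_extend:
  assumes M: "module R M" and fg: "finitely_generated R M"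
    and "regular_sequence R M rs" "set rs \<subseteq> \<mm>" "cohomological_depth M (multiples_submodule M rs) (int e)"
  shows "\<exists>ss. regular_sequence R M ss \<and> set ss \<subseteq> \<mm> \<and> length ss = length rs + e"
  using assms(3-5)
proof (induction e arbitrary: rs)
  case 0
  then show ?case by auto
next
  case (Suc e)
  have rsc: "set rs \<subseteq> carrier R" using Suc.prems(2) mm.Icarr by auto
  note U = multiples_submodule(1)[OF M rsc]
  obtain x where x: "x \<in> \<mm>" "nonzerodivisor_mod M (multiples_submodule M rs) x"
    using nonzerodivisor_of_positive_depth[OF M fg U Suc.prems(3)] by auto
  have R: "regular_sequence R M (rs @ [x])" "set (rs @ [x]) \<subseteq> \<mm>"
    using regular_sequence_snoc_iff[OF M fg, of rs x] Suc.prems(1,2) x by auto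
  have xc: "x \<in> carrier R" using x(1) mm.Icarr by auto
  have rsxc: "set (rs @ [x]) \<subseteq> carrier R" using rsc xc by auto
  have "multiples_submodule M (rs @ [x]) \<noteq> carrier M" using R(1) unfolding regular_sequence_iff[OF M] by simp
  then obtain e' where e': "cohomological_depth M (multiples_submodule M (rs @ [x])) e'"
    using cohomological_depth_exists[OF M fg multiples_submodule(1)[OF M rsxc]] by blast
  then have "cohomological_depth M (multiples_submodule M rs) (e' + 1)"
    using cohomological_depth_extend_by[OF M U x] unfolding multiples_submodule_snoc[OF M rsc xc] by simp
  then have "e' = int e" using cohomological_depth_unique[OF _ Suc.prems(3)] by force
  then obtain ss where "regular_sequence R M ss" "set ss \<subseteq> \<mm>" "length ss = length (rs @ [x]) + e"
    using Suc.IH[OF R] e' by auto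
  then show ?case by auto
qed

text \<open>A regular sequence of length k leaves a quotient of depth d - k, which is nonnegative,
  so k \<le> d; extending the empty sequence attains d.\<close>

theorem depth_eq_cohomological_depth:
  assumes M: "module R M" and fg: "finitely_generated R M" and nz: "\<not> zero_module M"
  shows "\<exists>d. cohomological_depth M {\<zero>\<^bsub>M\<^esub>} (int d) \<and> depth R M = ereal (real d)"
proof -
  have ne: "{\<zero>\<^bsub>M\<^esub>} \<noteq> carrier M" using nz unfolding zero_module_def by auto
  obtain d' where d': "cohomological_depth M {\<zero>\<^bsub>M\<^esub>} d'"
    using cohomological_depth_exists[OF M fg submodule_zero[OF M] ne] by auto
  then obtain d where d: "cohomological_depth M {\<zero>\<^bsub>M\<^esub>} (int d)"
    using cohomological_depth_nonneg[OF M] nonneg_int_cases by metis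
  let ?S = "{ereal (real (length rs)) | rs. regular_sequence R M rs \<and> set rs \<subseteq> \<mm>}"
  have "length rs \<le> d" if rs: "regular_sequence R M rs" "set rs \<subseteq> \<mm>" for rs
  proof -
    have rsc: "set rs \<subseteq> carrier R" using rs(2) mm.Icarr by auto
    have "multiples_submodule M rs \<noteq> carrier M" using rs(1) unfolding regular_sequence_iff[OF M] by simp
    then obtain e where e: "cohomological_depth M (multiples_submodule M rs) e"
      using cohomological_depth_exists[OF M fg multiples_submodule(1)[OF M rsc]] by blast
    have "e + int (length rs) = int d"
      using cohomological_depth_unique[OF cohomological_depth_regular_sequence[OF M fg rs e] d] .
    moreover have "e \<ge> 0" using cohomological_depth_nonneg[OF M e] .
    ultimately show ?thesis by linarith
  qed
  moreover have "\<exists>ss. regular_sequence R M ss \<and> set ss \<subseteq> \<mm> \<and> length ss = d"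
    using regular_sequence_extend[OF M fg, of "[]" d] d multiples_submodule_Nil[OF M] ne
    by (auto simp: regular_sequence_iff[OF M])
  ultimately have "Sup ?S = ereal (real d)"
    by (intro Sup_eqI) auto
  then show ?thesis using d nz unfolding depth_def by auto
qed

end

section \<open>Free and projective modules\<close>

lemma ring_as_module_simps [simp]:
  "carrier (ring_as_module R) = carrier R"
  "\<zero>\<^bsub>ring_as_module R\<^esub> = \<zero>\<^bsub>R\<^esub>"
  "x \<oplus>\<^bsub>ring_as_module R\<^esub> y = x \<oplus>\<^bsub>R\<^esub> y"
  "x \<odot>\<^bsub>ring_as_module R\<^esub> y = x \<otimes>\<^bsub>R\<^esub> y"
  unfolding ring_as_module_def by auto

lemma (in cring) module_ring_as_module: "module R (ring_as_module R)"
proof (rule moduleI)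
  show "cring R" by (rule is_cring)
  show "abelian_group (ring_as_module R)"
  proof (rule abelian_groupI)
    show "\<exists>y\<in>carrier (ring_as_module R). y \<oplus>\<^bsub>ring_as_module R\<^esub> x = \<zero>\<^bsub>ring_as_module R\<^esub>"
      if "x \<in> carrier (ring_as_module R)" for x
      using that by (intro bexI[of _ "\<ominus> x"]) (auto simp: l_neg)
  qed (auto simp: a_ac)
qed (auto simp: l_distr r_distr m_assoc)

lemma module_homs_scale:
  assumes "module R M" "e \<in> carrier M"
  shows "(\<lambda>r. r \<odot>\<^bsub>M\<^esub> e) \<in> module_homs R (ring_as_module R) M"
proof -
  interpret M: module R M by fact
  show ?thesis by (rule module_homsI) (use assms in \<open>auto simp: M.smult_l_distr M.smult_assoc1\<close>)
qed

lemma (in cring) finitely_generated_ring_as_module: "finitely_generated R (ring_as_module R)"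
proof -
  note M = module_ring_as_module
  have sub: "{\<one>} \<subseteq> carrier (ring_as_module R)" by simp
  note g = generated_submodule_props[OF M sub]
  have "x \<in> generated_submodule R (ring_as_module R) {\<one>}" if "x \<in> carrier R" for x
    using submoduleD(4)[OF M g(1) that, of \<one>] g(2) that by simp
  then have "generated_submodule R (ring_as_module R) {\<one>} = carrier (ring_as_module R)"
    using submoduleD(1)[OF M g(1)] by auto
  then show ?thesis unfolding finitely_generated_def by (intro exI[of _ "{\<one>}"]) auto
qed

lemma free_module_simps:
  "f \<in> carrier (free_module R B) \<longleftrightarrow> f \<in> B \<rightarrow>\<^sub>E carrier R \<and> finite {b \<in> B. f b \<noteq> \<zero>\<^bsub>R\<^esub>}"
  "\<zero>\<^bsub>free_module R B\<^esub> = (\<lambda>b\<in>B. \<zero>\<^bsub>R\<^esub>)"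
  "f \<oplus>\<^bsub>free_module R B\<^esub> g = (\<lambda>b\<in>B. f b \<oplus>\<^bsub>R\<^esub> g b)"
  "r \<odot>\<^bsub>free_module R B\<^esub> f = (\<lambda>b\<in>B. r \<otimes>\<^bsub>R\<^esub> f b)"
  unfolding free_module_def by auto

context cring
begin

lemma free_module_add_closed:
  assumes "f \<in> carrier (free_module R B)" "g \<in> carrier (free_module R B)"
  shows "f \<oplus>\<^bsub>free_module R B\<^esub> g \<in> carrier (free_module R B)"
proof -
  have "{b \<in> B. (\<lambda>b\<in>B. f b \<oplus> g b) b \<noteq> \<zero>} \<subseteq> {b \<in> B. f b \<noteq> \<zero>} \<union> {b \<in> B. g b \<noteq> \<zero>}" by auto
  then have "finite {b \<in> B. (\<lambda>b\<in>B. f b \<oplus> g b) b \<noteq> \<zero>}"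
    using assms finite_subset unfolding free_module_simps by blast
  then show ?thesis using assms unfolding free_module_simps by auto
qed

lemma free_module_smult_closed:
  assumes "r \<in> carrier R" "f \<in> carrier (free_module R B)"
  shows "r \<odot>\<^bsub>free_module R B\<^esub> f \<in> carrier (free_module R B)"
proof -
  have "{b \<in> B. (\<lambda>b\<in>B. r \<otimes> f b) b \<noteq> \<zero>} \<subseteq> {b \<in> B. f b \<noteq> \<zero>}" using assms(1) by auto
  then have "finite {b \<in> B. (\<lambda>b\<in>B. r \<otimes> f b) b \<noteq> \<zero>}"
    using assms(2) finite_subset unfolding free_module_simps by blast
  then show ?thesis using assms unfolding free_module_simps by auto
qed

definition free_unit :: "'p set \<Rightarrow> 'p \<Rightarrow> 'p \<Rightarrow> 'a" where
  "free_unit B a = (\<lambda>b\<in>B. if b = a then \<one> else \<zero>)"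

lemma free_unit_closed: "free_unit B a \<in> carrier (free_module R B)"
proof -
  have "finite {b \<in> B. free_unit B a b \<noteq> \<zero>}"
    by (rule finite_subset[of _ "{a}"]) (auto simp: free_unit_def)
  then show ?thesis unfolding free_module_simps by (auto simp: free_unit_def)
qed

lemma module_free_module: "module R (free_module R B)"
proof -
  have cl: "f b \<in> carrier R" if "f \<in> carrier (free_module R B)" "b \<in> B" for f b
    using that unfolding free_module_simps by auto
  have ext: "f b = undefined" if "f \<in> carrier (free_module R B)" "b \<notin> B" for f b
    using that unfolding free_module_simps by (auto simp: PiE_iff extensional_def)
  show ?thesis
  proof (rule moduleI)
    show "cring R" by (rule is_cring)
    show "abelian_group (free_module R B)"
    proof (rule abelian_groupI)
      show "\<zero>\<^bsub>free_module R B\<^esub> \<in> carrier (free_module R B)" unfolding free_module_simps by auto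
      show "f \<oplus>\<^bsub>free_module R B\<^esub> g \<in> carrier (free_module R B)"
        if "f \<in> carrier (free_module R B)" "g \<in> carrier (free_module R B)" for f g
        using free_module_add_closed[OF that] .
      show "\<zero>\<^bsub>free_module R B\<^esub> \<oplus>\<^bsub>free_module R B\<^esub> f = f" if "f \<in> carrier (free_module R B)" for f
        using cl[OF that] ext[OF that] unfolding free_module_simps(2,3) by (auto simp: fun_eq_iff)
      show "\<exists>g\<in>carrier (free_module R B). g \<oplus>\<^bsub>free_module R B\<^esub> f = \<zero>\<^bsub>free_module R B\<^esub>"
        if f: "f \<in> carrier (free_module R B)" for f
      proof (rule bexI)
        show "(\<ominus> \<one>) \<odot>\<^bsub>free_module R B\<^esub> f \<in> carrier (free_module R B)"
          by (rule free_module_smult_closed[OF _ f]) simp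
        show "((\<ominus> \<one>) \<odot>\<^bsub>free_module R B\<^esub> f) \<oplus>\<^bsub>free_module R B\<^esub> f = \<zero>\<^bsub>free_module R B\<^esub>"
          using cl[OF f] unfolding free_module_simps(2-4) by (auto simp: fun_eq_iff l_minus l_neg)
      qed
    qed (use cl in \<open>auto simp: free_module_simps(3) fun_eq_iff a_ac\<close>)
    show "r \<odot>\<^bsub>free_module R B\<^esub> f \<in> carrier (free_module R B)"
      if "r \<in> carrier R" "f \<in> carrier (free_module R B)" for r f
      using free_module_smult_closed[OF that] .
    show "\<one> \<odot>\<^bsub>free_module R B\<^esub> f = f" if "f \<in> carrier (free_module R B)" for f
      using cl[OF that] ext[OF that] unfolding free_module_simps(4) by (auto simp: fun_eq_iff)
  qed (use cl in \<open>auto simp: free_module_simps(3,4) fun_eq_iff l_distr r_distr m_assoc\<close>)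
qed

text \<open>Induction on a finite set containing the support: erasing the coordinate at a leaves an
  element supported on the smaller set.\<close>

lemma free_module_induct [consumes 1, case_names zero add]:
  assumes f: "f \<in> carrier (free_module R B)"
    and zero: "Q \<zero>\<^bsub>free_module R B\<^esub>"
    and step: "\<And>f r a. f \<in> carrier (free_module R B) \<Longrightarrow> Q f \<Longrightarrow> r \<in> carrier R \<Longrightarrow> a \<in> B \<Longrightarrow>
      Q (f \<oplus>\<^bsub>free_module R B\<^esub> r \<odot>\<^bsub>free_module R B\<^esub> free_unit B a)"
  shows "Q f"
proof -
  have "finite A \<Longrightarrow> A \<subseteq> B \<Longrightarrow> \<forall>f\<in>carrier (free_module R B). {b \<in> B. f b \<noteq> \<zero>} \<subseteq> A \<longrightarrow> Q f" for A
  proof (induction A rule: finite_induct)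
    case empty
    have "f = \<zero>\<^bsub>free_module R B\<^esub>" if "f \<in> carrier (free_module R B)" "{b \<in> B. f b \<noteq> \<zero>} \<subseteq> {}" for f
      using that unfolding free_module_simps by (auto simp: fun_eq_iff PiE_iff extensional_def)
    then show ?case using zero by blast
  next
    case (insert a A)
    show ?case
    proof (intro ballI impI)
      fix f assume f: "f \<in> carrier (free_module R B)" "{b \<in> B. f b \<noteq> \<zero>} \<subseteq> insert a A"
      have a: "a \<in> B" and AB: "A \<subseteq> B" using insert.prems by auto
      define f' where "f' = f(a := \<zero>)"
      have fc: "\<And>b. b \<in> B \<Longrightarrow> f b \<in> carrier R" "\<And>b. b \<notin> B \<Longrightarrow> f b = undefined"
        using f(1) unfolding free_module_simps by (auto simp: PiE_iff extensional_def)
      have "{b \<in> B. f' b \<noteq> \<zero>} \<subseteq> A" using f(2) unfolding f'_def by auto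
      moreover have "f' \<in> carrier (free_module R B)"
        unfolding free_module_simps
        using finite_subset[OF \<open>{b \<in> B. f' b \<noteq> \<zero>} \<subseteq> A\<close> insert.hyps(1)] fc a
        by (auto simp: f'_def PiE_iff extensional_def)
      ultimately have Q: "Q f'" and f'c: "f' \<in> carrier (free_module R B)" using insert.IH[OF AB] by auto
      have "f = f' \<oplus>\<^bsub>free_module R B\<^esub> f a \<odot>\<^bsub>free_module R B\<^esub> free_unit B a"
        unfolding free_module_simps f'_def free_unit_def using fc a by (auto simp: fun_eq_iff)
      then show "Q f" using step[OF f'c Q fc(1)[OF a] a] by metis
    qed
  qed
  moreover have "finite {b \<in> B. f b \<noteq> \<zero>}" using f unfolding free_module_simps by auto
  ultimately show ?thesis using f by blast
qed

text \<open>The formula for the lift, over any finite set that contains the support, is part of the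
  conclusion because a dual basis has to sum over one set for several elements at once.\<close>

lemma free_module_lift:
  assumes N: "module R N" and \<beta>: "\<beta> \<in> B \<rightarrow> carrier N"
  shows "\<exists>l\<in>module_homs R (free_module R B) N. (\<forall>b\<in>B. l (free_unit B b) = \<beta> b) \<and>
    (\<forall>f\<in>carrier (free_module R B). \<forall>A. finite A \<and> A \<subseteq> B \<and> {b \<in> B. f b \<noteq> \<zero>} \<subseteq> A \<longrightarrow>
      l f = finsum N (\<lambda>b. f b \<odot>\<^bsub>N\<^esub> \<beta> b) A)"
proof -
  interpret N: module R N by fact
  define l where "l f = finsum N (\<lambda>b. f b \<odot>\<^bsub>N\<^esub> \<beta> b) {b \<in> B. f b \<noteq> \<zero>}" for f
  have cl: "f b \<in> carrier R" if "f \<in> carrier (free_module R B)" "b \<in> B" for f b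
    using that unfolding free_module_simps by auto
  have fin: "finite {b \<in> B. f b \<noteq> \<zero>}" if "f \<in> carrier (free_module R B)" for f
    using that unfolding free_module_simps by auto
  have l: "l f = finsum N (\<lambda>b. f b \<odot>\<^bsub>N\<^esub> \<beta> b) A"
    if f: "f \<in> carrier (free_module R B)" and A: "finite A" "A \<subseteq> B" "{b \<in> B. f b \<noteq> \<zero>} \<subseteq> A" for f A
    unfolding l_def
    by (rule N.add.finprod_mono_neutral_cong_left[OF A(1,3)])
      (use A(2) \<beta> cl[OF f] in \<open>auto simp: Pi_iff subset_iff\<close>)
  have gc: "(\<lambda>b. f b \<odot>\<^bsub>N\<^esub> \<beta> b) \<in> A \<rightarrow> carrier N" if "f \<in> carrier (free_module R B)" "A \<subseteq> B" for f A
    using that cl \<beta> by (auto simp: Pi_iff subset_iff)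
  have "l \<in> module_homs R (free_module R B) N"
  proof (rule module_homsI)
    show "l f \<in> carrier N" if "f \<in> carrier (free_module R B)" for f
      unfolding l_def by (rule N.finsum_closed[OF gc[OF that]]) auto
    fix f g assume fg: "f \<in> carrier (free_module R B)" "g \<in> carrier (free_module R B)"
    let ?A = "{b \<in> B. f b \<noteq> \<zero>} \<union> {b \<in> B. g b \<noteq> \<zero>}"
    have A: "finite ?A" "?A \<subseteq> B" using fin fg by auto
    have "l (f \<oplus>\<^bsub>free_module R B\<^esub> g) = finsum N (\<lambda>b. (f \<oplus>\<^bsub>free_module R B\<^esub> g) b \<odot>\<^bsub>N\<^esub> \<beta> b) ?A"
      by (rule l[OF free_module_add_closed[OF fg] A]) (auto simp: free_module_simps)
    also have "\<dots> = finsum N (\<lambda>b. f b \<odot>\<^bsub>N\<^esub> \<beta> b \<oplus>\<^bsub>N\<^esub> g b \<odot>\<^bsub>N\<^esub> \<beta> b) ?A"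
      by (rule N.finsum_cong') (use cl[OF fg(1)] cl[OF fg(2)] \<beta> in \<open>auto simp: Pi_iff free_module_simps N.smult_l_distr\<close>)
    also have "\<dots> = finsum N (\<lambda>b. f b \<odot>\<^bsub>N\<^esub> \<beta> b) ?A \<oplus>\<^bsub>N\<^esub> finsum N (\<lambda>b. g b \<odot>\<^bsub>N\<^esub> \<beta> b) ?A"
      by (rule N.finsum_addf[OF gc[OF fg(1) A(2)] gc[OF fg(2) A(2)]])
    also have "\<dots> = l f \<oplus>\<^bsub>N\<^esub> l g"
      using l[OF fg(1) A] l[OF fg(2) A] by auto
    finally show "l (f \<oplus>\<^bsub>free_module R B\<^esub> g) = l f \<oplus>\<^bsub>N\<^esub> l g" .
  next
    fix r f assume r: "r \<in> carrier R" and f: "f \<in> carrier (free_module R B)"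
    let ?A = "{b \<in> B. f b \<noteq> \<zero>}"
    have A: "finite ?A" "?A \<subseteq> B" using fin f by auto
    have "l (r \<odot>\<^bsub>free_module R B\<^esub> f) = finsum N (\<lambda>b. (r \<odot>\<^bsub>free_module R B\<^esub> f) b \<odot>\<^bsub>N\<^esub> \<beta> b) ?A"
      by (rule l[OF free_module_smult_closed[OF r f] A]) (use r in \<open>auto simp: free_module_simps\<close>)
    also have "\<dots> = finsum N (\<lambda>b. r \<odot>\<^bsub>N\<^esub> (f b \<odot>\<^bsub>N\<^esub> \<beta> b)) ?A"
      by (rule N.finsum_cong') (use cl[OF f] r \<beta> in \<open>auto simp: Pi_iff free_module_simps N.smult_assoc1\<close>)
    also have "\<dots> = r \<odot>\<^bsub>N\<^esub> l f"
      unfolding l_def using N.finsum_smult_ldistr[OF A(1) r gc[OF f A(2)]] by simp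
    finally show "l (r \<odot>\<^bsub>free_module R B\<^esub> f) = r \<odot>\<^bsub>N\<^esub> l f" .
  qed
  moreover have "l (free_unit B b) = \<beta> b" if b: "b \<in> B" for b
  proof -
    have "l (free_unit B b) = finsum N (\<lambda>c. free_unit B b c \<odot>\<^bsub>N\<^esub> \<beta> c) {b}"
      by (rule l[OF free_unit_closed]) (use b in \<open>auto simp: free_unit_def\<close>)
    also have "\<dots> = \<beta> b"
      using b \<beta> by (subst N.finsum_insert) (auto simp: free_unit_def Pi_iff)
    finally show ?thesis .
  qed
  ultimately show ?thesis using l by (intro bexI[of _ l]) auto
qed

lemma free_module_homs_eq:
  assumes N: "module R N" and l: "l \<in> module_homs R (free_module R B) N" "l' \<in> module_homs R (free_module R B) N"
    and e: "\<And>b. b \<in> B \<Longrightarrow> l (free_unit B b) = l' (free_unit B b)" and f: "f \<in> carrier (free_module R B)"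
  shows "l f = l' f"
  using f
proof (induction rule: free_module_induct)
  case zero
  then show ?case using module_homs_zero[OF module_free_module N] l by metis
next
  case (add f r a)
  then show ?case
    using module_homsD[OF l(1)] module_homsD[OF l(2)] e free_unit_closed[of B a]
      free_module_smult_closed[of r "free_unit B a" B] by simp
qed

text \<open>The dual basis lemma cut down to a finite index set, the union of the supports of the
  images of S in a free module. It is the device by which modules of infinite rank are handled with
  finite sums.\<close>

lemma projective_dual_basis:
  fixes P :: "('a, 'p, 'd) module_scheme"
  assumes P: "projective_module R P" and S: "finite S" "S \<subseteq> carrier P"
  obtains B :: "'p set" and e s where "finite B" "\<And>b. b \<in> B \<Longrightarrow> e b \<in> carrier P"
    "\<And>b. b \<in> B \<Longrightarrow> s b \<in> module_homs R P (ring_as_module R)"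
    "\<And>x. x \<in> S \<Longrightarrow> finsum P (\<lambda>b. s b x \<odot>\<^bsub>P\<^esub> e b) B = x"
proof -
  obtain B :: "'p set" and s p where sp: "s \<in> module_homs R P (free_module R B)"
    "p \<in> module_homs R (free_module R B) P" "\<And>x. x \<in> carrier P \<Longrightarrow> p (s x) = x" and M: "module R P"
    using P unfolding projective_module_def by auto
  interpret P: module R P by (rule M)
  define e where "e b = p (free_unit B b)" for b
  have e: "e \<in> B \<rightarrow> carrier P" using module_homsD(1)[OF sp(2) free_unit_closed] unfolding e_def by auto
  obtain l where l: "l \<in> module_homs R (free_module R B) P" "\<forall>b\<in>B. l (free_unit B b) = e b"
    "\<forall>f\<in>carrier (free_module R B). \<forall>A. finite A \<and> A \<subseteq> B \<and> {b \<in> B. f b \<noteq> \<zero>} \<subseteq> A \<longrightarrow>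
      l f = finsum P (\<lambda>b. f b \<odot>\<^bsub>P\<^esub> e b) A"
    using free_module_lift[OF M e] by blast
  have pl: "p f = l f" if "f \<in> carrier (free_module R B)" for f
    by (rule free_module_homs_eq[OF M sp(2) l(1) _ that]) (use l(2) in \<open>auto simp: e_def\<close>)
  define A where "A = (\<Union>x\<in>S. {b \<in> B. s x b \<noteq> \<zero>})"
  have sc: "s x \<in> carrier (free_module R B)" if "x \<in> carrier P" for x using module_homsD(1)[OF sp(1) that] .
  have A: "finite A" "A \<subseteq> B" unfolding A_def using S sc by (auto simp: free_module_simps subset_iff)
  have "finsum P (\<lambda>b. s x b \<odot>\<^bsub>P\<^esub> e b) A = x" if x: "x \<in> S" for x
  proof -
    have xc: "x \<in> carrier P" using x S by auto
    have "{b \<in> B. s x b \<noteq> \<zero>} \<subseteq> A" using x unfolding A_def by auto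
    then have "finsum P (\<lambda>b. s x b \<odot>\<^bsub>P\<^esub> e b) A = l (s x)"
      using l(3)[rule_format, OF sc[OF xc], of A] A by simp
    also have "\<dots> = x" using pl[OF sc[of x]] sp(3) x S by auto
    finally show ?thesis by simp
  qed
  moreover have "(\<lambda>x. s x b) \<in> module_homs R P (ring_as_module R)" if b: "b \<in> A" for b
  proof (rule module_homsI)
    show "s x b \<in> carrier (ring_as_module R)" if "x \<in> carrier P" for x
      using sc[OF that] b A unfolding free_module_simps by auto
    show "s (x \<oplus>\<^bsub>P\<^esub> y) b = s x b \<oplus>\<^bsub>ring_as_module R\<^esub> s y b" if "x \<in> carrier P" "y \<in> carrier P" for x y
      using module_homsD(2)[OF sp(1) that] b A by (auto simp: free_module_simps)
    show "s (r \<odot>\<^bsub>P\<^esub> x) b = r \<odot>\<^bsub>ring_as_module R\<^esub> s x b" if "r \<in> carrier R" "x \<in> carrier P" for r x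
      using module_homsD(3)[OF sp(1) that] b A by (auto simp: free_module_simps)
  qed
  moreover have "e b \<in> carrier P" if "b \<in> A" for b using e A(2) that by auto
  ultimately show thesis
    using that[of A e "\<lambda>b x. s x b"] A(1) by blast
qed

text \<open>The lift is chosen on the basis of a free module that has P as a summand. The error
  \<phi> - g h lies in X on basis vectors, and hence everywhere.\<close>

lemma projective_lift_modulo:
  fixes P :: "('a, 'p, 'd) module_scheme"
  assumes P: "projective_module R P" and N: "module R N" and L: "module R L"
    and \<phi>: "\<phi> \<in> module_homs R P L" and g: "g \<in> module_homs R N L" and X: "submodule X R L"
    and ex: "\<And>x. x \<in> carrier P \<Longrightarrow> \<exists>y\<in>carrier N. \<phi> x \<ominus>\<^bsub>L\<^esub> g y \<in> X"
  shows "\<exists>h\<in>module_homs R P N. \<forall>x\<in>carrier P. \<phi> x \<ominus>\<^bsub>L\<^esub> g (h x) \<in> X"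
proof -
  obtain B :: "'p set" and s p where sp: "s \<in> module_homs R P (free_module R B)"
    "p \<in> module_homs R (free_module R B) P" "\<And>x. x \<in> carrier P \<Longrightarrow> p (s x) = x" and M: "module R P"
    using P unfolding projective_module_def by auto
  interpret P: module R P by (rule M)
  interpret N: module R N by (rule N)
  interpret L: module R L by (rule L)
  note F = module_free_module[of B]
  have "\<forall>b\<in>B. \<exists>y. y \<in> carrier N \<and> \<phi> (p (free_unit B b)) \<ominus>\<^bsub>L\<^esub> g y \<in> X"
    using ex[OF module_homsD(1)[OF sp(2) free_unit_closed]] by blast
  then obtain \<beta> where \<beta>: "\<And>b. b \<in> B \<Longrightarrow> \<beta> b \<in> carrier N"
    "\<And>b. b \<in> B \<Longrightarrow> \<phi> (p (free_unit B b)) \<ominus>\<^bsub>L\<^esub> g (\<beta> b) \<in> X" by metis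
  then have "\<beta> \<in> B \<rightarrow> carrier N" by auto
  then obtain l where l: "l \<in> module_homs R (free_module R B) N" "\<forall>b\<in>B. l (free_unit B b) = \<beta> b"
    using free_module_lift[OF N, of \<beta> B] by blast
  define k where "k f = \<phi> (p f) \<ominus>\<^bsub>L\<^esub> g (l f)" for f
  have k: "k \<in> module_homs R (free_module R B) L"
    unfolding k_def
    by (rule module_homs_diff[OF F L module_homs_compose[OF sp(2) \<phi>] module_homs_compose[OF l(1) g]])
  have "k f \<in> X" if "f \<in> carrier (free_module R B)" for f
    using that
  proof (induction rule: free_module_induct)
    case zero
    then show ?case using module_homs_zero[OF F L k] submoduleD(2)[OF L X] by simp
  next
    case (add f r a)
    have "k (free_unit B a) \<in> X" unfolding k_def using \<beta>(2)[OF \<open>a \<in> B\<close>] l(2) \<open>a \<in> B\<close> by simp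
    then show ?case
      using module_homsD[OF k] add free_unit_closed[of B a] submoduleD(3,4)[OF L X]
        free_module_smult_closed[of r "free_unit B a" B] by simp
  qed
  then have "\<phi> x \<ominus>\<^bsub>L\<^esub> g (l (s x)) \<in> X" if "x \<in> carrier P" for x
    using sp(3)[OF that] module_homsD(1)[OF sp(1) that] unfolding k_def by metis
  then show ?thesis using module_homs_compose[OF sp(1) l(1)] by (intro bexI[of _ "\<lambda>x. l (s x)"]) auto
qed

end

section \<open>Koszul cohomology of powers and of projective modules\<close>

text \<open>A variant of \<open>cochains_choice\<close> whose relation may depend on the position;
  it serves to lift several cochains simultaneously to one.\<close>

lemma cochains_pointwise_choice:
  assumes "\<And>bs. length bs = n \<Longrightarrow> int (count_list bs True) = p \<Longrightarrow> \<exists>c\<in>B. Q bs c"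
    and "\<And>bs. length bs \<noteq> n \<or> int (count_list bs True) \<noteq> p \<Longrightarrow> Q bs \<zero>\<^bsub>N\<^esub>"
  shows "\<exists>g\<in>cochains N n p B. \<forall>bs. Q bs (g bs)"
proof -
  have "\<forall>bs. \<exists>c. c \<in> (if length bs = n \<and> int (count_list bs True) = p then B else {\<zero>\<^bsub>N\<^esub>}) \<and> Q bs c"
    using assms by (auto split: if_splits)
  then obtain g where "\<forall>bs. g bs \<in> (if length bs = n \<and> int (count_list bs True) = p then B else {\<zero>\<^bsub>N\<^esub>}) \<and> Q bs (g bs)"
    by metis
  then show ?thesis by (intro bexI[of _ g]) (auto simp: cochains_def)
qed

context koszul_local_ring
begin

lemma restrict_inclusion_hom:
  assumes P: "module R P" and Z: "submodule Z R P"
  shows "(\<lambda>x. x) \<in> module_homs R (P\<lparr>carrier := Z\<rparr>) P"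
  by (rule module_homsI) (use submoduleD(1)[OF P Z] in auto)

text \<open>Additive inverses are defined through the carrier, so restricting it might affect the
  differential; naturality along the inclusion shows that it does not.\<close>

lemma koszul_diff_restrict:
  assumes P: "module R P" and Z: "submodule Z R P" and f: "\<forall>bs. f bs \<in> Z"
  shows "D (P\<lparr>carrier := Z\<rparr>) f bs = D P f bs"
  using koszul_diff_natural[OF submodule.submodule_is_module[OF Z P] P restrict_inclusion_hom[OF P Z] xs_carrier, of f bs] f
  by simp

lemma koszul_diff_restrict_natural:
  assumes P: "module R P" and Z: "submodule Z R P" and M: "module R M"
    and t: "t \<in> module_homs R (P\<lparr>carrier := Z\<rparr>) M" and f: "\<forall>bs. f bs \<in> Z"
  shows "t (D P f bs) = D M (\<lambda>b. t (f b)) bs"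
  using koszul_diff_natural[OF submodule.submodule_is_module[OF Z P] M t xs_carrier, of f bs] f
  unfolding koszul_diff_restrict[OF P Z f] by simp

lemma cochains_hom_restrict:
  assumes P: "module R P" and Z: "submodule Z R P" and M: "module R M"
    and t: "t \<in> module_homs R (P\<lparr>carrier := Z\<rparr>) M" and f: "f \<in> C P p Z"
  shows "(\<lambda>bs. t (f bs)) \<in> C M p (carrier M)"
proof -
  have "C (P\<lparr>carrier := Z\<rparr>) p Z = C P p Z" unfolding cochains_def by simp
  with f have "f \<in> C (P\<lparr>carrier := Z\<rparr>) p Z" by simp
  then show ?thesis
    by (rule cochains_hom[OF submodule.submodule_is_module[OF Z P] M t])
      (use module_homsD(1)[OF t] in simp)
qed

lemma restrict_inv:
  assumes P: "module R P" and Z: "submodule Z R P" and y: "y \<in> Z"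
  shows "\<ominus>\<^bsub>P\<lparr>carrier := Z\<rparr>\<^esub> y = \<ominus>\<^bsub>P\<^esub> y"
  using module_homs_inv[OF submodule.submodule_is_module[OF Z P] P restrict_inclusion_hom[OF P Z], of y] y
  by simp

text \<open>The cohomology of Z/B is a sum of n copies of that of M: every coordinate of a cocycle
  is a boundary, and the n bounding cochains are lifted together to a single cochain with values in
  Z.\<close>

lemma vanishes_power_quotient:
  assumes P: "module R P" and Z: "submodule Z R P" and B: "submodule B R P" and BZ: "B \<subseteq> Z"
    and M: "module R M" and \<theta>: "power_coordinates R (P\<lparr>carrier := Z\<rparr>) B M n \<theta>"
    and van: "vanishes M p (carrier M) {\<zero>\<^bsub>M\<^esub>}"
  shows "vanishes P p Z B"
  unfolding vanishes_def
proof (intro ballI impI)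
  interpret P: module R P by fact
  interpret M: module R M by fact
  note t = power_coordinatesD[OF \<theta>, simplified] and z = submoduleD[OF P Z]
  note N = submodule.submodule_is_module[OF Z P]
  fix f assume f: "f \<in> C P p Z" "D P f \<in> C P (p + 1) B"
  have fZ: "\<forall>bs. f bs \<in> Z" using cochains_mem[OF f(1) z(2)] by blast
  have "\<exists>g\<in>C M (p - 1) (carrier M). \<forall>bs. \<theta> i (f bs) = D M g bs" if i: "i < n" for i
  proof -
    have c: "(\<lambda>bs. \<theta> i (f bs)) \<in> C M p (carrier M)" by (rule cochains_hom_restrict[OF P Z M t(1)[OF i] f(1)])
    have "D M (\<lambda>bs. \<theta> i (f bs)) bs = \<zero>\<^bsub>M\<^esub>" for bs
    proof -
      have "D P f bs \<in> B" using cochains_mem[OF f(2) submoduleD(2)[OF P B]] .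
      then have "\<theta> i (D P f bs) = \<zero>\<^bsub>M\<^esub>" using t(3) BZ i by blast
      then show ?thesis using koszul_diff_restrict_natural[OF P Z M t(1)[OF i] fZ] by simp
    qed
    then have "D M (\<lambda>bs. \<theta> i (f bs)) \<in> C M (p + 1) {\<zero>\<^bsub>M\<^esub>}" unfolding cochains_zero_iff by auto
    then obtain g u where "g \<in> C M (p - 1) (carrier M)" "u \<in> C M p {\<zero>\<^bsub>M\<^esub>}"
      "\<forall>bs. \<theta> i (f bs) = D M g bs \<oplus>\<^bsub>M\<^esub> u bs"
      using van c unfolding vanishes_def by blast
    moreover from this have "D M g bs \<in> carrier M" for bs
      using D_closed[OF M cochains_carrier[OF M submodule_carrier[OF M]]] by blast
    ultimately show ?thesis unfolding cochains_zero_iff by auto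
  qed
  then have "\<forall>i. \<exists>g. i < n \<longrightarrow> g \<in> C M (p - 1) (carrier M) \<and> (\<forall>bs. \<theta> i (f bs) = D M g bs)" by blast
  then obtain G where G: "\<And>i. i < n \<Longrightarrow> G i \<in> C M (p - 1) (carrier M)"
    "\<And>i bs. i < n \<Longrightarrow> \<theta> i (f bs) = D M (G i) bs" by metis
  have Gc: "\<forall>bs. G i bs \<in> carrier M" if "i < n" for i
    by (rule cochains_carrier[OF M submodule_carrier[OF M] G(1)[OF that]])
  have "\<exists>g\<in>C P (p - 1) Z. \<forall>bs. \<forall>i<n. \<theta> i (g bs) = G i bs"
  proof (rule cochains_pointwise_choice)
    show "\<exists>c\<in>Z. \<forall>i<n. \<theta> i c = G i bs" for bs using t(2)[of "\<lambda>i. G i bs"] Gc by auto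
    show "\<forall>i<n. \<theta> i \<zero>\<^bsub>P\<^esub> = G i bs" if "length bs \<noteq> length xs \<or> int (count_list bs True) \<noteq> p - 1" for bs
      using cochainsD(2)[OF G(1) that] module_homs_zero[OF N M t(1)] by simp
  qed
  then obtain g where g: "g \<in> C P (p - 1) Z" "\<And>bs i. i < n \<Longrightarrow> \<theta> i (g bs) = G i bs" by blast
  have gZ: "\<forall>bs. g bs \<in> Z" using cochains_mem[OF g(1) z(2)] by blast
  define u where "u bs = f bs \<ominus>\<^bsub>P\<^esub> D P g bs" for bs
  have Dg: "D P g \<in> C P p Z" using koszul_diff_cochains[OF P xs_carrier Z g(1)] by simp
  have DgZ: "D P g bs \<in> Z" for bs using cochains_mem[OF Dg z(2)] .
  have uC: "u \<in> C P p Z" unfolding u_def by (rule cochains_minus[OF P Z f(1) Dg])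
  have "u bs \<in> B" for bs
  proof -
    have uZ: "u bs \<in> Z" using cochains_mem[OF uC z(2)] .
    have u': "u bs = f bs \<ominus>\<^bsub>P\<lparr>carrier := Z\<rparr>\<^esub> D P g bs"
      unfolding u_def using restrict_inv[OF P Z DgZ] by (simp add: a_minus_def)
    have "\<theta> i (u bs) = \<zero>\<^bsub>M\<^esub>" if i: "i < n" for i
    proof -
      have "\<theta> i (u bs) = \<theta> i (f bs) \<ominus>\<^bsub>M\<^esub> \<theta> i (D P g bs)"
        unfolding u' using module_homs_minus[OF N M t(1)[OF i], of "f bs" "D P g bs"] fZ DgZ by simp
      also have "\<theta> i (D P g bs) = D M (G i) bs"
        using koszul_diff_restrict_natural[OF P Z M t(1)[OF i] gZ] g(2)[OF i] by simp
      finally show ?thesis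
        using G(2)[OF i] D_closed[OF M Gc[OF i]] by (simp add: a_minus_def M.r_neg)
    qed
    then show ?thesis using t(3)[OF uZ] by auto
  qed
  then have "u \<in> C P p B" using cochains_restrict[OF uC] by blast
  moreover have "f bs = D P g bs \<oplus>\<^bsub>P\<^esub> u bs" for bs
    unfolding u_def using z(1) fZ DgZ by (simp add: a_minus_def P.a_ac P.r_neg P.r_neg1 P.r_neg2)
  ultimately show "\<exists>g\<in>C P (p - 1) Z. \<exists>u\<in>C P p B. \<forall>bs. f bs = D P g bs \<oplus>\<^bsub>P\<^esub> u bs"
    using g(1) by blast
qed

text \<open>For n > 0 a cocycle of M can be placed in coordinate 0 with zeros elsewhere; bounding it
  in Z/B and reading off coordinate 0 bounds it in M.\<close>

lemma vanishes_of_power_quotient: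
  assumes P: "module R P" and Z: "submodule Z R P" and B: "submodule B R P" and BZ: "B \<subseteq> Z"
    and M: "module R M" and \<theta>: "power_coordinates R (P\<lparr>carrier := Z\<rparr>) B M n \<theta>" and n: "n > 0"
    and van: "vanishes P p Z B"
  shows "vanishes M p (carrier M) {\<zero>\<^bsub>M\<^esub>}"
  unfolding vanishes_def
proof (intro ballI impI)
  interpret P: module R P by fact
  interpret M: module R M by fact
  note t = power_coordinatesD[OF \<theta>, simplified] and z = submoduleD[OF P Z]
  note N = submodule.submodule_is_module[OF Z P]
  fix f assume f: "f \<in> C M p (carrier M)" "D M f \<in> C M (p + 1) {\<zero>\<^bsub>M\<^esub>}"
  have fc: "\<forall>bs. f bs \<in> carrier M" by (rule cochains_carrier[OF M submodule_carrier[OF M] f(1)])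
  have Df: "D M f bs = \<zero>\<^bsub>M\<^esub>" for bs using f(2) unfolding cochains_zero_iff by simp
  have "\<exists>g\<in>C P p Z. \<forall>bs. \<forall>i<n. \<theta> i (g bs) = (if i = 0 then f bs else \<zero>\<^bsub>M\<^esub>)"
  proof (rule cochains_pointwise_choice)
    show "\<exists>c\<in>Z. \<forall>i<n. \<theta> i c = (if i = 0 then f bs else \<zero>\<^bsub>M\<^esub>)" for bs
      using t(2)[of "\<lambda>i. if i = 0 then f bs else \<zero>\<^bsub>M\<^esub>"] fc by auto
    show "\<forall>i<n. \<theta> i \<zero>\<^bsub>P\<^esub> = (if i = 0 then f bs else \<zero>\<^bsub>M\<^esub>)"
      if "length bs \<noteq> length xs \<or> int (count_list bs True) \<noteq> p" for bs
      using cochainsD(2)[OF f(1) that] module_homs_zero[OF N M t(1)] by simp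
  qed
  then obtain F where F: "F \<in> C P p Z" "\<And>bs i. i < n \<Longrightarrow> \<theta> i (F bs) = (if i = 0 then f bs else \<zero>\<^bsub>M\<^esub>)" by blast
  have FZ: "\<forall>bs. F bs \<in> Z" using cochains_mem[OF F(1) z(2)] by blast
  have DF: "D P F \<in> C P (p + 1) Z" by (rule koszul_diff_cochains[OF P xs_carrier Z F(1)])
  have "D P F bs \<in> B" for bs
  proof -
    have "\<theta> i (D P F bs) = \<zero>\<^bsub>M\<^esub>" if i: "i < n" for i
    proof -
      have "(\<lambda>b. \<theta> i (F b)) = (if i = 0 then f else (\<lambda>_. \<zero>\<^bsub>M\<^esub>))" using F(2)[OF i] by auto
      then show ?thesis
        using koszul_diff_restrict_natural[OF P Z M t(1)[OF i] FZ] Df koszul_diff_zero[OF M xs_carrier] by simp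
    qed
    then show ?thesis using t(3)[OF cochains_mem[OF DF z(2)]] by auto
  qed
  then have "D P F \<in> C P (p + 1) B" using cochains_restrict[OF DF] by blast
  then obtain g u where g: "g \<in> C P (p - 1) Z" "u \<in> C P p B" "\<And>bs. F bs = D P g bs \<oplus>\<^bsub>P\<^esub> u bs"
    using van F(1) unfolding vanishes_def by blast
  have gZ: "\<forall>bs. g bs \<in> Z" using cochains_mem[OF g(1) z(2)] by blast
  have "f bs = D M (\<lambda>b. \<theta> 0 (g b)) bs \<oplus>\<^bsub>M\<^esub> \<zero>\<^bsub>M\<^esub>" for bs
  proof -
    have uB: "u bs \<in> B" using cochains_mem[OF g(2) submoduleD(2)[OF P B]] .
    have DgZ: "D P g bs \<in> Z" using cochains_mem[OF koszul_diff_cochains[OF P xs_carrier Z g(1)] z(2)] .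
    have "f bs = \<theta> 0 (D P g bs \<oplus>\<^bsub>P\<^esub> u bs)" using F(2)[OF n] g(3) by simp
    also have "\<dots> = \<theta> 0 (D P g bs) \<oplus>\<^bsub>M\<^esub> \<theta> 0 (u bs)"
      using module_homsD(2)[OF t(1)[OF n], of "D P g bs" "u bs"] DgZ uB BZ by auto
    also have "\<theta> 0 (u bs) = \<zero>\<^bsub>M\<^esub>" using t(3)[of "u bs"] uB BZ n by auto
    also have "\<theta> 0 (D P g bs) = D M (\<lambda>b. \<theta> 0 (g b)) bs"
      by (rule koszul_diff_restrict_natural[OF P Z M t(1)[OF n] gZ])
    finally show ?thesis .
  qed
  moreover have "(\<lambda>b. \<theta> 0 (g b)) \<in> C M (p - 1) (carrier M)" by (rule cochains_hom_restrict[OF P Z M t(1)[OF n] g(1)])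
  moreover have "(\<lambda>_. \<zero>\<^bsub>M\<^esub>) \<in> C M p {\<zero>\<^bsub>M\<^esub>}" unfolding cochains_zero_iff by simp
  ultimately show "\<exists>g\<in>C M (p - 1) (carrier M). \<exists>u\<in>C M p {\<zero>\<^bsub>M\<^esub>}. \<forall>bs. f bs = D M g bs \<oplus>\<^bsub>M\<^esub> u bs"
    by (intro bexI[of _ "\<lambda>b. \<theta> 0 (g b)"] bexI[of _ "\<lambda>_. \<zero>\<^bsub>M\<^esub>"]) auto
qed

section \<open>Vanishing for projective modules\<close>

abbreviation "R\<^sub>m \<equiv> ring_as_module R"

lemma cochains_linear_combination:
  assumes P: "module R P" and B: "finite B"
    and e: "\<And>b. b \<in> B \<Longrightarrow> e b \<in> carrier P" and c: "\<And>b. b \<in> B \<Longrightarrow> c b \<in> C R\<^sub>m p (carrier R)"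
  shows "(\<lambda>bs. finsum P (\<lambda>b. c b bs \<odot>\<^bsub>P\<^esub> e b) B) \<in> C P p (carrier P) \<and>
    (\<forall>bs. D P (\<lambda>bs. finsum P (\<lambda>b. c b bs \<odot>\<^bsub>P\<^esub> e b) B) bs = finsum P (\<lambda>b. D R\<^sub>m (c b) bs \<odot>\<^bsub>P\<^esub> e b) B)"
  using B e c
proof (induction B rule: finite_induct)
  interpret P: module R P by fact
  case empty
  show ?case using koszul_diff_zero[OF P xs_carrier] by (auto simp: cochains_def)
next
  interpret P: module R P by fact
  case (insert a B)
  note RM = module_ring_as_module
  note cP = submodule_carrier[OF P]
  have cc: "\<forall>bs. c b bs \<in> carrier R" if "b \<in> insert a B" for b
    using cochains_carrier[OF RM submodule_carrier[OF RM]] insert.prems(2)[OF that] by simp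
  have Dc: "D R\<^sub>m (c b) bs \<in> carrier R" if "b \<in> insert a B" for b bs
    using D_closed[OF RM, of "c b" bs] cc[OF that] by simp
  define F where "F bs = finsum P (\<lambda>b. c b bs \<odot>\<^bsub>P\<^esub> e b) B" for bs
  have IH: "F \<in> C P p (carrier P)" "\<And>bs. D P F bs = finsum P (\<lambda>b. D R\<^sub>m (c b) bs \<odot>\<^bsub>P\<^esub> e b) B"
    unfolding F_def using insert.IH insert.prems by auto
  have ea: "e a \<in> carrier P" using insert.prems by auto
  note sc = module_homs_scale[OF P ea]
  have A: "(\<lambda>bs. c a bs \<odot>\<^bsub>P\<^esub> e a) \<in> C P p (carrier P)"
    by (rule cochains_hom[OF RM P sc]) (use insert.prems(2)[of a] ea in auto)
  have DA: "D P (\<lambda>bs. c a bs \<odot>\<^bsub>P\<^esub> e a) bs = D R\<^sub>m (c a) bs \<odot>\<^bsub>P\<^esub> e a" for bs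
    using koszul_diff_natural[OF RM P sc xs_carrier, of "c a" bs] cc[of a] by simp
  have e1: "finsum P (\<lambda>b. c b bs \<odot>\<^bsub>P\<^esub> e b) (insert a B) = c a bs \<odot>\<^bsub>P\<^esub> e a \<oplus>\<^bsub>P\<^esub> F bs" for bs
    unfolding F_def by (rule P.finsum_insert[OF insert.hyps]) (use cc insert.prems(1) in auto)
  have e2: "finsum P (\<lambda>b. D R\<^sub>m (c b) bs \<odot>\<^bsub>P\<^esub> e b) (insert a B)
      = D R\<^sub>m (c a) bs \<odot>\<^bsub>P\<^esub> e a \<oplus>\<^bsub>P\<^esub> D P F bs" for bs
    unfolding IH(2) by (rule P.finsum_insert[OF insert.hyps]) (use Dc insert.prems(1) in auto)
  show ?case
    unfolding e1 e2 using cochains_add[OF P cP A IH(1)]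
      D_add[OF P cochains_carrier[OF P cP A] cochains_carrier[OF P cP IH(1)]] DA by simp
qed

text \<open>A cochain has finitely many values, and a finite dual basis for these splits a cocycle
  into cocycles with values in R. Bounding each of them and recombining bounds the cocycle.\<close>

lemma vanishes_projective:
  fixes P :: "('a, 'p, 'd) module_scheme"
  assumes P: "projective_module R P" and van: "vanishes R\<^sub>m p (carrier R\<^sub>m) {\<zero>}"
  shows "vanishes P p (carrier P) {\<zero>\<^bsub>P\<^esub>}"
  unfolding vanishes_def
proof (intro ballI impI)
  have M: "module R P" using P unfolding projective_module_def by simp
  note RM = module_ring_as_module
  interpret P: module R P by (rule M)
  fix f assume f: "f \<in> C P p (carrier P)" "D P f \<in> C P (p + 1) {\<zero>\<^bsub>P\<^esub>}"
  have fc: "\<forall>bs. f bs \<in> carrier P" by (rule cochains_carrier[OF M submodule_carrier[OF M] f(1)])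
  have Df: "D P f = (\<lambda>_. \<zero>\<^bsub>P\<^esub>)" using f(2) unfolding cochains_zero_iff .
  have "range f \<subseteq> insert \<zero>\<^bsub>P\<^esub> (f ` {bs. set bs \<subseteq> UNIV \<and> length bs = length xs})"
    using cochainsD(2)[OF f(1)] by auto
  moreover have "finite {bs::bool list. set bs \<subseteq> UNIV \<and> length bs = length xs}"
    by (rule finite_lists_length_eq) simp
  ultimately have fin: "finite (range f)" using finite_subset by blast
  have sub: "range f \<subseteq> carrier P" using fc by auto
  obtain B :: "'p set" and e s where B: "finite B" and
    es: "\<And>b. b \<in> B \<Longrightarrow> e b \<in> carrier P" "\<And>b. b \<in> B \<Longrightarrow> s b \<in> module_homs R P R\<^sub>m" and
    sum: "\<And>x. x \<in> range f \<Longrightarrow> finsum P (\<lambda>b. s b x \<odot>\<^bsub>P\<^esub> e b) B = x"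
    using projective_dual_basis[OF P fin sub] by blast
  have "\<exists>g\<in>C R\<^sub>m (p - 1) (carrier R\<^sub>m). \<forall>bs. s b (f bs) = D R\<^sub>m g bs" if b: "b \<in> B" for b
  proof -
    have c: "(\<lambda>bs. s b (f bs)) \<in> C R\<^sub>m p (carrier R\<^sub>m)"
      by (rule cochains_hom[OF M RM es(2)[OF b] f(1)]) (rule module_homsD(1)[OF es(2)[OF b]])
    have "D R\<^sub>m (\<lambda>bs. s b (f bs)) bs = \<zero>" for bs
      using koszul_diff_natural[OF M RM es(2)[OF b] xs_carrier, of f bs] fc Df
        module_homs_zero[OF M RM es(2)[OF b]] by simp
    then have "D R\<^sub>m (\<lambda>bs. s b (f bs)) \<in> C R\<^sub>m (p + 1) {\<zero>}"
      using cochains_zero_iff[of _ "R\<^sub>m"] by (simp add: fun_eq_iff)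
    then obtain g u where g: "g \<in> C R\<^sub>m (p - 1) (carrier R\<^sub>m)" "u \<in> C R\<^sub>m p {\<zero>}"
      "\<forall>bs. s b (f bs) = D R\<^sub>m g bs \<oplus>\<^bsub>R\<^sub>m\<^esub> u bs"
      using van c unfolding vanishes_def by blast
    moreover have "D R\<^sub>m g bs \<in> carrier R" for bs
      using D_closed[OF RM cochains_carrier[OF RM submodule_carrier[OF RM] g(1)]] by simp
    moreover have "u = (\<lambda>_. \<zero>)" using g(2) cochains_zero_iff[of u "R\<^sub>m"] by simp
    ultimately show ?thesis by (intro bexI[of _ g]) auto
  qed
  then have "\<forall>b. \<exists>g. b \<in> B \<longrightarrow> g \<in> C R\<^sub>m (p - 1) (carrier R\<^sub>m) \<and> (\<forall>bs. s b (f bs) = D R\<^sub>m g bs)" by blast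
  then obtain G where G: "\<And>b. b \<in> B \<Longrightarrow> G b \<in> C R\<^sub>m (p - 1) (carrier R)"
    "\<And>b bs. b \<in> B \<Longrightarrow> s b (f bs) = D R\<^sub>m (G b) bs" by (metis ring_as_module_simps(1))
  define g where "g = (\<lambda>bs. finsum P (\<lambda>b. G b bs \<odot>\<^bsub>P\<^esub> e b) B)"
  have g: "g \<in> C P (p - 1) (carrier P)" "\<And>bs. D P g bs = finsum P (\<lambda>b. D R\<^sub>m (G b) bs \<odot>\<^bsub>P\<^esub> e b) B"
    unfolding g_def using cochains_linear_combination[OF M B es(1) G(1)] by auto
  have "f bs = D P g bs \<oplus>\<^bsub>P\<^esub> \<zero>\<^bsub>P\<^esub>" for bs
  proof -
    have "f bs = finsum P (\<lambda>b. s b (f bs) \<odot>\<^bsub>P\<^esub> e b) B" by (rule sum[symmetric]) simp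
    also have "\<dots> = finsum P (\<lambda>b. D R\<^sub>m (G b) bs \<odot>\<^bsub>P\<^esub> e b) B"
      by (rule P.finsum_cong') (use G(2) es module_homsD(1)[OF es(2)] fc in \<open>auto simp flip: G(2)\<close>)
    finally show ?thesis
      using g(2) D_closed[OF M cochains_carrier[OF M submodule_carrier[OF M] g(1)]] by simp
  qed
  moreover have "(\<lambda>_. \<zero>\<^bsub>P\<^esub>) \<in> C P p {\<zero>\<^bsub>P\<^esub>}" unfolding cochains_zero_iff by simp
  ultimately show "\<exists>g\<in>C P (p - 1) (carrier P). \<exists>u\<in>C P p {\<zero>\<^bsub>P\<^esub>}. \<forall>bs. f bs = D P g bs \<oplus>\<^bsub>P\<^esub> u bs"
    using g(1) by (intro bexI[of _ g] bexI[of _ "\<lambda>_. \<zero>\<^bsub>P\<^esub>"]) auto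
qed

section \<open>Retractions of maps that are injective modulo the maximal ideal\<close>

lemma unit_functional:
  assumes P: "module R P" and l: "l \<in> module_homs R P R\<^sub>m" and u: "u \<in> carrier P" "l u \<notin> \<mm>"
  shows "\<exists>l'\<in>module_homs R P R\<^sub>m. l' u = \<one>"
proof -
  have lu: "l u \<in> carrier R" using module_homsD(1)[OF l u(1)] by simp
  have U: "l u \<in> Units R" by (rule Units_of_notin_max_ideal[OF lu u(2)])
  show ?thesis
  proof (rule bexI[of _ "\<lambda>x. inv (l u) \<otimes> l x"])
    show "inv (l u) \<otimes> l u = \<one>" using U by simp
    show "(\<lambda>x. inv (l u) \<otimes> l x) \<in> module_homs R P R\<^sub>m"
      using module_homs_smult[OF P module_ring_as_module l, of "inv (l u)"] U by simp
  qed
qed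

text \<open>Suppose that every functional takes d u into the maximal ideal, so that d u is a
  combination with coefficients there. For a cocycle z of R with nonzero class, z d u is then a
  boundary, because the maximal ideal kills the class of z. Injectivity makes z u a boundary, and
  applying l exhibits z = l (z u) as one.\<close>

lemma cohomology_injective_unit_functional:
  fixes W :: "('a, 'p, 'd) module_scheme"
  assumes A: "module R A" and W: "projective_module R W" and d: "d \<in> module_homs R A W"
    and nv: "\<not> vanishes R\<^sub>m r (carrier R\<^sub>m) {\<zero>}"
    and inj: "\<And>f g. f \<in> C A r (carrier A) \<Longrightarrow> D A f = (\<lambda>_. \<zero>\<^bsub>A\<^esub>) \<Longrightarrow> g \<in> C W (r - 1) (carrier W) \<Longrightarrow>
      (\<lambda>bs. d (f bs)) = D W g \<Longrightarrow> \<exists>g'\<in>C A (r - 1) (carrier A). f = D A g'"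
    and u: "u \<in> carrier A" and l: "l \<in> module_homs R A R\<^sub>m" "l u = \<one>"
  shows "\<exists>l'\<in>module_homs R W R\<^sub>m. l' (d u) = \<one>"
proof (rule ccontr)
  assume no: "\<not> ?thesis"
  have MW: "module R W" using W unfolding projective_module_def by simp
  note RM = module_ring_as_module
  interpret A: module R A by (rule A)
  interpret W: module R W by (rule MW)
  have du: "d u \<in> carrier W" using module_homsD(1)[OF d u] .
  \<comment> \<open>A functional with a unit as its value at d u could be rescaled to take the value
    1.\<close>
  have nonunit: "l' (d u) \<in> \<mm>" if "l' \<in> module_homs R W R\<^sub>m" for l'
    using unit_functional[OF MW that du] no by blast
  obtain z where z: "z \<in> C R\<^sub>m r (carrier R\<^sub>m)" "D R\<^sub>m z \<in> C R\<^sub>m (r + 1) {\<zero>}"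
    "\<not> (\<exists>g\<in>C R\<^sub>m (r - 1) (carrier R\<^sub>m). \<exists>v\<in>C R\<^sub>m r {\<zero>}. \<forall>bs. z bs = D R\<^sub>m g bs \<oplus>\<^bsub>R\<^sub>m\<^esub> v bs)"
    using nv unfolding vanishes_def by blast
  have zc: "\<forall>bs. z bs \<in> carrier R" using cochains_carrier[OF RM submodule_carrier[OF RM] z(1)] by simp
  have Dz: "D R\<^sub>m z bs = \<zero>" for bs using z(2) cochains_zero_iff[of _ "R\<^sub>m"] by simp
  have z0: "(\<lambda>_. \<zero>) \<in> C R\<^sub>m r {\<zero>}" using cochains_zero_iff[of _ "R\<^sub>m"] by simp
  have fin: "finite {d u}" "{d u} \<subseteq> carrier W" using du by auto
  obtain B :: "'p set" and e s where B: "finite B" and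
    es: "\<And>b. b \<in> B \<Longrightarrow> e b \<in> carrier W" "\<And>b. b \<in> B \<Longrightarrow> s b \<in> module_homs R W R\<^sub>m" and
    sum': "\<And>x. x \<in> {d u} \<Longrightarrow> finsum W (\<lambda>b. s b x \<odot>\<^bsub>W\<^esub> e b) B = x"
    using projective_dual_basis[OF W fin] by blast
  have sum: "d u = finsum W (\<lambda>b. s b (d u) \<odot>\<^bsub>W\<^esub> e b) B" by (rule sum'[symmetric]) simp
  have sc: "s b (d u) \<in> carrier R" if "b \<in> B" for b using module_homsD(1)[OF es(2)[OF that] du] by simp
  have "\<exists>y\<in>C R\<^sub>m (r - 1) (carrier R\<^sub>m). \<forall>bs. s b (d u) \<otimes> z bs = D R\<^sub>m y bs" if b: "b \<in> B" for b
  proof -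
    obtain g v where g: "g \<in> C R\<^sub>m (r - 1) (carrier R\<^sub>m)" "v \<in> C R\<^sub>m r {\<zero>\<^bsub>R\<^sub>m\<^esub>}"
      "\<forall>bs. s b (d u) \<odot>\<^bsub>R\<^sub>m\<^esub> z bs = D R\<^sub>m g bs \<oplus>\<^bsub>R\<^sub>m\<^esub> v bs"
      using max_ideal_kills_cohomology[OF RM submodule_carrier[OF RM] submodule_zero[OF RM] z(1) _ nonunit[OF es(2)[OF b]]]
        z(2) by auto
    moreover have "D R\<^sub>m g bs \<in> carrier R" for bs
      using D_closed[OF RM cochains_carrier[OF RM submodule_carrier[OF RM] g(1)]] by simp
    moreover have "v = (\<lambda>_. \<zero>)" using g(2) unfolding cochains_zero_iff by simp
    ultimately show ?thesis by (intro bexI[of _ g]) auto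
  qed
  then have "\<forall>b. \<exists>y. b \<in> B \<longrightarrow> y \<in> C R\<^sub>m (r - 1) (carrier R) \<and> (\<forall>bs. s b (d u) \<otimes> z bs = D R\<^sub>m y bs)" by auto
  then obtain Y where Y: "\<And>b. b \<in> B \<Longrightarrow> Y b \<in> C R\<^sub>m (r - 1) (carrier R)"
    "\<And>b bs. b \<in> B \<Longrightarrow> s b (d u) \<otimes> z bs = D R\<^sub>m (Y b) bs" by metis
  define g where "g = (\<lambda>bs. finsum W (\<lambda>b. Y b bs \<odot>\<^bsub>W\<^esub> e b) B)"
  have g: "g \<in> C W (r - 1) (carrier W)" "\<And>bs. D W g bs = finsum W (\<lambda>b. D R\<^sub>m (Y b) bs \<odot>\<^bsub>W\<^esub> e b) B"
    unfolding g_def using cochains_linear_combination[OF MW B es(1) Y(1)] by auto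
  note scu = module_homs_scale[OF A u]
  define f where "f = (\<lambda>bs. z bs \<odot>\<^bsub>A\<^esub> u)"
  have f: "f \<in> C A r (carrier A)"
    unfolding f_def by (rule cochains_hom[OF RM A scu z(1)]) (use u in auto)
  have Df: "D A f = (\<lambda>_. \<zero>\<^bsub>A\<^esub>)"
    unfolding f_def using koszul_diff_natural[OF RM A scu xs_carrier, of z] zc Dz u by (auto simp: fun_eq_iff)
  have "d (f bs) = D W g bs" for bs
  proof -
    have "d (f bs) = z bs \<odot>\<^bsub>W\<^esub> d u" unfolding f_def using module_homsD(3)[OF d] zc u by simp
    also have "\<dots> = z bs \<odot>\<^bsub>W\<^esub> finsum W (\<lambda>b. s b (d u) \<odot>\<^bsub>W\<^esub> e b) B" using sum by simp
    also have "\<dots> = finsum W (\<lambda>b. z bs \<odot>\<^bsub>W\<^esub> (s b (d u) \<odot>\<^bsub>W\<^esub> e b)) B"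
      by (rule W.finsum_smult_ldistr[OF B]) (use zc sc es in auto)
    also have "\<dots> = finsum W (\<lambda>b. D R\<^sub>m (Y b) bs \<odot>\<^bsub>W\<^esub> e b) B"
      by (rule W.finsum_cong')
        (use zc sc es in \<open>auto simp flip: Y(2) simp: W.smult_assoc1[symmetric] m_comm\<close>)
    finally show ?thesis using g(2) by simp
  qed
  then have "(\<lambda>bs. d (f bs)) = D W g" by auto
  from inj[OF f Df g(1) this] obtain h where h: "h \<in> C A (r - 1) (carrier A)" "f = D A h" by blast
  have lh: "(\<lambda>bs. l (h bs)) \<in> C R\<^sub>m (r - 1) (carrier R\<^sub>m)"
    by (rule cochains_hom[OF A RM l(1) h(1)]) (rule module_homsD(1)[OF l(1)])
  have "z bs = D R\<^sub>m (\<lambda>b. l (h b)) bs \<oplus>\<^bsub>R\<^sub>m\<^esub> \<zero>" for bs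
  proof -
    have "l (f bs) = z bs" unfolding f_def using module_homsD(3)[OF l(1), of "z bs" u] zc u l(2) by simp
    moreover have "l (f bs) = D R\<^sub>m (\<lambda>b. l (h b)) bs"
      using koszul_diff_natural[OF A RM l(1) xs_carrier, of h bs] cochains_carrier[OF A submodule_carrier[OF A] h(1)] h(2)
      by simp
    ultimately show ?thesis using zc by simp
  qed
  then have "\<exists>g\<in>C R\<^sub>m (r - 1) (carrier R\<^sub>m). \<exists>v\<in>C R\<^sub>m r {\<zero>}. \<forall>bs. z bs = D R\<^sub>m g bs \<oplus>\<^bsub>R\<^sub>m\<^esub> v bs"
    by (intro bexI[OF _ lh] bexI[OF _ z0]) simp
  then show False using z(3) by simp
qed

text \<open>A dual form of Nakayama's lemma: a proper submodule of R^I is killed, modulo the maximal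
  ideal, by a linear form that is nonzero there. Coordinates are eliminated one at a time. Functions
  are arbitrary off I, hence the conditions on G ask for agreement on I.\<close>

lemma unimodular_rows_everything:
  fixes G :: "('c \<Rightarrow> 'a) set"
  assumes I: "finite I"
    and cl: "\<And>v i. v \<in> G \<Longrightarrow> i \<in> I \<Longrightarrow> v i \<in> carrier R"
    and comb: "\<And>v w r. v \<in> G \<Longrightarrow> w \<in> G \<Longrightarrow> r \<in> carrier R \<Longrightarrow> \<exists>y\<in>G. \<forall>i\<in>I. y i = v i \<oplus> r \<otimes> w i"
    and zero: "\<exists>y\<in>G. \<forall>i\<in>I. y i = \<zero>"
    and unit: "\<And>c. (\<And>i. i \<in> I \<Longrightarrow> c i \<in> carrier R) \<Longrightarrow> \<exists>i\<in>I. c i \<notin> \<mm> \<Longrightarrow>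
      \<exists>v\<in>G. finsum R (\<lambda>i. c i \<otimes> v i) I = \<one>"
    and t: "\<And>i. i \<in> I \<Longrightarrow> t i \<in> carrier R"
  shows "\<exists>v\<in>G. \<forall>i\<in>I. v i = t i"
  using I cl comb zero unit t
proof (induction I arbitrary: G t rule: finite_induct)
  case empty
  then show ?case by auto
next
  case (insert a I)
  note cl = insert.prems(1) and comb = insert.prems(2) and unit = insert.prems(4) and t = insert.prems(5)
  define \<delta> where "\<delta> i = (if i = a then \<one> else \<zero>)" for i
  have "\<exists>v\<in>G. finsum R (\<lambda>i. \<delta> i \<otimes> v i) (insert a I) = \<one>"
    by (rule unit) (use one_notin_max_ideal in \<open>auto simp: \<delta>_def\<close>)
  then obtain v where v: "v \<in> G" "finsum R (\<lambda>i. \<delta> i \<otimes> v i) (insert a I) = \<one>" by blast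
  have sumI: "finsum R (\<lambda>i. c i \<otimes> w i) (insert a I) = c a \<otimes> w a \<oplus> finsum R (\<lambda>i. c i \<otimes> w i) I"
    if "\<And>i. i \<in> insert a I \<Longrightarrow> c i \<in> carrier R" "w \<in> G" for c w
    by (rule finsum_insert[OF insert.hyps]) (use that cl in auto)
  have va: "v a = \<one>"
  proof -
    have "finsum R (\<lambda>i. \<delta> i \<otimes> v i) I = \<zero>"
    proof -
      have "finsum R (\<lambda>i. \<delta> i \<otimes> v i) I = finsum R (\<lambda>i. \<zero>) I"
        by (rule finsum_cong') (use insert.hyps cl[OF v(1)] in \<open>auto simp: \<delta>_def\<close>)
      then show ?thesis by simp
    qed
    then show ?thesis using v(2) sumI[of \<delta> v] v(1) cl[OF v(1)] by (simp add: \<delta>_def)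
  qed
  define G' where "G' = {w \<in> G. w a = \<zero>}"
  \<comment> \<open>A member of \<open>G'\<close> that meets this corrected target meets
    \<open>t\<close> after adding the multiple of \<open>v\<close> by the entry of \<open>t\<close>
    at \<open>a\<close>.\<close>
  have "\<exists>w\<in>G'. \<forall>i\<in>I. w i = t i \<ominus> t a \<otimes> v i"
  proof (rule insert.IH)
    show "w i \<in> carrier R" if "w \<in> G'" "i \<in> I" for w i using that cl unfolding G'_def by auto
    show "\<exists>y\<in>G'. \<forall>i\<in>I. y i = w i \<oplus> r \<otimes> w' i" if "w \<in> G'" "w' \<in> G'" "r \<in> carrier R" for w w' r
      using comb[of w w' r] that unfolding G'_def by auto
    show "\<exists>y\<in>G'. \<forall>i\<in>I. y i = \<zero>" using insert.prems(3) unfolding G'_def by auto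
    show "t i \<ominus> t a \<otimes> v i \<in> carrier R" if "i \<in> I" for i using t that cl[OF v(1)] by auto
    fix c assume c: "\<And>i. i \<in> I \<Longrightarrow> c i \<in> carrier R" "\<exists>i\<in>I. c i \<notin> \<mm>"
    define k where "k = finsum R (\<lambda>i. c i \<otimes> v i) I"
    have kc: "k \<in> carrier R" unfolding k_def using c(1) cl[OF v(1)] by (intro finsum_closed) auto
    \<comment> \<open>The entry at \<open>a\<close> makes \<open>c'\<close> orthogonal to
      \<open>v\<close>. Subtracting the multiple of \<open>v\<close> that is needed to reach
      \<open>G'\<close> therefore preserves the pairing with \<open>c'\<close>, which on
      \<open>G'\<close> is the pairing with \<open>c\<close>.\<close>
    define c' where "c' i = (if i = a then \<ominus> k else c i)" for i
    have c'c: "c' i \<in> carrier R" if "i \<in> insert a I" for i using that c(1) kc unfolding c'_def by auto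
    have sc': "finsum R (\<lambda>i. c' i \<otimes> w i) (insert a I) = \<ominus> k \<otimes> w a \<oplus> finsum R (\<lambda>i. c i \<otimes> w i) I" if w: "w \<in> G" for w
    proof -
      have "finsum R (\<lambda>i. c' i \<otimes> w i) I = finsum R (\<lambda>i. c i \<otimes> w i) I"
        by (rule finsum_cong') (use insert.hyps c(1) cl[OF w] in \<open>auto simp: c'_def\<close>)
      then show ?thesis using sumI[OF c'c w] by (simp add: c'_def)
    qed
    have "\<exists>i\<in>insert a I. c' i \<notin> \<mm>" using c(2) insert.hyps unfolding c'_def by auto
    then obtain w where w: "w \<in> G" "finsum R (\<lambda>i. c' i \<otimes> w i) (insert a I) = \<one>" using unit[of c'] c'c by blast
    have wa: "w a \<in> carrier R" using cl[OF w(1)] by auto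
    obtain y where y: "y \<in> G" "\<And>i. i \<in> insert a I \<Longrightarrow> y i = w i \<oplus> (\<ominus> w a) \<otimes> v i"
      using comb[OF w(1) v(1), of "\<ominus> w a"] wa by auto
    have ya: "y a = \<zero>" using y(2)[of a] va wa by (simp add: r_neg)
    have "finsum R (\<lambda>i. c i \<otimes> y i) I = finsum R (\<lambda>i. c i \<otimes> w i \<oplus> (\<ominus> w a) \<otimes> (c i \<otimes> v i)) I"
    proof (rule finsum_cong')
      show "c i \<otimes> y i = c i \<otimes> w i \<oplus> \<ominus> w a \<otimes> (c i \<otimes> v i)" if i: "i \<in> I" for i
      proof -
        have "c i \<in> carrier R" "w i \<in> carrier R" "v i \<in> carrier R"
          using i c(1) cl[OF w(1)] cl[OF v(1)] by auto
        moreover have "y i = w i \<oplus> (\<ominus> w a) \<otimes> v i" using y(2) i by auto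
        ultimately show ?thesis using wa by (simp add: r_distr m_lcomm)
      qed
    qed (use c(1) cl[OF w(1)] cl[OF v(1)] wa in auto)
    also have "\<dots> = finsum R (\<lambda>i. c i \<otimes> w i) I \<oplus> finsum R (\<lambda>i. (\<ominus> w a) \<otimes> (c i \<otimes> v i)) I"
      by (rule finsum_addf) (use c(1) cl[OF w(1)] cl[OF v(1)] wa in auto)
    also have "finsum R (\<lambda>i. (\<ominus> w a) \<otimes> (c i \<otimes> v i)) I = (\<ominus> w a) \<otimes> k"
      unfolding k_def by (rule finsum_rdistr[symmetric, OF insert.hyps(1)]) (use c(1) cl[OF v(1)] wa in auto)
    also have "finsum R (\<lambda>i. c i \<otimes> w i) I \<oplus> (\<ominus> w a) \<otimes> k = \<one>"
    proof -
      have "finsum R (\<lambda>i. c i \<otimes> w i) I \<in> carrier R" using c(1) cl[OF w(1)] by (intro finsum_closed) auto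
      moreover have "(\<ominus> w a) \<otimes> k = \<ominus> k \<otimes> w a" using wa kc by algebra
      ultimately show ?thesis using w(2) unfolding sc'[OF w(1)] using wa kc by (simp add: a_comm)
    qed
    finally show "\<exists>w\<in>G'. finsum R (\<lambda>i. c i \<otimes> w i) I = \<one>" using y(1) ya unfolding G'_def by auto
  qed
  then obtain w where w: "w \<in> G" "w a = \<zero>" "\<And>i. i \<in> I \<Longrightarrow> w i = t i \<ominus> t a \<otimes> v i" unfolding G'_def by auto
  obtain y where y: "y \<in> G" "\<And>i. i \<in> insert a I \<Longrightarrow> y i = w i \<oplus> t a \<otimes> v i"
    using comb[OF w(1) v(1), of "t a"] t by auto
  have "y i = t i" if i: "i \<in> insert a I" for i
  proof (cases "i = a")
    case True
    then show ?thesis using y(2)[of a] w(2) va t by simp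
  next
    case False
    then have "v i \<in> carrier R" "t i \<in> carrier R" "t a \<in> carrier R" "w i = t i \<ominus> t a \<otimes> v i"
      using i cl[OF v(1)] t w(3) by auto
    then show ?thesis using y(2)[OF i] by (simp add: a_minus_def a_assoc l_neg)
  qed
  then show ?case using y(1) by auto
qed

text \<open>
  The coefficient vectors, in a dual basis at \<open>S\<close>, of the functionals on \<open>W\<close> pulled back to \<open>S\<close> form a
  module that pairs to \<open>1\<close> with every vector that is nonzero modulo the maximal ideal; hence every
  coordinate functional on \<open>S\<close> comes from \<open>W\<close>.
\<close>

lemma retraction_on_finite_set:
  fixes A :: "('a, 'p, 'd) module_scheme"
  assumes A: "projective_module R A" and W: "module R W" and d: "d \<in> module_homs R A W"
    and unit: "\<And>u l. u \<in> carrier A \<Longrightarrow> l \<in> module_homs R A R\<^sub>m \<Longrightarrow> l u = \<one> \<Longrightarrow>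
      \<exists>l'\<in>module_homs R W R\<^sub>m. l' (d u) = \<one>"
    and S: "finite S" "S \<subseteq> carrier A"
  shows "\<exists>r\<in>module_homs R W A. \<forall>x\<in>S. r (d x) = x"
proof -
  have MA: "module R A" using A unfolding projective_module_def by simp
  interpret A: module R A by (rule MA)
  interpret W: module R W by (rule W)
  note RM = module_ring_as_module
  obtain B :: "'p set" and e s where B: "finite B" and
    es: "\<And>b. b \<in> B \<Longrightarrow> e b \<in> carrier A" "\<And>b. b \<in> B \<Longrightarrow> s b \<in> module_homs R A R\<^sub>m" and
    sum: "\<And>x. x \<in> S \<Longrightarrow> finsum A (\<lambda>b. s b x \<odot>\<^bsub>A\<^esub> e b) B = x"
    using projective_dual_basis[OF A S] by blast
  have sc: "s b x \<in> carrier R" if "b \<in> B" "x \<in> carrier A" for b x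
    using module_homsD(1)[OF es(2)[OF that(1)] that(2)] by simp
  have Sc: "x \<in> carrier A" if "x \<in> S" for x using S(2) that by auto
  have lsum: "l (finsum A (\<lambda>b. c b \<odot>\<^bsub>A\<^esub> e b) B) = finsum R (\<lambda>b. c b \<otimes> l (e b)) B"
    if l: "l \<in> module_homs R A R\<^sub>m" and c: "\<And>b. b \<in> B \<Longrightarrow> c b \<in> carrier R" for l c
  proof -
    have "B' \<subseteq> B \<Longrightarrow> l (finsum A (\<lambda>b. c b \<odot>\<^bsub>A\<^esub> e b) B') = finsum R (\<lambda>b. c b \<otimes> l (e b)) B'" for B'
    proof (induction B' rule: infinite_finite_induct)
      case (infinite B')
      then show ?case using B finite_subset by blast
    next
      case empty
      then show ?case using module_homs_zero[OF MA RM l] by simp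
    next
      case (insert a B')
      have le: "l (e b) \<in> carrier R" if "b \<in> B" for b using module_homsD(1)[OF l es(1)[OF that]] by simp
      have i1: "finsum A (\<lambda>b. c b \<odot>\<^bsub>A\<^esub> e b) (insert a B') = c a \<odot>\<^bsub>A\<^esub> e a \<oplus>\<^bsub>A\<^esub> finsum A (\<lambda>b. c b \<odot>\<^bsub>A\<^esub> e b) B'"
        by (rule A.finsum_insert[OF insert.hyps(1,2)]) (use insert.prems c es in \<open>auto simp: subset_iff\<close>)
      have i2: "finsum R (\<lambda>b. c b \<otimes> l (e b)) (insert a B') = c a \<otimes> l (e a) \<oplus> finsum R (\<lambda>b. c b \<otimes> l (e b)) B'"
        by (rule finsum_insert[OF insert.hyps(1,2)]) (use insert.prems c le in \<open>auto simp: subset_iff\<close>)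
      have cl: "finsum A (\<lambda>b. c b \<odot>\<^bsub>A\<^esub> e b) B' \<in> carrier A" "c a \<odot>\<^bsub>A\<^esub> e a \<in> carrier A" "c a \<in> carrier R" "e a \<in> carrier A"
        using insert.prems c es by (auto simp: subset_iff intro!: A.finsum_closed)
      show ?case
        unfolding i1 i2 using module_homsD(2)[OF l cl(2,1)] module_homsD(3)[OF l cl(3,4)] insert by simp
    qed
    then show ?thesis by blast
  qed
  define G where "G = {v. (\<forall>b\<in>B. v b \<in> carrier R) \<and>
    (\<exists>\<mu>\<in>module_homs R W R\<^sub>m. \<forall>x\<in>S. \<mu> (d x) = finsum R (\<lambda>b. s b x \<otimes> v b) B)}"
  have GI: "v \<in> G" if "\<And>b. b \<in> B \<Longrightarrow> v b \<in> carrier R" "\<mu> \<in> module_homs R W R\<^sub>m"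
    "\<And>x. x \<in> S \<Longrightarrow> \<mu> (d x) = finsum R (\<lambda>b. s b x \<otimes> v b) B" for v \<mu>
    using that unfolding G_def by blast
  have every: "\<exists>v\<in>G. \<forall>b\<in>B. v b = t b" if t: "\<And>b. b \<in> B \<Longrightarrow> t b \<in> carrier R" for t
  proof (rule unimodular_rows_everything[OF B])
    show "v b \<in> carrier R" if "v \<in> G" "b \<in> B" for v b using that unfolding G_def by auto
    show "t b \<in> carrier R" if "b \<in> B" for b using t[OF that] .
    have "(\<lambda>_. \<zero>) \<in> G"
    proof (rule GI[OF _ module_homs_const_zero[OF RM]])
      show "\<zero>\<^bsub>R\<^sub>m\<^esub> = finsum R (\<lambda>b. s b x \<otimes> \<zero>) B" if "x \<in> S" for x
      proof -
        have "finsum R (\<lambda>b. s b x \<otimes> \<zero>) B = finsum R (\<lambda>b. \<zero>) B"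
          by (rule finsum_cong') (use sc Sc[OF that] in auto)
        then show ?thesis by simp
      qed
    qed auto
    then show "\<exists>y\<in>G. \<forall>b\<in>B. y b = \<zero>" by auto
  next
    fix v w r assume v: "v \<in> G" and w: "w \<in> G" and r: "r \<in> carrier R"
    obtain \<mu> where \<mu>: "\<forall>b\<in>B. v b \<in> carrier R" "\<mu> \<in> module_homs R W R\<^sub>m"
      "\<forall>x\<in>S. \<mu> (d x) = finsum R (\<lambda>b. s b x \<otimes> v b) B" using v unfolding G_def by auto
    obtain \<nu> where \<nu>: "\<forall>b\<in>B. w b \<in> carrier R" "\<nu> \<in> module_homs R W R\<^sub>m"
      "\<forall>x\<in>S. \<nu> (d x) = finsum R (\<lambda>b. s b x \<otimes> w b) B" using w unfolding G_def by auto
    have "(\<lambda>b. v b \<oplus> r \<otimes> w b) \<in> G"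
    proof (rule GI)
      show "(\<lambda>x. \<mu> x \<oplus>\<^bsub>R\<^sub>m\<^esub> r \<odot>\<^bsub>R\<^sub>m\<^esub> \<nu> x) \<in> module_homs R W R\<^sub>m"
        by (rule module_homs_add[OF W RM \<mu>(2) module_homs_smult[OF W RM \<nu>(2) r]])
      show "v b \<oplus> r \<otimes> w b \<in> carrier R" if "b \<in> B" for b using \<mu> \<nu> r that by auto
      fix x assume x: "x \<in> S"
      have "finsum R (\<lambda>b. s b x \<otimes> (v b \<oplus> r \<otimes> w b)) B = finsum R (\<lambda>b. s b x \<otimes> v b \<oplus> r \<otimes> (s b x \<otimes> w b)) B"
        by (rule finsum_cong') (use \<mu>(1) \<nu>(1) r sc Sc[OF x] in \<open>auto simp: r_distr m_lcomm\<close>)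
      also have "\<dots> = finsum R (\<lambda>b. s b x \<otimes> v b) B \<oplus> finsum R (\<lambda>b. r \<otimes> (s b x \<otimes> w b)) B"
        by (rule finsum_addf) (use \<mu>(1) \<nu>(1) r sc Sc[OF x] in auto)
      also have "finsum R (\<lambda>b. r \<otimes> (s b x \<otimes> w b)) B = r \<otimes> finsum R (\<lambda>b. s b x \<otimes> w b) B"
        by (rule finsum_rdistr[symmetric, OF B r]) (use \<nu>(1) sc Sc[OF x] in auto)
      finally show "\<mu> (d x) \<oplus>\<^bsub>R\<^sub>m\<^esub> r \<odot>\<^bsub>R\<^sub>m\<^esub> \<nu> (d x) = finsum R (\<lambda>b. s b x \<otimes> (v b \<oplus> r \<otimes> w b)) B"
        using \<mu>(3) \<nu>(3) x by simp
    qed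
    then show "\<exists>y\<in>G. \<forall>b\<in>B. y b = v b \<oplus> r \<otimes> w b" by auto
  next
    fix c assume c: "\<And>b. b \<in> B \<Longrightarrow> c b \<in> carrier R" and ex: "\<exists>b\<in>B. c b \<notin> \<mm>"
    define a where "a = finsum A (\<lambda>b. c b \<odot>\<^bsub>A\<^esub> e b) B"
    have ac: "a \<in> carrier A" unfolding a_def using c es by (intro A.finsum_closed) auto
    have sumS: "finsum R (\<lambda>b. s b x \<otimes> l (e b)) B = l x" if "x \<in> S" "l \<in> module_homs R A R\<^sub>m" for x l
      using lsum[OF that(2), of "\<lambda>b. s b x"] sc Sc[OF that(1)] sum[OF that(1)] by simp
    show "\<exists>v\<in>G. finsum R (\<lambda>b. c b \<otimes> v b) B = \<one>"
    proof (cases "\<exists>l\<in>module_homs R A R\<^sub>m. l a = \<one>")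
      case True
      \<comment> \<open>If some functional takes the combination \<open>a\<close> of the vectors
        \<open>e b\<close> to 1, the hypothesis supplies one on W, and its values at the vectors d
        (e b) pair with \<open>c\<close> to 1.\<close>
      then obtain \<mu> where \<mu>: "\<mu> \<in> module_homs R W R\<^sub>m" "\<mu> (d a) = \<one>" using unit[OF ac] by blast
      have \<mu>d: "(\<lambda>x. \<mu> (d x)) \<in> module_homs R A R\<^sub>m" by (rule module_homs_compose[OF d \<mu>(1)])
      have "(\<lambda>b. \<mu> (d (e b))) \<in> G"
        by (rule GI[OF _ \<mu>(1)]) (use module_homsD(1)[OF \<mu>d es(1)] sumS[OF _ \<mu>d] in auto)
      moreover have "finsum R (\<lambda>b. c b \<otimes> \<mu> (d (e b))) B = \<one>"
        using lsum[OF \<mu>d c] \<mu>(2) unfolding a_def by simp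
      ultimately show ?thesis by (intro bexI[of _ "\<lambda>b. \<mu> (d (e b))"])
    next
      case False
      then have sm: "s b a \<in> \<mm>" if "b \<in> B" for b using unit_functional[OF MA es(2)[OF that] ac] by blast
      obtain b where b: "b \<in> B" "c b \<notin> \<mm>" using ex by blast
      define \<delta> where "\<delta> b' = (if b' = b then \<one> else \<zero>)" for b'
      have delta: "finsum R (\<lambda>b'. k b' \<otimes> \<delta> b') B = k b" if "\<And>b'. b' \<in> B \<Longrightarrow> k b' \<in> carrier R" for k
      proof -
        have "finsum R (\<lambda>b'. k b' \<otimes> \<delta> b') B = finsum R (\<lambda>b'. if b = b' then k b' else \<zero>) B"
          by (rule finsum_cong') (use that in \<open>auto simp: \<delta>_def\<close>)
        then show ?thesis using finsum_singleton[OF b(1) B, of k] that by auto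
      qed
      \<comment> \<open>The vectors \<open>e b\<close> may be dependent. This is the row at
        \<open>b\<close> of 1 - E, where E has the entries s_b(e_b'). It annihilates the coordinates
        of each x in S, so the zero functional puts it into \<open>G\<close>; it pairs with
        \<open>c\<close> to c_b - s_b(a), a unit because s_b(a) lies in the maximal ideal.\<close>
      define v where "v b' = \<delta> b' \<ominus> s b (e b')" for b'
      have sbe: "s b (e b') \<in> carrier R" if "b' \<in> B" for b' using sc[OF b(1) es(1)[OF that]] .
      have vc: "v b' \<in> carrier R" if "b' \<in> B" for b' unfolding v_def \<delta>_def using sbe[OF that] by auto
      have sumv: "finsum R (\<lambda>b'. k b' \<otimes> v b') B = k b \<ominus> finsum R (\<lambda>b'. k b' \<otimes> s b (e b')) B"
        if k: "\<And>b'. b' \<in> B \<Longrightarrow> k b' \<in> carrier R" for k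
      proof -
        have "finsum R (\<lambda>b'. k b' \<otimes> v b') B = finsum R (\<lambda>b'. k b' \<otimes> \<delta> b' \<oplus> (\<ominus> \<one>) \<otimes> (k b' \<otimes> s b (e b'))) B"
          by (rule finsum_cong') (use k sbe in \<open>auto simp: v_def \<delta>_def a_minus_def r_distr r_minus l_minus\<close>)
        also have "\<dots> = finsum R (\<lambda>b'. k b' \<otimes> \<delta> b') B \<oplus> finsum R (\<lambda>b'. (\<ominus> \<one>) \<otimes> (k b' \<otimes> s b (e b'))) B"
          by (rule finsum_addf) (use k sbe in \<open>auto simp: \<delta>_def\<close>)
        also have "finsum R (\<lambda>b'. (\<ominus> \<one>) \<otimes> (k b' \<otimes> s b (e b'))) B = (\<ominus> \<one>) \<otimes> finsum R (\<lambda>b'. k b' \<otimes> s b (e b')) B"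
          by (rule finsum_rdistr[symmetric, OF B]) (use k sbe in auto)
        moreover have "finsum R (\<lambda>b'. k b' \<otimes> s b (e b')) B \<in> carrier R" using k sbe by (intro finsum_closed) auto
        ultimately show ?thesis using delta[OF k] by (simp add: a_minus_def l_minus)
      qed
      have "v \<in> G"
      proof (rule GI[OF vc module_homs_const_zero[OF RM]])
        show "\<zero>\<^bsub>R\<^sub>m\<^esub> = finsum R (\<lambda>b. s b x \<otimes> v b) B" if x: "x \<in> S" for x
          using sumv[of "\<lambda>b'. s b' x"] sc[OF _ Sc[OF x]] sumS[OF x es(2)[OF b(1)]] b(1) by (simp add: a_minus_def r_neg)
      qed
      have k: "finsum R (\<lambda>b'. c b' \<otimes> v b') B = c b \<ominus> s b a"
        using sumv[OF c] lsum[OF es(2)[OF b(1)] c] unfolding a_def by simp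
      have cb: "c b \<in> carrier R" "s b a \<in> carrier R" using c b(1) sc[OF b(1) ac] by auto
      have "c b \<ominus> s b a \<notin> \<mm>"
      proof
        assume "c b \<ominus> s b a \<in> \<mm>"
        then have "(c b \<ominus> s b a) \<oplus> s b a \<in> \<mm>" using sm[OF b(1)] mm.a_closed by auto
        moreover have "(c b \<ominus> s b a) \<oplus> s b a = c b" using cb by algebra
        ultimately show False using b(2) by simp
      qed
      then have U: "c b \<ominus> s b a \<in> Units R" using Units_of_notin_max_ideal cb by auto
      define i where "i = inv (c b \<ominus> s b a)"
      have ic: "i \<in> carrier R" "i \<otimes> (c b \<ominus> s b a) = \<one>" using U unfolding i_def by auto
      have "(\<lambda>b'. i \<otimes> v b') \<in> G"
      proof (rule GI[OF _ module_homs_const_zero[OF RM]])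
        show "i \<otimes> v b' \<in> carrier R" if "b' \<in> B" for b' using ic vc[OF that] by auto
        show "\<zero>\<^bsub>R\<^sub>m\<^esub> = finsum R (\<lambda>b'. s b' x \<otimes> (i \<otimes> v b')) B" if x: "x \<in> S" for x
        proof -
          have "finsum R (\<lambda>b'. s b' x \<otimes> (i \<otimes> v b')) B = finsum R (\<lambda>b'. i \<otimes> (s b' x \<otimes> v b')) B"
            by (rule finsum_cong') (use ic vc sc Sc[OF x] in \<open>auto simp: m_lcomm\<close>)
          also have "\<dots> = i \<otimes> finsum R (\<lambda>b'. s b' x \<otimes> v b') B"
            by (rule finsum_rdistr[symmetric, OF B ic(1)]) (use vc sc Sc[OF x] in auto)
          also have "finsum R (\<lambda>b'. s b' x \<otimes> v b') B = \<zero>"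
            using sumv[of "\<lambda>b'. s b' x"] sc[OF _ Sc[OF x]] sumS[OF x es(2)[OF b(1)]] b(1) by (simp add: a_minus_def r_neg)
          finally show ?thesis using ic by simp
        qed
      qed
      moreover have "finsum R (\<lambda>b'. c b' \<otimes> (i \<otimes> v b')) B = \<one>"
      proof -
        have "finsum R (\<lambda>b'. c b' \<otimes> (i \<otimes> v b')) B = finsum R (\<lambda>b'. i \<otimes> (c b' \<otimes> v b')) B"
          by (rule finsum_cong') (use ic vc c in \<open>auto simp: m_lcomm\<close>)
        also have "\<dots> = i \<otimes> finsum R (\<lambda>b'. c b' \<otimes> v b') B"
          by (rule finsum_rdistr[symmetric, OF B ic(1)]) (use vc c in auto)
        finally show ?thesis using k ic by simp
      qed
      ultimately show ?thesis by (intro bexI[of _ "\<lambda>b'. i \<otimes> v b'"])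
    qed
  qed
  \<comment> \<open>Each coordinate functional on S is thus induced from W along \<open>d\<close>;
    weighting the vectors \<open>e b\<close> by these functionals gives the retraction.\<close>
  have "\<exists>\<mu>\<in>module_homs R W R\<^sub>m. \<forall>x\<in>S. \<mu> (d x) = s b x" if b: "b \<in> B" for b
  proof -
    have "\<exists>v\<in>G. \<forall>b'\<in>B. v b' = (if b' = b then \<one> else \<zero>)" by (rule every) simp
    then obtain v where v: "v \<in> G" "\<forall>b'\<in>B. v b' = (if b' = b then \<one> else \<zero>)" by blast
    then obtain \<mu> where \<mu>: "\<mu> \<in> module_homs R W R\<^sub>m" "\<forall>x\<in>S. \<mu> (d x) = finsum R (\<lambda>b. s b x \<otimes> v b) B"
      unfolding G_def by auto
    have "finsum R (\<lambda>b'. s b' x \<otimes> v b') B = s b x" if x: "x \<in> S" for x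
    proof -
      have "finsum R (\<lambda>b'. s b' x \<otimes> v b') B = finsum R (\<lambda>b'. if b = b' then s b' x else \<zero>) B"
        by (rule finsum_cong') (use v(2) sc Sc[OF x] in auto)
      then show ?thesis using finsum_singleton[OF b B, of "\<lambda>b'. s b' x"] sc Sc[OF x] by auto
    qed
    then show ?thesis using \<mu> by auto
  qed
  then obtain \<mu> where \<mu>: "\<And>b. b \<in> B \<Longrightarrow> \<mu> b \<in> module_homs R W R\<^sub>m" "\<And>b x. b \<in> B \<Longrightarrow> x \<in> S \<Longrightarrow> \<mu> b (d x) = s b x"
    by metis
  have hom: "B' \<subseteq> B \<Longrightarrow> (\<lambda>w. finsum A (\<lambda>b. \<mu> b w \<odot>\<^bsub>A\<^esub> e b) B') \<in> module_homs R W A" for B'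
  proof (induction B' rule: infinite_finite_induct)
    case (infinite B')
    then show ?case using B finite_subset by blast
  next
    case empty
    then show ?case using module_homs_const_zero[OF MA] by simp
  next
    case (insert a B')
    have aB: "a \<in> B" using insert.prems by auto
    have "(\<lambda>w. \<mu> a w \<odot>\<^bsub>A\<^esub> e a) \<in> module_homs R W A"
      by (rule module_homs_compose[OF \<mu>(1)[OF aB] module_homs_scale[OF MA es(1)[OF aB]]])
    then have h: "(\<lambda>w. \<mu> a w \<odot>\<^bsub>A\<^esub> e a \<oplus>\<^bsub>A\<^esub> finsum A (\<lambda>b. \<mu> b w \<odot>\<^bsub>A\<^esub> e b) B') \<in> module_homs R W A"
      using insert by (intro module_homs_add[OF W MA]) auto
    have "finsum A (\<lambda>b. \<mu> b w \<odot>\<^bsub>A\<^esub> e b) (insert a B') = \<mu> a w \<odot>\<^bsub>A\<^esub> e a \<oplus>\<^bsub>A\<^esub> finsum A (\<lambda>b. \<mu> b w \<odot>\<^bsub>A\<^esub> e b) B'"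
      if "w \<in> carrier W" for w
      by (rule A.finsum_insert[OF insert.hyps(1,2)])
        (use insert.prems es module_homsD(1)[OF \<mu>(1)] that in \<open>auto simp: subset_iff\<close>)
    then show ?case
      by (intro module_homsI)
        (use module_homsD[OF h] W.smult_closed W.a_closed in auto)
  qed
  have "finsum A (\<lambda>b. \<mu> b (d x) \<odot>\<^bsub>A\<^esub> e b) B = x" if x: "x \<in> S" for x
  proof -
    have "finsum A (\<lambda>b. \<mu> b (d x) \<odot>\<^bsub>A\<^esub> e b) B = finsum A (\<lambda>b. s b x \<odot>\<^bsub>A\<^esub> e b) B"
      by (rule A.finsum_cong') (use \<mu>(2) x es sc Sc[OF x] in auto)
    then show ?thesis using sum[OF x] by simp
  qed
  then show ?thesis using hom[of B] by (intro bexI[of _ "\<lambda>w. finsum A (\<lambda>b. \<mu> b w \<odot>\<^bsub>A\<^esub> e b) B"]) auto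
qed

end

section \<open>Complexes with homology in sums of copies of one module\<close>

locale koszul_complex = koszul_local_ring R xs
  for R :: "('a, 'r) ring_scheme" (structure) and xs +
  fixes P :: "('a, 'p) complex_data"
  assumes complex: "is_complex R P"
begin

abbreviation "X \<equiv> obj P"
abbreviation "d \<equiv> differential P"

definition Z :: "int \<Rightarrow> 'p set" where
  "Z q = a_kernel (X q) (X (q - 1)) (d q)"

definition B :: "int \<Rightarrow> 'p set" where
  "B q = d (q + 1) ` carrier (X (q + 1))"

lemma module_X: "module R (X q)"
  using complex unfolding is_complex_def by blast

lemma d_hom: "d q \<in> module_homs R (X q) (X (q - 1))"
  using complex unfolding is_complex_def by blast

lemma d_hom_Suc: "d (q + 1) \<in> module_homs R (X (q + 1)) (X q)"
  using d_hom[of "q + 1"] by simp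

lemma d_d_Suc: "x \<in> carrier (X (q + 1)) \<Longrightarrow> d q (d (q + 1) x) = \<zero>\<^bsub>X (q - 1)\<^esub>"
  using complex unfolding is_complex_def by blast

lemma d_d: "x \<in> carrier (X q) \<Longrightarrow> d (q - 1) (d q x) = \<zero>\<^bsub>X (q - 1 - 1)\<^esub>"
  using d_d_Suc[of x "q - 1"] by simp

lemma Z_iff: "x \<in> Z q \<longleftrightarrow> x \<in> carrier (X q) \<and> d q x = \<zero>\<^bsub>X (q - 1)\<^esub>"
  unfolding Z_def a_kernel_def' by auto

lemma submodule_Z: "submodule (Z q) R (X q)"
proof -
  have "Z q = {x \<in> carrier (X q). d q x \<in> {\<zero>\<^bsub>X (q - 1)\<^esub>}}" using Z_iff by auto
  then show ?thesis
    using submodule_vimage[OF module_X module_X d_hom submodule_zero[OF module_X]] by simp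
qed

lemma submodule_B: "submodule (B q) R (X q)"
  unfolding B_def by (rule submodule_image[OF module_X module_X d_hom_Suc submodule_carrier[OF module_X]])

lemma B_subset_Z: "B q \<subseteq> Z q"
  unfolding B_def using Z_iff d_d_Suc module_homsD(1)[OF d_hom_Suc] by auto

lemma zero_X:
  assumes "zero_module (X q)"
  shows "carrier (X q) = {\<zero>\<^bsub>X q\<^esub>}" "Z q = B q"
proof -
  show "carrier (X q) = {\<zero>\<^bsub>X q\<^esub>}" using assms unfolding zero_module_def .
  moreover have "Z q \<subseteq> carrier (X q)" using submoduleD(1)[OF module_X submodule_Z] by blast
  moreover have "\<zero>\<^bsub>X q\<^esub> \<in> B q" by (rule submoduleD(2)[OF module_X submodule_B])
  ultimately show "Z q = B q" using B_subset_Z by auto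
qed

lemma Z_eq_B_iff_of_coordinates:
  assumes M: "module R M" and nonzero: "\<not> zero_module M"
    and \<theta>: "power_coordinates R ((X q)\<lparr>carrier := Z q\<rparr>) (B q) M n \<theta>"
  shows "Z q = B q \<longleftrightarrow> n = 0"
proof
  interpret M: module R M by (rule M)
  note t = power_coordinatesD[OF \<theta>, simplified]
  show "Z q = B q" if "n = 0" using t(3) B_subset_Z that by auto
  assume e: "Z q = B q"
  show "n = 0"
  proof (rule ccontr)
    assume n: "n \<noteq> 0"
    obtain m where m: "m \<in> carrier M" "m \<noteq> \<zero>\<^bsub>M\<^esub>" using nonzero M.zero_closed unfolding zero_module_def by blast
    then obtain z where "z \<in> Z q" "\<forall>i<n. \<theta> i z = m" using t(2)[of "\<lambda>_. m"] by auto
    then show False using t(3)[of z] e n m by auto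
  qed
qed

end

text \<open>The degrees \<open>l\<close> and \<open>c\<close> are mere bounds for the nonzero
  modules, so a complex is shortened by lowering \<open>c\<close> even if the new top module happens
  to be zero. In contrast, \<open>s\<close> is the exact top degree of homology.\<close>

locale power_homology_complex = koszul_complex R xs P
  for R :: "('a, 'r) ring_scheme" (structure) and xs and P :: "('a, 'p) complex_data" +
  fixes M :: "('a, 'm, 'd) module_scheme" and a :: "int \<Rightarrow> nat" and l c s :: int
  assumes projective: "\<And>i. projective_module R (obj P i)"
    and M: "module R M" and M_fg: "finitely_generated R M" and M_nonzero: "\<not> zero_module M"
    and above: "\<And>i. i > c \<Longrightarrow> zero_module (obj P i)"
    and below: "\<And>i. i < l \<Longrightarrow> zero_module (obj P i)"
    and coordinates_ZB: "\<And>q. \<exists>\<theta>. power_coordinates R ((X q)\<lparr>carrier := Z q\<rparr>) (B q) M (a q) \<theta>"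
    and top_homology: "a s \<noteq> 0" "\<And>i. i > s \<Longrightarrow> a i = 0"
begin

lemma Z_eq_B_iff: "Z q = B q \<longleftrightarrow> a q = 0"
  using coordinates_ZB[of q] Z_eq_B_iff_of_coordinates[OF M M_nonzero] by blast

lemma s_le_c: "s \<le> c"
  using top_homology(1) above[of s] zero_X(2)[of s] Z_eq_B_iff[of s] by force

lemma l_le_s: "l \<le> s"
  using top_homology(1) below[of s] zero_X(2)[of s] Z_eq_B_iff[of s] by force

section \<open>Chases in the double complex of Koszul cochains\<close>

lemma X_carrier: "f \<in> C (X q) p (carrier (X q)) \<Longrightarrow> \<forall>bs. f bs \<in> carrier (X q)"
  by (rule cochains_carrier[OF module_X submodule_carrier[OF module_X]])

lemma d_cochain:
  "f \<in> C (X q) p (carrier (X q)) \<Longrightarrow> (\<lambda>bs. d q (f bs)) \<in> C (X (q - 1)) p (carrier (X (q - 1)))"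
  by (erule cochains_hom[OF module_X module_X d_hom]) (rule module_homsD(1)[OF d_hom])

lemma d_cochain_B:
  "f \<in> C (X (q + 1)) p (carrier (X (q + 1))) \<Longrightarrow> (\<lambda>bs. d (q + 1) (f bs)) \<in> C (X q) p (B q)"
  by (erule cochains_hom[OF module_X module_X d_hom_Suc]) (auto simp: B_def)

lemma d_D:
  "f \<in> C (X q) p (carrier (X q)) \<Longrightarrow> d q (D (X q) f bs) = D (X (q - 1)) (\<lambda>b. d q (f b)) bs"
  by (rule koszul_diff_natural[OF module_X module_X d_hom xs_carrier]) (use X_carrier in blast)

lemma d_D_Suc:
  "f \<in> C (X (q + 1)) p (carrier (X (q + 1))) \<Longrightarrow> d (q + 1) (D (X (q + 1)) f bs) = D (X q) (\<lambda>b. d (q + 1) (f b)) bs"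
  using d_D[of f "q + 1"] by simp

lemma B_cochain_lift:
  assumes "f \<in> C (X q) p (B q)"
  shows "\<exists>w\<in>C (X (q + 1)) p (carrier (X (q + 1))). \<forall>bs. f bs = d (q + 1) (w bs)"
proof (rule cochains_choice[OF assms])
  interpret X': module R "X (q + 1)" by (rule module_X)
  show "\<exists>y\<in>carrier (X (q + 1)). x = d (q + 1) y" if "x \<in> B q" for x using that unfolding B_def by auto
  show "\<zero>\<^bsub>X q\<^esub> = d (q + 1) \<zero>\<^bsub>X (q + 1)\<^esub>" using module_homs_zero[OF module_X module_X d_hom_Suc] by simp
  show "\<zero>\<^bsub>X (q + 1)\<^esub> \<in> carrier (X (q + 1))" by simp
qed

lemma D_cochain: "f \<in> C (X q) p (carrier (X q)) \<Longrightarrow> D (X q) f \<in> C (X q) (p + 1) (carrier (X q))"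
  by (rule koszul_diff_cochains[OF module_X xs_carrier submodule_carrier[OF module_X]])

lemma row_exact:
  assumes "vanishes (X q) p (carrier (X q)) {\<zero>\<^bsub>X q\<^esub>}"
    and f: "f \<in> C (X q) p (carrier (X q))" "\<And>bs. D (X q) f bs = \<zero>\<^bsub>X q\<^esub>"
  shows "\<exists>g\<in>C (X q) (p - 1) (carrier (X q)). \<forall>bs. f bs = D (X q) g bs"
proof -
  interpret Xq: module R "X q" by (rule module_X)
  have "D (X q) f \<in> C (X q) (p + 1) {\<zero>\<^bsub>X q\<^esub>}" using f(2) unfolding cochains_zero_iff by auto
  then obtain g u where g: "g \<in> C (X q) (p - 1) (carrier (X q))" "u \<in> C (X q) p {\<zero>\<^bsub>X q\<^esub>}"
    "\<forall>bs. f bs = D (X q) g bs \<oplus>\<^bsub>X q\<^esub> u bs"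
    using assms(1) f(1) unfolding vanishes_def by blast
  moreover have "u = (\<lambda>_. \<zero>\<^bsub>X q\<^esub>)" using g(2) unfolding cochains_zero_iff .
  ultimately show ?thesis
    using D_closed[OF module_X X_carrier[OF g(1)]] by (intro bexI[of _ g]) auto
qed

text \<open>
  A cochain on the line \<open>p - q = r - k\<close> that is a cycle in the total complex of the double complex
  of Koszul cochains, up to the next terms of the line, splits into boundaries in the two directions.
\<close>

lemma diagonal_chase:
  assumes rows: "\<And>p q. p < r \<Longrightarrow> vanishes (X q) p (carrier (X q)) {\<zero>\<^bsub>X q\<^esub>}"
    and cols: "\<And>p q. p \<le> r \<Longrightarrow> p - q = r - k \<Longrightarrow> vanishes (X q) p (Z q) (B q)"
    and "p \<le> r" "p - q = r - k"
    and "u \<in> C (X q) p (carrier (X q))" "D (X q) u \<in> C (X q) (p + 1) (B q)"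
    and "v \<in> C (X (q - 1)) (p - 1) (carrier (X (q - 1)))" "\<And>bs. d q (u bs) = D (X (q - 1)) v bs"
  shows "\<exists>g\<in>C (X q) (p - 1) (carrier (X q)). \<exists>w\<in>C (X (q + 1)) p (carrier (X (q + 1))).
    \<forall>bs. u bs = D (X q) g bs \<oplus>\<^bsub>X q\<^esub> d (q + 1) (w bs)"
  using assms(3-)
proof (induction "nat (p + 1)" arbitrary: p q u v)
  case 0
  interpret Xq: module R "X q" by (rule module_X)
  interpret Xq1: module R "X (q + 1)" by (rule module_X)
  have "p < 0" using 0 by simp
  then have u: "u = (\<lambda>_. \<zero>\<^bsub>X q\<^esub>)" using 0(4) cochains_negative by blast
  have "(\<lambda>_. \<zero>\<^bsub>X q\<^esub>) \<in> C (X q) (p - 1) (carrier (X q))" "(\<lambda>_. \<zero>\<^bsub>X (q + 1)\<^esub>) \<in> C (X (q + 1)) p (carrier (X (q + 1)))"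
    unfolding cochains_def by auto
  moreover have "u bs = D (X q) (\<lambda>_. \<zero>\<^bsub>X q\<^esub>) bs \<oplus>\<^bsub>X q\<^esub> d (q + 1) \<zero>\<^bsub>X (q + 1)\<^esub>" for bs
    unfolding u using koszul_diff_zero[OF module_X xs_carrier] module_homs_zero[OF module_X module_X d_hom_Suc] by simp
  ultimately show ?case by (intro bexI[of _ "\<lambda>_. \<zero>\<^bsub>X q\<^esub>"] bexI[of _ "\<lambda>_. \<zero>\<^bsub>X (q + 1)\<^esub>"]) auto
next
  case (Suc n)
  note u = Suc.prems(3) and Du = Suc.prems(4) and v = Suc.prems(5) and dv = Suc.prems(6)
  interpret Xq: module R "X q" by (rule module_X)
  interpret Xq': module R "X (q - 1)" by (rule module_X)
  note uc = X_carrier[OF u] and vc = X_carrier[OF v]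
  have Dv: "D (X (q - 1)) v = (\<lambda>bs. d q (u bs))" using dv by auto
  have "(\<lambda>bs. d q (u bs)) \<in> C (X (q - 1)) p (B (q - 1))" using d_cochain_B[of u "q - 1" p] u by simp
  then have DvB: "D (X (q - 1)) v \<in> C (X (q - 1)) (p - 1 + 1) (B (q - 1))" unfolding Dv by simp
  have ddu: "(\<lambda>b. d (q - 1) (d q (u b))) = (\<lambda>_. \<zero>\<^bsub>X (q - 1 - 1)\<^esub>)" using d_d uc by auto
  have "D (X (q - 1 - 1)) (\<lambda>b. d (q - 1) (v b)) bs = \<zero>\<^bsub>X (q - 1 - 1)\<^esub>" for bs
    using d_D[OF v, of bs] d_d uc unfolding Dv by simp
  \<comment> \<open>Since D (d v) = d (d u) = 0 and p - 1 < r, exactness of the row continues the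
    line by a term \<open>v'\<close>, as the induction hypothesis for \<open>v\<close>
    demands.\<close>
  then obtain v' where v': "v' \<in> C (X (q - 1 - 1)) (p - 1 - 1) (carrier (X (q - 1 - 1)))"
    "\<And>bs. d (q - 1) (v bs) = D (X (q - 1 - 1)) v' bs"
    using row_exact[OF rows[of "p - 1"] d_cochain[OF v]] Suc.prems(1) by auto
  have "n = nat (p - 1 + 1)" "p - 1 \<le> r" "p - 1 - (q - 1) = r - k" using Suc.hyps(2) Suc.prems by auto
  from Suc.hyps(1)[OF this v DvB v'] obtain g' w where
    g': "g' \<in> C (X (q - 1)) (p - 1 - 1) (carrier (X (q - 1)))"
    and w: "w \<in> C (X q) (p - 1) (carrier (X q))"
    and vgw: "\<And>bs. v bs = D (X (q - 1)) g' bs \<oplus>\<^bsub>X (q - 1)\<^esub> d q (w bs)" by auto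
  note wc = X_carrier[OF w] and gc' = X_carrier[OF g']
  have Dw: "D (X q) w \<in> C (X q) p (carrier (X q))" using D_cochain[OF w] by simp
  note Dwc = X_carrier[OF Dw]
  have Dg'c: "\<forall>bs. D (X (q - 1)) g' bs \<in> carrier (X (q - 1))" using D_closed[OF module_X gc'] by blast
  have dwc: "\<forall>bs. d q (w bs) \<in> carrier (X (q - 1))" using X_carrier[OF d_cochain[OF w]] .
  have "v = (\<lambda>bs. D (X (q - 1)) g' bs \<oplus>\<^bsub>X (q - 1)\<^esub> d q (w bs))" using vgw by auto
  then have Dv2: "D (X (q - 1)) v bs = d q (D (X q) w bs)" for bs
    using D_add[OF module_X Dg'c dwc] D_D[OF module_X gc'] d_D[OF w] D_closed[OF module_X dwc] by simp
  \<comment> \<open>Writing v = D g' + d w gives d u = D v = d (D w). So u - D w takes values in the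
    cycles, where the hypothesis on the column applies.\<close>
  define e where "e = (\<lambda>bs. u bs \<ominus>\<^bsub>X q\<^esub> D (X q) w bs)"
  have e: "e \<in> C (X q) p (carrier (X q))"
    unfolding e_def by (rule cochains_minus[OF module_X submodule_carrier[OF module_X] u Dw])
  have "e bs \<in> Z q" for bs
  proof -
    have "d q (e bs) = d q (u bs) \<ominus>\<^bsub>X (q - 1)\<^esub> d q (D (X q) w bs)"
      unfolding e_def using module_homs_minus[OF module_X module_X d_hom, of "u bs" q "D (X q) w bs"] uc Dwc by simp
    also have "\<dots> = \<zero>\<^bsub>X (q - 1)\<^esub>"
      using dv Dv2 module_homsD(1)[OF d_hom, of "u bs" q] uc by (simp add: a_minus_def Xq'.r_neg)
    finally show ?thesis unfolding Z_iff using X_carrier[OF e] by simp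
  qed
  then have eZ: "e \<in> C (X q) p (Z q)" using cochains_restrict[OF e] by blast
  have "D (X q) e bs = D (X q) u bs" for bs
    unfolding e_def using D_minus[OF module_X uc Dwc] D_D[OF module_X wc] D_closed[OF module_X uc]
    by (simp add: a_minus_def)
  then have "D (X q) e = D (X q) u" by auto
  then have "D (X q) e \<in> C (X q) (p + 1) (B q)" using Du by simp
  then obtain g b where g: "g \<in> C (X q) (p - 1) (Z q)" and b: "b \<in> C (X q) p (B q)"
    and egb: "\<And>bs. e bs = D (X q) g bs \<oplus>\<^bsub>X q\<^esub> b bs"
    using cols[OF Suc.prems(1,2)] eZ unfolding vanishes_def by blast
  have g: "g \<in> C (X q) (p - 1) (carrier (X q))"
    using cochains_mono[OF g] submoduleD(1)[OF module_X submodule_Z] by blast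
  obtain w' where w': "w' \<in> C (X (q + 1)) p (carrier (X (q + 1)))" "\<And>bs. b bs = d (q + 1) (w' bs)"
    using B_cochain_lift[OF b] by blast
  have bc: "\<forall>bs. b bs \<in> carrier (X q)" by (rule cochains_carrier[OF module_X submodule_B b])
  have "u bs = D (X q) (\<lambda>bs. w bs \<oplus>\<^bsub>X q\<^esub> g bs) bs \<oplus>\<^bsub>X q\<^esub> d (q + 1) (w' bs)" for bs
  proof -
    have "u bs = D (X q) w bs \<oplus>\<^bsub>X q\<^esub> e bs"
      unfolding e_def using uc Dwc by (simp add: a_minus_def Xq.a_ac Xq.r_neg Xq.r_neg1 Xq.r_neg2)
    then show ?thesis
      unfolding egb D_add[OF module_X wc X_carrier[OF g]] w'(2)[symmetric]
      using Dwc bc D_closed[OF module_X X_carrier[OF g]] by (simp add: Xq.a_assoc)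
  qed
  then show ?case
    using w'(1) cochains_add[OF module_X submodule_carrier[OF module_X] w g]
    by (intro bexI[of _ "\<lambda>bs. w bs \<oplus>\<^bsub>X q\<^esub> g bs"] bexI[of _ w']) auto
qed

text \<open>Along the line p = q + k the columns above s are exact, and k + c < r keeps every
  position with q \<le> c in the range where the rows are exact. A cocycle modulo boundaries is
  pushed up this line until the complex ends, and the corrections are carried back down.\<close>

lemma ascending_chase:
  assumes rows: "\<And>p q. p < r \<Longrightarrow> vanishes (X q) p (carrier (X q)) {\<zero>\<^bsub>X q\<^esub>}"
    and "k + c < r" "q \<ge> s"
    and "u \<in> C (X q) (q + k) (carrier (X q))" "D (X q) u \<in> C (X q) (q + k + 1) (B q)"
  shows "\<exists>g\<in>C (X q) (q + k - 1) (carrier (X q)). \<exists>w\<in>C (X (q + 1)) (q + k) (carrier (X (q + 1))).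
    \<forall>bs. u bs = D (X q) g bs \<oplus>\<^bsub>X q\<^esub> d (q + 1) (w bs)"
  using assms(3-)
proof (induction "nat (c + 1 - q)" arbitrary: q u)
  case 0
  interpret Xq: module R "X q" by (rule module_X)
  interpret Xq1: module R "X (q + 1)" by (rule module_X)
  have "zero_module (X q)" using above 0 by simp
  then have u: "u bs = \<zero>\<^bsub>X q\<^esub>" for bs using X_carrier[OF 0(3)] zero_X(1) by auto
  have "(\<lambda>_. \<zero>\<^bsub>X q\<^esub>) \<in> C (X q) (q + k - 1) (carrier (X q))"
    "(\<lambda>_. \<zero>\<^bsub>X (q + 1)\<^esub>) \<in> C (X (q + 1)) (q + k) (carrier (X (q + 1)))"
    unfolding cochains_def by auto
  moreover have "u bs = D (X q) (\<lambda>_. \<zero>\<^bsub>X q\<^esub>) bs \<oplus>\<^bsub>X q\<^esub> d (q + 1) \<zero>\<^bsub>X (q + 1)\<^esub>" for bs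
    unfolding u using koszul_diff_zero[OF module_X xs_carrier] module_homs_zero[OF module_X module_X d_hom_Suc] by simp
  ultimately show ?case by (intro bexI[of _ "\<lambda>_. \<zero>\<^bsub>X q\<^esub>"] bexI[of _ "\<lambda>_. \<zero>\<^bsub>X (q + 1)\<^esub>"]) auto
next
  case (Suc n)
  note u = Suc.prems(2) and Du = Suc.prems(3)
  interpret Xq: module R "X q" by (rule module_X)
  note uc = X_carrier[OF u]
  obtain w1 where w1: "w1 \<in> C (X (q + 1)) (q + k + 1) (carrier (X (q + 1)))"
    "\<And>bs. D (X q) u bs = d (q + 1) (w1 bs)"
    using B_cochain_lift[OF Du] by blast
  have w1': "w1 \<in> C (X (q + 1)) (q + 1 + k) (carrier (X (q + 1)))" using w1(1) by (simp add: algebra_simps)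
  note w1c = X_carrier[OF w1(1)]
  have "D (X (q + 1)) w1 bs \<in> B (q + 1)" for bs
  proof -
    have "d (q + 1) (D (X (q + 1)) w1 bs) = D (X q) (\<lambda>b. d (q + 1) (w1 b)) bs" by (rule d_D_Suc[OF w1(1)])
    also have "(\<lambda>b. d (q + 1) (w1 b)) = D (X q) u" using w1(2) by auto
    finally have "d (q + 1) (D (X (q + 1)) w1 bs) = \<zero>\<^bsub>X q\<^esub>" using D_D[OF module_X uc] by simp
    then have "D (X (q + 1)) w1 bs \<in> Z (q + 1)" unfolding Z_iff using D_closed[OF module_X w1c] by simp
    moreover have "Z (q + 1) = B (q + 1)" using top_homology(2)[of "q + 1"] Suc.prems(1) Z_eq_B_iff by simp
    ultimately show ?thesis by simp
  qed
  then have Dw1: "D (X (q + 1)) w1 \<in> C (X (q + 1)) (q + 1 + k + 1) (B (q + 1))"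
    using cochains_restrict[OF D_cochain[OF w1']] by blast
  have "n = nat (c + 1 - (q + 1))" "s \<le> q + 1" using Suc.hyps(2) Suc.prems(1) by auto
  from Suc.hyps(1)[OF this w1' Dw1] obtain g1 w2 where
    g1: "g1 \<in> C (X (q + 1)) (q + 1 + k - 1) (carrier (X (q + 1)))"
    and w2: "w2 \<in> C (X (q + 1 + 1)) (q + 1 + k) (carrier (X (q + 1 + 1)))"
    and w1gw: "\<And>bs. w1 bs = D (X (q + 1)) g1 bs \<oplus>\<^bsub>X (q + 1)\<^esub> d (q + 1 + 1) (w2 bs)" by auto
  have g1: "g1 \<in> C (X (q + 1)) (q + k) (carrier (X (q + 1)))" using g1 by (simp add: algebra_simps)
  note g1c = X_carrier[OF g1]
  have dg1: "(\<lambda>bs. d (q + 1) (g1 bs)) \<in> C (X q) (q + k) (carrier (X q))" using d_cochain[OF g1] by simp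
  note dg1c = X_carrier[OF dg1]
  have w2c: "d (q + 1 + 1) (w2 bs) \<in> carrier (X (q + 1))" for bs
    using module_homsD(1)[OF d_hom_Suc] X_carrier[OF w2] by blast
  have Dg1c: "D (X (q + 1)) g1 bs \<in> carrier (X (q + 1))" for bs using D_closed[OF module_X g1c] .
  have Du2: "D (X q) u bs = D (X q) (\<lambda>b. d (q + 1) (g1 b)) bs" for bs
  proof -
    have "D (X q) u bs = d (q + 1) (D (X (q + 1)) g1 bs) \<oplus>\<^bsub>X q\<^esub> d (q + 1) (d (q + 1 + 1) (w2 bs))"
      unfolding w1(2) w1gw using module_homsD(2)[OF d_hom_Suc Dg1c w2c] .
    also have "d (q + 1) (d (q + 1 + 1) (w2 bs)) = \<zero>\<^bsub>X q\<^esub>"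
      using d_d_Suc[of "w2 bs" "q + 1"] X_carrier[OF w2] by simp
    finally show ?thesis
      using d_D_Suc[OF g1] module_homsD(1)[OF d_hom_Suc Dg1c] by simp
  qed
  \<comment> \<open>D u = d w1 with w1 = D g1 + d w2, so D u = D (d g1). Subtracting d g1 leaves a
    genuine cocycle, which row exactness bounds.\<close>
  define e where "e = (\<lambda>bs. u bs \<ominus>\<^bsub>X q\<^esub> d (q + 1) (g1 bs))"
  have e: "e \<in> C (X q) (q + k) (carrier (X q))"
    unfolding e_def by (rule cochains_minus[OF module_X submodule_carrier[OF module_X] u dg1])
  have "D (X q) e bs = \<zero>\<^bsub>X q\<^esub>" for bs
    unfolding e_def using D_minus[OF module_X uc dg1c] Du2 D_closed[OF module_X dg1c] by (simp add: a_minus_def Xq.r_neg)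
  moreover have "q + k < r" using Suc.hyps(2) assms(2) by linarith
  ultimately obtain g where g: "g \<in> C (X q) (q + k - 1) (carrier (X q))" "\<And>bs. e bs = D (X q) g bs"
    using row_exact[OF rows e] by blast
  have "u bs = D (X q) g bs \<oplus>\<^bsub>X q\<^esub> d (q + 1) (g1 bs)" for bs
    unfolding g(2)[symmetric] e_def using uc dg1c by (simp add: a_minus_def Xq.a_assoc Xq.l_neg)
  then show ?case using g(1) g1 by (intro bexI[of _ g] bexI[of _ g1]) auto
qed

lemma row_vanishes:
  assumes "cohomological_depth R\<^sub>m {\<zero>} r" "p < r"
  shows "vanishes (X q) p (carrier (X q)) {\<zero>\<^bsub>X q\<^esub>}"
  by (rule vanishes_projective[OF projective]) (use assms in \<open>auto simp: cohomological_depth_def\<close>)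

lemma column_vanishes:
  assumes "cohomological_depth M {\<zero>\<^bsub>M\<^esub>} e" "p < e"
  shows "vanishes (X q) p (Z q) (B q)"
proof -
  obtain \<theta> where "power_coordinates R ((X q)\<lparr>carrier := Z q\<rparr>) (B q) M (a q) \<theta>"
    using coordinates_ZB by blast
  then show ?thesis
    by (rule vanishes_power_quotient[OF module_X submodule_Z submodule_B B_subset_Z M])
      (use assms in \<open>auto simp: cohomological_depth_def\<close>)
qed

lemma exact_column_vanishes:
  assumes "q > s"
  shows "vanishes (X q) p (Z q) (B q)"
proof -
  interpret Xq: module R "X q" by (rule module_X)
  have ZB: "Z q = B q" using Z_eq_B_iff top_homology(2)[OF assms] by simp
  show ?thesis
    unfolding vanishes_def ZB
  proof (intro ballI impI)
    fix f assume f: "f \<in> C (X q) p (B q)"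
    have "(\<lambda>_. \<zero>\<^bsub>X q\<^esub>) \<in> C (X q) (p - 1) (B q)"
      using submoduleD(2)[OF module_X submodule_B] unfolding cochains_def by simp
    then show "\<exists>g\<in>C (X q) (p - 1) (B q). \<exists>u\<in>C (X q) p (B q). \<forall>bs. f bs = D (X q) g bs \<oplus>\<^bsub>X q\<^esub> u bs"
      using f cochains_carrier[OF module_X submodule_B f] koszul_diff_zero[OF module_X xs_carrier]
      by (intro bexI[of _ "\<lambda>_. \<zero>\<^bsub>X q\<^esub>"] bexI[of _ f]) auto
  qed
qed

lemma top_column_not_vanishes:
  assumes "cohomological_depth M {\<zero>\<^bsub>M\<^esub>} e"
  shows "\<not> vanishes (X s) e (Z s) (B s)"
proof -
  obtain \<theta> where "power_coordinates R ((X s)\<lparr>carrier := Z s\<rparr>) (B s) M (a s) \<theta>"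
    using coordinates_ZB by blast
  from vanishes_of_power_quotient[OF module_X submodule_Z submodule_B B_subset_Z M this] top_homology(1) assms
  show ?thesis unfolding cohomological_depth_def by auto
qed

text \<open>Otherwise the ascending chase writes a cocycle of Z_s/B_s in degree e as D g + d w. Here
  g has values in X_s; a diagonal chase starting at X_(s-1) corrects it to have values in Z_s. Then
  the cohomology of H_s(P) in degree e vanishes, although H_s(P) is a positive power of M.\<close>

theorem length_lower_bound:
  assumes r: "cohomological_depth R\<^sub>m {\<zero>} r" and e: "cohomological_depth M {\<zero>\<^bsub>M\<^esub>} e"
  shows "r - e \<le> c - s"
proof (rule ccontr)
  assume "\<not> ?thesis"
  then have lt: "e - s + c < r" by linarith
  note rows = row_vanishes[OF r]
  interpret Xs: module R "X s" by (rule module_X)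
  interpret Xs': module R "X (s - 1)" by (rule module_X)
  have "vanishes (X s) e (Z s) (B s)"
    unfolding vanishes_def
  proof (intro ballI impI)
    fix u assume u: "u \<in> C (X s) e (Z s)" "D (X s) u \<in> C (X s) (e + 1) (B s)"
    have uX: "u \<in> C (X s) e (carrier (X s))"
      using cochains_mono[OF u(1)] submoduleD(1)[OF module_X submodule_Z] by blast
    obtain g w where g: "g \<in> C (X s) (e - 1) (carrier (X s))"
      and w: "w \<in> C (X (s + 1)) e (carrier (X (s + 1)))"
      and ugw: "\<And>bs. u bs = D (X s) g bs \<oplus>\<^bsub>X s\<^esub> d (s + 1) (w bs)"
      using ascending_chase[OF rows lt order.refl, of u] uX u(2) by auto
    note gc = X_carrier[OF g] and wc = X_carrier[OF w]
    have dwB: "(\<lambda>bs. d (s + 1) (w bs)) \<in> C (X s) e (B s)" by (rule d_cochain_B[OF w])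
    have dwc: "\<forall>bs. d (s + 1) (w bs) \<in> carrier (X s)" by (rule cochains_carrier[OF module_X submodule_B dwB])
    have Dgc: "D (X s) g bs \<in> carrier (X s)" for bs using D_closed[OF module_X gc] .
    have dDg: "d s (D (X s) g bs) = \<zero>\<^bsub>X (s - 1)\<^esub>" for bs
    proof -
      have "d s (u bs) = d s (D (X s) g bs) \<oplus>\<^bsub>X (s - 1)\<^esub> d s (d (s + 1) (w bs))"
        unfolding ugw using module_homsD(2)[OF d_hom Dgc] dwc by blast
      moreover have "d s (u bs) = \<zero>\<^bsub>X (s - 1)\<^esub>"
        using cochains_mem[OF u(1) submoduleD(2)[OF module_X submodule_Z]] Z_iff by blast
      moreover have "d s (d (s + 1) (w bs)) = \<zero>\<^bsub>X (s - 1)\<^esub>" using d_d_Suc wc by blast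
      ultimately show ?thesis using module_homsD(1)[OF d_hom Dgc] by simp
    qed
    have dg: "(\<lambda>bs. d s (g bs)) \<in> C (X (s - 1)) (e - 1) (carrier (X (s - 1)))" by (rule d_cochain[OF g])
    have Ddg: "D (X (s - 1)) (\<lambda>bs. d s (g bs)) bs = \<zero>\<^bsub>X (s - 1)\<^esub>" for bs using d_D[OF g] dDg by simp
    have er: "e - 1 < r" using lt s_le_c by linarith
    obtain v where v: "v \<in> C (X (s - 1)) (e - 1 - 1) (carrier (X (s - 1)))"
      "\<And>bs. d s (g bs) = D (X (s - 1)) v bs"
      using row_exact[OF rows[OF er] dg Ddg] by blast
    have Dv: "D (X (s - 1)) v = (\<lambda>bs. d s (g bs))" using v(2) by auto
    have DvB: "D (X (s - 1)) v \<in> C (X (s - 1)) (e - 1 - 1 + 1) (B (s - 1))"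
      unfolding Dv using d_cochain_B[of g "s - 1" "e - 1"] g by simp
    have "D (X (s - 1 - 1)) (\<lambda>b. d (s - 1) (v b)) bs = \<zero>\<^bsub>X (s - 1 - 1)\<^esub>" for bs
      using d_D[OF v(1), of bs] d_d gc unfolding Dv by simp
    moreover have "e - 1 - 1 < r" using er by linarith
    ultimately obtain v' where v': "v' \<in> C (X (s - 1 - 1)) (e - 1 - 1 - 1) (carrier (X (s - 1 - 1)))"
      "\<And>bs. d (s - 1) (v bs) = D (X (s - 1 - 1)) v' bs"
      using row_exact[OF rows d_cochain[OF v(1)]] by blast
    \<comment> \<open>The cochain \<open>v\<close> has degree e - 2 on X_(s-1) and so lies on the
      line p - q = (e - 1) - s. With e - 1 as the bound for p, all columns met by the chase are in
      degrees below e and vanish.\<close>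
    have "\<exists>g2\<in>C (X (s - 1)) (e - 1 - 1 - 1) (carrier (X (s - 1))). \<exists>w2\<in>C (X (s - 1 + 1)) (e - 1 - 1) (carrier (X (s - 1 + 1))).
        \<forall>bs. v bs = D (X (s - 1)) g2 bs \<oplus>\<^bsub>X (s - 1)\<^esub> d (s - 1 + 1) (w2 bs)"
    proof (rule diagonal_chase[where r = "e - 1" and k = s])
      show "vanishes (X q) p (carrier (X q)) {\<zero>\<^bsub>X q\<^esub>}" if "p < e - 1" for p q
        using rows that er by simp
      show "vanishes (X q) p (Z q) (B q)" if "p \<le> e - 1" "p - q = e - 1 - s" for p q
        using column_vanishes[OF e] that by simp
    qed (use v v' DvB in auto)
    then obtain g2 w2 where g2: "g2 \<in> C (X (s - 1)) (e - 1 - 1 - 1) (carrier (X (s - 1)))"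
      and w2: "w2 \<in> C (X s) (e - 1 - 1) (carrier (X s))"
      and vgw: "\<And>bs. v bs = D (X (s - 1)) g2 bs \<oplus>\<^bsub>X (s - 1)\<^esub> d s (w2 bs)" by auto
    note g2c = X_carrier[OF g2] and w2c = X_carrier[OF w2]
    have Dg2c: "\<forall>bs. D (X (s - 1)) g2 bs \<in> carrier (X (s - 1))" using D_closed[OF module_X g2c] by blast
    have dw2c: "\<forall>bs. d s (w2 bs) \<in> carrier (X (s - 1))" using X_carrier[OF d_cochain[OF w2]] .
    have "v = (\<lambda>bs. D (X (s - 1)) g2 bs \<oplus>\<^bsub>X (s - 1)\<^esub> d s (w2 bs))" using vgw by auto
    then have Dv2: "D (X (s - 1)) v bs = d s (D (X s) w2 bs)" for bs
      using D_add[OF module_X Dg2c dw2c] D_D[OF module_X g2c] d_D[OF w2] D_closed[OF module_X dw2c] by simp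
    have Dw2: "D (X s) w2 \<in> C (X s) (e - 1) (carrier (X s))" using D_cochain[OF w2] by simp
    note Dw2c = X_carrier[OF Dw2]
    \<comment> \<open>As d g = D v = d (D w2), subtracting D w2 moves \<open>g\<close> into the
      cycles, and D g stays the same.\<close>
    define h where "h = (\<lambda>bs. g bs \<ominus>\<^bsub>X s\<^esub> D (X s) w2 bs)"
    have h: "h \<in> C (X s) (e - 1) (carrier (X s))"
      unfolding h_def by (rule cochains_minus[OF module_X submodule_carrier[OF module_X] g Dw2])
    have "h bs \<in> Z s" for bs
    proof -
      have "d s (h bs) = d s (g bs) \<ominus>\<^bsub>X (s - 1)\<^esub> d s (D (X s) w2 bs)"
        unfolding h_def using module_homs_minus[OF module_X module_X d_hom, of "g bs" s "D (X s) w2 bs"] gc Dw2c by simp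
      also have "\<dots> = \<zero>\<^bsub>X (s - 1)\<^esub>"
        using v(2) Dv2 module_homsD(1)[OF d_hom, of "g bs" s] gc by (simp add: a_minus_def Xs'.r_neg)
      finally show ?thesis unfolding Z_iff using X_carrier[OF h] by simp
    qed
    then have hZ: "h \<in> C (X s) (e - 1) (Z s)" using cochains_restrict[OF h] by blast
    have "D (X s) h bs = D (X s) g bs" for bs
      unfolding h_def using D_minus[OF module_X gc Dw2c] D_D[OF module_X w2c] Dgc by (simp add: a_minus_def)
    then have "\<forall>bs. u bs = D (X s) h bs \<oplus>\<^bsub>X s\<^esub> d (s + 1) (w bs)" using ugw by simp
    then show "\<exists>g\<in>C (X s) (e - 1) (Z s). \<exists>b\<in>C (X s) e (B s). \<forall>bs. u bs = D (X s) g bs \<oplus>\<^bsub>X s\<^esub> b bs"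
      using hZ dwB by (intro bexI[of _ h] bexI[of _ "\<lambda>bs. d (s + 1) (w bs)"]) auto
  qed
  then show False using top_column_not_vanishes[OF e] by simp
qed

text \<open>The diagonal p - q = r - c through X_c in degree r meets no nonzero column cohomology:
  above s the columns are exact, and for q \<le> s one has p \<le> s + r - c < e. As X_(c+1) = 0,
  the chase says that X_c \<rightarrow> X_(c-1) is injective on cohomology in degree r.\<close>

lemma top_differential_unit_functional:
  assumes r: "cohomological_depth R\<^sub>m {\<zero>} r" and e: "cohomological_depth M {\<zero>\<^bsub>M\<^esub>} e" and lt: "r - e < c - s"
    and u: "u \<in> carrier (X c)" "f \<in> module_homs R (X c) R\<^sub>m" "f u = \<one>"
  shows "\<exists>f'\<in>module_homs R (X (c - 1)) R\<^sub>m. f' (d c u) = \<one>"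
proof (rule cohomology_injective_unit_functional[OF module_X projective d_hom _ _ u])
  show "\<not> vanishes R\<^sub>m r (carrier R\<^sub>m) {\<zero>}" using r unfolding cohomological_depth_def by simp
  interpret Xc: module R "X c" by (rule module_X)
  fix f g assume f: "f \<in> C (X c) r (carrier (X c))" "D (X c) f = (\<lambda>_. \<zero>\<^bsub>X c\<^esub>)"
    and g: "g \<in> C (X (c - 1)) (r - 1) (carrier (X (c - 1)))" "(\<lambda>bs. d c (f bs)) = D (X (c - 1)) g"
  have "\<exists>g'\<in>C (X c) (r - 1) (carrier (X c)). \<exists>w\<in>C (X (c + 1)) r (carrier (X (c + 1))).
      \<forall>bs. f bs = D (X c) g' bs \<oplus>\<^bsub>X c\<^esub> d (c + 1) (w bs)"
  proof (rule diagonal_chase[where r = r and k = c])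
    show "vanishes (X q) p (carrier (X q)) {\<zero>\<^bsub>X q\<^esub>}" if "p < r" for p q by (rule row_vanishes[OF r that])
    show "vanishes (X q) p (Z q) (B q)" if "p \<le> r" "p - q = r - c" for p q
    proof (cases "q > s")
      case True
      then show ?thesis by (rule exact_column_vanishes)
    next
      case False
      then have "p < e" using that lt by linarith
      then show ?thesis by (rule column_vanishes[OF e])
    qed
    show "D (X c) f \<in> C (X c) (r + 1) (B c)"
      unfolding f(2) cochains_def using submoduleD(2)[OF module_X submodule_B] by simp
    show "d c (f bs) = D (X (c - 1)) g bs" for bs using g(2) by metis
  qed (use f g in auto)
  then obtain g' w where g': "g' \<in> C (X c) (r - 1) (carrier (X c))" and w: "w \<in> C (X (c + 1)) r (carrier (X (c + 1)))"
    and fgw: "\<And>bs. f bs = D (X c) g' bs \<oplus>\<^bsub>X c\<^esub> d (c + 1) (w bs)" by blast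
  have "w bs = \<zero>\<^bsub>X (c + 1)\<^esub>" for bs using X_carrier[OF w] zero_X(1)[OF above[of "c + 1"]] by auto
  then have "f bs = D (X c) g' bs" for bs
    using fgw module_homs_zero[OF module_X module_X d_hom_Suc] D_closed[OF module_X X_carrier[OF g']] by simp
  then show "\<exists>g'\<in>C (X c) (r - 1) (carrier (X c)). f = D (X c) g'" using g' by (intro bexI[of _ g']) auto
qed

end

section \<open>Splitting off the top of a resolution\<close>

lemma projective_summand:
  fixes P :: "('a, 'p, 'd) module_scheme"
  assumes P: "projective_module R P" and Y: "submodule Y R P" and \<pi>: "\<pi> \<in> module_homs R P P"
    and "\<And>x. x \<in> carrier P \<Longrightarrow> \<pi> x \<in> Y" "\<And>y. y \<in> Y \<Longrightarrow> \<pi> y = y"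
  shows "projective_module R (P\<lparr>carrier := Y\<rparr>)"
proof -
  obtain B :: "'p set" and s p where sp: "s \<in> module_homs R P (free_module R B)"
    "p \<in> module_homs R (free_module R B) P" "\<And>x. x \<in> carrier P \<Longrightarrow> p (s x) = x" and M: "module R P"
    using P unfolding projective_module_def by auto
  note y = submoduleD[OF M Y]
  have s: "s \<in> module_homs R (P\<lparr>carrier := Y\<rparr>) (free_module R B)"
    using module_homsD[OF sp(1)] y(1) by (intro module_homsI) auto
  have p: "(\<lambda>f. \<pi> (p f)) \<in> module_homs R (free_module R B) (P\<lparr>carrier := Y\<rparr>)"
    using module_homsD[OF module_homs_compose[OF sp(2) \<pi>]] module_homsD(1)[OF sp(2)] assms(4)
    by (intro module_homsI) auto
  have "\<forall>x\<in>carrier (P\<lparr>carrier := Y\<rparr>). \<pi> (p (s x)) = x"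
    using sp(3) y(1) assms(5) by auto
  then show ?thesis
    unfolding projective_module_def using submodule.submodule_is_module[OF Y M]
    by (intro conjI exI[of _ B] bexI[OF _ s] bexI[OF _ p])
qed

text \<open>For each coordinate and each generator of M, a preimage with zeros in all other
  coordinates. The conclusion is phrased for all submodules H containing S, since it is applied with
  N the cycles and H the trace on them of a submodule generated in the larger module.\<close>

lemma power_coordinates_finite_generators:
  fixes N :: "('a, 'p, 'e) module_scheme"
  assumes N: "module R N" and M: "module R M" and fg: "finitely_generated R M"
    and \<theta>: "power_coordinates R N B M n \<theta>"
  shows "\<exists>S. finite S \<and> S \<subseteq> carrier N \<and>
    (\<forall>H. submodule H R N \<and> S \<subseteq> H \<longrightarrow> (\<forall>z\<in>carrier N. \<exists>w\<in>H. \<exists>b\<in>B. z = w \<oplus>\<^bsub>N\<^esub> b))"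
proof -
  interpret N: module R N by fact
  interpret M: module R M by fact
  note t = power_coordinatesD[OF \<theta>]
  obtain G where G: "finite G" "G \<subseteq> carrier M" "generated_submodule R M G = carrier M"
    using fg unfolding finitely_generated_def by auto
  define \<zeta> where "\<zeta> i g = (SOME z. z \<in> carrier N \<and> (\<forall>j<n. \<theta> j z = (if j = i then g else \<zero>\<^bsub>M\<^esub>)))" for i g
  have \<zeta>: "\<zeta> i g \<in> carrier N" "j < n \<Longrightarrow> \<theta> j (\<zeta> i g) = (if j = i then g else \<zero>\<^bsub>M\<^esub>)"
    if "g \<in> G" for i g j
  proof -
    have "(if j = i then g else \<zero>\<^bsub>M\<^esub>) \<in> carrier M" for j using G(2) that by auto
    from t(2)[of "\<lambda>j. if j = i then g else \<zero>\<^bsub>M\<^esub>", OF this]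
    have "\<exists>z. z \<in> carrier N \<and> (\<forall>j<n. \<theta> j z = (if j = i then g else \<zero>\<^bsub>M\<^esub>))" by blast
    from someI_ex[OF this]
    show "\<zeta> i g \<in> carrier N" "j < n \<Longrightarrow> \<theta> j (\<zeta> i g) = (if j = i then g else \<zero>\<^bsub>M\<^esub>)"
      unfolding \<zeta>_def by blast+
  qed
  define S where "S = (\<lambda>(i, g). \<zeta> i g) ` ({..<n} \<times> G)"
  have S: "finite S" "S \<subseteq> carrier N" unfolding S_def using G(1) \<zeta>(1) by auto
  have "\<exists>w\<in>H. \<exists>b\<in>B. z = w \<oplus>\<^bsub>N\<^esub> b" if H: "submodule H R N" "S \<subseteq> H" and z: "z \<in> carrier N" for H z
  proof -
    note h = submoduleD[OF N H(1)]
    have one: "\<exists>w\<in>H. \<forall>j<n. \<theta> j w = (if j = i then m else \<zero>\<^bsub>M\<^esub>)" if i: "i < n" and m: "m \<in> carrier M" for i m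
    proof -
      define V where "V = {m \<in> carrier M. \<exists>w\<in>H. \<forall>j<n. \<theta> j w = (if j = i then m else \<zero>\<^bsub>M\<^esub>)}"
      have VI: "m \<in> V" if "m \<in> carrier M" "w \<in> H" "\<And>j. j < n \<Longrightarrow> \<theta> j w = (if j = i then m else \<zero>\<^bsub>M\<^esub>)" for m w
        using that unfolding V_def by blast
      have "submodule V R M"
        unfolding submodule_iff[OF M]
      proof (intro conjI ballI)
        show "V \<subseteq> carrier M" unfolding V_def by auto
        show "\<zero>\<^bsub>M\<^esub> \<in> V" by (rule VI[OF _ h(2)]) (use module_homs_zero[OF N M t(1)] in auto)
      next
        fix m m' assume "m \<in> V" "m' \<in> V"
        then obtain w w' where w: "m \<in> carrier M" "m' \<in> carrier M" "w \<in> H" "w' \<in> H"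
          "\<forall>j<n. \<theta> j w = (if j = i then m else \<zero>\<^bsub>M\<^esub>)" "\<forall>j<n. \<theta> j w' = (if j = i then m' else \<zero>\<^bsub>M\<^esub>)"
          unfolding V_def by auto
        show "m \<oplus>\<^bsub>M\<^esub> m' \<in> V"
          by (rule VI[OF _ h(3)[OF w(3,4)]]) (use w h(1) module_homsD(2)[OF t(1)] in auto)
      next
        fix r m assume r: "r \<in> carrier R" and "m \<in> V"
        then obtain w where w: "m \<in> carrier M" "w \<in> H" "\<forall>j<n. \<theta> j w = (if j = i then m else \<zero>\<^bsub>M\<^esub>)"
          unfolding V_def by auto
        show "r \<odot>\<^bsub>M\<^esub> m \<in> V"
          by (rule VI[OF _ h(4)[OF r w(2)]]) (use w r h(1) module_homsD(3)[OF t(1)] in auto)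
      qed
      moreover have "G \<subseteq> V"
      proof
        fix g assume g: "g \<in> G"
        have "\<zeta> i g \<in> H" using H(2) g i unfolding S_def by auto
        then show "g \<in> V" using VI[of g "\<zeta> i g"] g G(2) \<zeta>(2)[OF g] by auto
      qed
      ultimately have "carrier M \<subseteq> V" using generated_submodule_minimal G(3) by metis
      with m have "m \<in> V" by blast
      then show ?thesis unfolding V_def by blast
    qed
    have "k \<le> n \<Longrightarrow> \<exists>w\<in>H. \<forall>j<n. \<theta> j w = (if j < k then \<theta> j z else \<zero>\<^bsub>M\<^esub>)" for k
    proof (induction k)
      case 0
      then show ?case using h(2) module_homs_zero[OF N M t(1)] by auto
    next
      case (Suc k)
      then obtain w where w: "w \<in> H" "\<And>j. j < n \<Longrightarrow> \<theta> j w = (if j < k then \<theta> j z else \<zero>\<^bsub>M\<^esub>)" by auto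
      have \<theta>z: "\<theta> j z \<in> carrier M" if "j < n" for j using module_homsD(1)[OF t(1)[OF that] z] .
      obtain w' where w': "w' \<in> H" "\<And>j. j < n \<Longrightarrow> \<theta> j w' = (if j = k then \<theta> k z else \<zero>\<^bsub>M\<^esub>)"
        using one[of k "\<theta> k z"] \<theta>z[of k] Suc.prems by auto
      have "\<theta> j (w \<oplus>\<^bsub>N\<^esub> w') = (if j < Suc k then \<theta> j z else \<zero>\<^bsub>M\<^esub>)" if j: "j < n" for j
        using module_homsD(2)[OF t(1)[OF j], of w w'] w w' h(1) \<theta>z[OF j] j by auto
      then show ?case using h(3)[OF w(1) w'(1)] by blast
    qed
    from this[of n] obtain w where w: "w \<in> H" "\<And>j. j < n \<Longrightarrow> \<theta> j w = \<theta> j z" by auto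
    have wc: "w \<in> carrier N" using h(1) w by auto
    have "\<theta> j (z \<ominus>\<^bsub>N\<^esub> w) = \<zero>\<^bsub>M\<^esub>" if "j < n" for j
      using module_homs_minus[OF N M t(1)[OF that] z wc] w(2)[OF that] module_homsD(1)[OF t(1)[OF that] z]
      by (simp add: a_minus_def M.r_neg)
    then have "z \<ominus>\<^bsub>N\<^esub> w \<in> B" using t(3)[of "z \<ominus>\<^bsub>N\<^esub> w"] z wc by auto
    moreover have "z = w \<oplus>\<^bsub>N\<^esub> (z \<ominus>\<^bsub>N\<^esub> w)" using z wc N.a_comm[of w "z \<ominus>\<^bsub>N\<^esub> w"] by (simp add: a_minus_def N.a_assoc N.l_neg)
    ultimately show ?thesis using w(1) by blast
  qed
  then show ?thesis using S by (intro exI[of _ S]) auto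
qed

context power_homology_complex
begin

section \<open>Homotopies with finitely generated error\<close>

abbreviation "gensub q \<equiv> generated_submodule R (X q)"

text \<open>Put \<phi> = 1 - h d. The image of d \<phi> lies in a finitely generated module, so it
  is finitely generated. Lifts of its generators together with lifts of generators of H_i form S,
  and each \<phi> x is, modulo boundaries, generated by S.\<close>

lemma homotopy_step:
  assumes h: "h \<in> module_homs R (X (i - 1)) (X i)" and T: "finite T" "T \<subseteq> carrier (X (i - 1))"
    and dd: "\<And>y. y \<in> carrier (X i) \<Longrightarrow> d i y \<ominus>\<^bsub>X (i - 1)\<^esub> d i (h (d i y)) \<in> gensub (i - 1) T"
  shows "\<exists>S. finite S \<and> S \<subseteq> carrier (X i) \<and>
    (\<forall>x\<in>carrier (X i). \<exists>y\<in>carrier (X (i + 1)). (x \<ominus>\<^bsub>X i\<^esub> h (d i x)) \<ominus>\<^bsub>X i\<^esub> d (i + 1) y \<in> gensub i S)"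
proof -
  interpret Xi: module R "X i" by (rule module_X)
  note Xi = module_X[of i]
  define \<phi> where "\<phi> x = x \<ominus>\<^bsub>X i\<^esub> h (d i x)" for x
  have \<phi>: "\<phi> \<in> module_homs R (X i) (X i)"
    unfolding \<phi>_def by (rule module_homs_diff[OF Xi Xi module_homs_id module_homs_compose[OF d_hom h]])
  have hd: "h (d i x) \<in> carrier (X i)" if "x \<in> carrier (X i)" for x
    using module_homsD(1)[OF h module_homsD(1)[OF d_hom that]] .
  note d\<phi> = module_homs_compose[OF \<phi> d_hom]
  define Y where "Y = (\<lambda>x. d i (\<phi> x)) ` carrier (X i)"
  have Y: "submodule Y R (X (i - 1))"
    unfolding Y_def by (rule submodule_image[OF Xi module_X d\<phi> submodule_carrier[OF Xi]])
  have "Y \<subseteq> gensub (i - 1) T"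
    unfolding Y_def \<phi>_def using dd module_homs_minus[OF Xi module_X d_hom _ hd] by auto
  then obtain S1 where S1: "finite S1" "S1 \<subseteq> Y" "Y = gensub (i - 1) S1"
    using noetherian_submodule_finitely_generated[OF noetherian module_X T Y] by blast
  obtain T1 where T1: "finite T1" "T1 \<subseteq> carrier (X i)" "S1 = (\<lambda>x. d i (\<phi> x)) ` T1"
    using S1(1,2) finite_subset_image unfolding Y_def by metis
  note N = submodule.submodule_is_module[OF submodule_Z Xi]
  obtain \<theta> where \<theta>: "power_coordinates R ((X i)\<lparr>carrier := Z i\<rparr>) (B i) M (a i) \<theta>"
    using coordinates_ZB by blast
  obtain S2 where S2: "finite S2" "S2 \<subseteq> Z i"
    "\<And>H z. submodule H R ((X i)\<lparr>carrier := Z i\<rparr>) \<Longrightarrow> S2 \<subseteq> H \<Longrightarrow> z \<in> Z i \<Longrightarrow>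
      \<exists>w\<in>H. \<exists>b\<in>B i. z = w \<oplus>\<^bsub>X i\<^esub> b"
    using power_coordinates_finite_generators[OF N M M_fg \<theta>] by auto
  have S2c: "S2 \<subseteq> carrier (X i)" using S2(2) submoduleD(1)[OF Xi submodule_Z] by blast
  define S where "S = \<phi> ` T1 \<union> S2"
  have S: "finite S" "S \<subseteq> carrier (X i)"
    unfolding S_def using T1 S2(1) S2c module_homsD(1)[OF \<phi>] by auto
  note G = generated_submodule_props[OF Xi S(2)]
  note g = submoduleD[OF Xi G(1)]
  have "\<exists>y\<in>carrier (X (i + 1)). \<phi> x \<ominus>\<^bsub>X i\<^esub> d (i + 1) y \<in> gensub i S" if x: "x \<in> carrier (X i)" for x
  proof -
    have \<phi>x: "\<phi> x \<in> carrier (X i)" using module_homsD(1)[OF \<phi> x] .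
    have "S1 \<subseteq> d i ` gensub i S" unfolding T1(3) using G(2) unfolding S_def by auto
    then have "Y \<subseteq> d i ` gensub i S"
      unfolding S1(3) by (rule generated_submodule_minimal[OF submodule_image[OF Xi module_X d_hom G(1)]])
    then obtain t where t: "t \<in> gensub i S" "d i (\<phi> x) = d i t" using x unfolding Y_def by blast
    have tc: "t \<in> carrier (X i)" using g(1) t by auto
    interpret Xi': module R "X (i - 1)" by (rule module_X)
    have "\<phi> x \<ominus>\<^bsub>X i\<^esub> t \<in> Z i"
      unfolding Z_iff using module_homs_minus[OF Xi module_X d_hom \<phi>x tc] \<phi>x tc t(2) module_homsD(1)[OF d_hom tc]
      by (simp add: a_minus_def Xi'.r_neg)
    moreover have "submodule (gensub i S \<inter> Z i) R ((X i)\<lparr>carrier := Z i\<rparr>)"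
      by (rule submodule_restrict[OF Xi submodule_Z submodule_Int[OF Xi G(1) submodule_Z]]) simp
    moreover have "S2 \<subseteq> gensub i S \<inter> Z i" using S2(2) G(2) unfolding S_def by auto
    ultimately obtain w b where w: "w \<in> gensub i S" "b \<in> B i" "\<phi> x \<ominus>\<^bsub>X i\<^esub> t = w \<oplus>\<^bsub>X i\<^esub> b"
      using S2(3) by blast
    obtain y where y: "y \<in> carrier (X (i + 1))" "b = d (i + 1) y" using w(2) unfolding B_def by auto
    have bc: "b \<in> carrier (X i)" "w \<in> carrier (X i)" using submoduleD(1)[OF Xi submodule_B w(2)] g(1) w by auto
    have "\<phi> x = (\<phi> x \<ominus>\<^bsub>X i\<^esub> t) \<oplus>\<^bsub>X i\<^esub> t" using \<phi>x tc by (simp add: a_minus_def Xi.a_assoc Xi.l_neg)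
    then have "\<phi> x \<ominus>\<^bsub>X i\<^esub> b = ((w \<oplus>\<^bsub>X i\<^esub> b) \<oplus>\<^bsub>X i\<^esub> t) \<ominus>\<^bsub>X i\<^esub> b" unfolding w(3) by simp
    also have "(w \<oplus>\<^bsub>X i\<^esub> b) \<oplus>\<^bsub>X i\<^esub> t = (w \<oplus>\<^bsub>X i\<^esub> t) \<oplus>\<^bsub>X i\<^esub> b" using bc tc by (simp add: Xi.a_ac)
    also have "\<dots> \<ominus>\<^bsub>X i\<^esub> b = w \<oplus>\<^bsub>X i\<^esub> t"
      using bc tc Xi.a_assoc[of "w \<oplus>\<^bsub>X i\<^esub> t" b "\<ominus>\<^bsub>X i\<^esub> b"] by (simp add: a_minus_def Xi.r_neg)
    also have "\<dots> \<in> gensub i S" using g(3) w(1) t(1) by auto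
    finally show ?thesis using y by blast
  qed
  then show ?thesis using S unfolding \<phi>_def by blast
qed

text \<open>The maps \<open>h\<close> are homotopies from the identity of \<open>P\<close> to maps with finitely generated image.\<close>

lemma finite_homotopy:
  "i \<ge> l \<Longrightarrow> \<exists>h\<in>module_homs R (X (i - 1)) (X i). \<exists>T. finite T \<and> T \<subseteq> carrier (X (i - 1)) \<and>
    (\<forall>y\<in>carrier (X i). d i y \<ominus>\<^bsub>X (i - 1)\<^esub> d i (h (d i y)) \<in> gensub (i - 1) T)"
proof (induction i rule: int_ge_induct)
  case base
  interpret X': module R "X (l - 1)" by (rule module_X)
  have zero: "carrier (X (l - 1)) = {\<zero>\<^bsub>X (l - 1)\<^esub>}" using zero_X(1) below by simp
  have hz: "(\<lambda>_. \<zero>\<^bsub>X l\<^esub>) \<in> module_homs R (X (l - 1)) (X l)" by (rule module_homs_const_zero[OF module_X])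
  interpret Xl: module R "X l" by (rule module_X)
  have "d l y \<ominus>\<^bsub>X (l - 1)\<^esub> d l \<zero>\<^bsub>X l\<^esub> \<in> gensub (l - 1) {}" if y: "y \<in> carrier (X l)" for y
  proof -
    have "d l y \<ominus>\<^bsub>X (l - 1)\<^esub> d l \<zero>\<^bsub>X l\<^esub> \<in> carrier (X (l - 1))"
      using module_homsD(1)[OF d_hom] y by simp
    then show ?thesis unfolding zero generated_submodule_empty[OF module_X] .
  qed
  then show ?case using hz by (intro bexI[OF _ hz] exI[of _ "{}"]) auto
next
  case (step i)
  interpret Xi: module R "X i" by (rule module_X)
  obtain h T where h: "h \<in> module_homs R (X (i - 1)) (X i)" and T: "finite T" "T \<subseteq> carrier (X (i - 1))"
    "\<And>y. y \<in> carrier (X i) \<Longrightarrow> d i y \<ominus>\<^bsub>X (i - 1)\<^esub> d i (h (d i y)) \<in> gensub (i - 1) T"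
    using step.IH by blast
  obtain S where S: "finite S" "S \<subseteq> carrier (X i)"
    "\<And>x. x \<in> carrier (X i) \<Longrightarrow>
      \<exists>y\<in>carrier (X (i + 1)). (x \<ominus>\<^bsub>X i\<^esub> h (d i x)) \<ominus>\<^bsub>X i\<^esub> d (i + 1) y \<in> gensub i S"
    using homotopy_step[OF h T] by blast
  have \<phi>: "(\<lambda>x. x \<ominus>\<^bsub>X i\<^esub> h (d i x)) \<in> module_homs R (X i) (X i)"
    by (rule module_homs_diff[OF module_X module_X module_homs_id module_homs_compose[OF d_hom h]])
  \<comment> \<open>Projectivity of X_i turns the elementwise choice of \<open>y\<close> into a
    linear map, the next homotopy.\<close>
  have "\<exists>k\<in>module_homs R (X i) (X (i + 1)). \<forall>x\<in>carrier (X i).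
      (x \<ominus>\<^bsub>X i\<^esub> h (d i x)) \<ominus>\<^bsub>X i\<^esub> d (i + 1) (k x) \<in> gensub i S"
    by (rule projective_lift_modulo[OF projective module_X module_X \<phi> d_hom_Suc
          generated_submodule_is_submodule[OF module_X S(2)]]) (rule S(3))
  then obtain k where k: "k \<in> module_homs R (X i) (X (i + 1))"
    "\<And>x. x \<in> carrier (X i) \<Longrightarrow> (x \<ominus>\<^bsub>X i\<^esub> h (d i x)) \<ominus>\<^bsub>X i\<^esub> d (i + 1) (k x) \<in> gensub i S" by blast
  \<comment> \<open>On boundaries the term h d vanishes, and the estimate in degree i becomes the
    one required for i + 1.\<close>
  have "d (i + 1) y \<ominus>\<^bsub>X i\<^esub> d (i + 1) (k (d (i + 1) y)) \<in> gensub i S" if y: "y \<in> carrier (X (i + 1))" for y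
  proof -
    have dy: "d (i + 1) y \<in> carrier (X i)" using module_homsD(1)[OF d_hom_Suc y] .
    have "h (d i (d (i + 1) y)) = \<zero>\<^bsub>X i\<^esub>" using d_d_Suc[OF y] module_homs_zero[OF module_X module_X h] by simp
    then show ?thesis using k(2)[OF dy] module_minus_zero[OF module_X dy] by simp
  qed
  then show ?case using k(1) S(1,2) by (intro bexI[of _ k] exI[of _ S]) auto
qed

text \<open>Since X_(c+1) = 0, the map 1 - h d itself has image in a finitely generated submodule of
  X_c, and on that submodule a map r0 with r0 d = 1 exists. Then \<rho> = h + r0 (1 - d h) satisfies
  \<rho> d = h d + r0 d (1 - h d) = 1.\<close>

lemma top_differential_retraction:
  assumes r: "cohomological_depth R\<^sub>m {\<zero>} r" and e: "cohomological_depth M {\<zero>\<^bsub>M\<^esub>} e" and lt: "r - e < c - s"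
  shows "\<exists>\<rho>\<in>module_homs R (X (c - 1)) (X c). \<forall>x\<in>carrier (X c). \<rho> (d c x) = x"
proof -
  interpret Xc: module R "X c" by (rule module_X)
  interpret Xc': module R "X (c - 1)" by (rule module_X)
  have "l \<le> c" using l_le_s s_le_c by linarith
  then obtain h T where h: "h \<in> module_homs R (X (c - 1)) (X c)" and T: "finite T" "T \<subseteq> carrier (X (c - 1))"
    "\<And>y. y \<in> carrier (X c) \<Longrightarrow> d c y \<ominus>\<^bsub>X (c - 1)\<^esub> d c (h (d c y)) \<in> gensub (c - 1) T"
    using finite_homotopy[of c] by blast
  obtain S where S: "finite S" "S \<subseteq> carrier (X c)"
    "\<And>x. x \<in> carrier (X c) \<Longrightarrow>
      \<exists>y\<in>carrier (X (c + 1)). (x \<ominus>\<^bsub>X c\<^esub> h (d c x)) \<ominus>\<^bsub>X c\<^esub> d (c + 1) y \<in> gensub c S"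
    using homotopy_step[OF h T] by blast
  have hd: "h (d c x) \<in> carrier (X c)" if "x \<in> carrier (X c)" for x
    using module_homsD(1)[OF h module_homsD(1)[OF d_hom that]] .
  have fin: "x \<ominus>\<^bsub>X c\<^esub> h (d c x) \<in> gensub c S" if x: "x \<in> carrier (X c)" for x
  proof -
    obtain y where y: "y \<in> carrier (X (c + 1))" "(x \<ominus>\<^bsub>X c\<^esub> h (d c x)) \<ominus>\<^bsub>X c\<^esub> d (c + 1) y \<in> gensub c S"
      using S(3)[OF x] by blast
    have "y = \<zero>\<^bsub>X (c + 1)\<^esub>" using y(1) zero_X(1)[OF above[of "c + 1"]] by simp
    then have "d (c + 1) y = \<zero>\<^bsub>X c\<^esub>" using module_homs_zero[OF module_X module_X d_hom_Suc] by simp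
    moreover have "(x \<ominus>\<^bsub>X c\<^esub> h (d c x)) \<ominus>\<^bsub>X c\<^esub> \<zero>\<^bsub>X c\<^esub> = x \<ominus>\<^bsub>X c\<^esub> h (d c x)"
      by (rule module_minus_zero[OF module_X]) (use x hd[OF x] in auto)
    ultimately show ?thesis using y(2) by simp
  qed
  have "\<exists>r0\<in>module_homs R (X (c - 1)) (X c). \<forall>x\<in>S. r0 (d c x) = x"
    by (rule retraction_on_finite_set[OF projective module_X d_hom _ S(1,2)])
      (rule top_differential_unit_functional[OF r e lt])
  then obtain r0 where r0: "r0 \<in> module_homs R (X (c - 1)) (X c)" "\<And>x. x \<in> S \<Longrightarrow> r0 (d c x) = x" by blast
  have r0d: "(\<lambda>x. r0 (d c x) \<ominus>\<^bsub>X c\<^esub> x) \<in> module_homs R (X c) (X c)"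
    by (rule module_homs_diff[OF module_X module_X module_homs_compose[OF d_hom r0(1)] module_homs_id])
  have "S \<subseteq> {x \<in> carrier (X c). r0 (d c x) \<ominus>\<^bsub>X c\<^esub> x \<in> {\<zero>\<^bsub>X c\<^esub>}}"
    using S(2) r0(2) by (auto simp: a_minus_def Xc.r_neg)
  then have "gensub c S \<subseteq> {x \<in> carrier (X c). r0 (d c x) \<ominus>\<^bsub>X c\<^esub> x \<in> {\<zero>\<^bsub>X c\<^esub>}}"
    by (rule generated_submodule_minimal[OF submodule_vimage[OF module_X module_X r0d submodule_zero[OF module_X]]])
  then have r0s: "r0 (d c x) = x" if "x \<in> gensub c S" for x
  proof -
    have x: "x \<in> carrier (X c)" "r0 (d c x) \<ominus>\<^bsub>X c\<^esub> x = \<zero>\<^bsub>X c\<^esub>"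
      using \<open>gensub c S \<subseteq> _\<close> that by auto
    have rc: "r0 (d c x) \<in> carrier (X c)" using module_homsD(1)[OF r0(1) module_homsD(1)[OF d_hom x(1)]] .
    have "r0 (d c x) = (r0 (d c x) \<ominus>\<^bsub>X c\<^esub> x) \<oplus>\<^bsub>X c\<^esub> x" using rc x(1) by (simp add: a_minus_def Xc.a_assoc Xc.l_neg)
    then show ?thesis unfolding x(2) using x(1) by simp
  qed
  define \<rho> where "\<rho> w = h w \<oplus>\<^bsub>X c\<^esub> r0 (w \<ominus>\<^bsub>X (c - 1)\<^esub> d c (h w))" for w
  have \<rho>: "\<rho> \<in> module_homs R (X (c - 1)) (X c)"
    unfolding \<rho>_def
    by (rule module_homs_add[OF module_X module_X h module_homs_compose[OF module_homs_diff[OF module_X module_X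
        module_homs_id module_homs_compose[OF h d_hom]] r0(1)]])
  have "\<rho> (d c x) = x" if x: "x \<in> carrier (X c)" for x
  proof -
    have "d c x \<ominus>\<^bsub>X (c - 1)\<^esub> d c (h (d c x)) = d c (x \<ominus>\<^bsub>X c\<^esub> h (d c x))"
      using module_homs_minus[OF module_X module_X d_hom x hd[OF x]] by simp
    then have "\<rho> (d c x) = h (d c x) \<oplus>\<^bsub>X c\<^esub> (x \<ominus>\<^bsub>X c\<^esub> h (d c x))"
      unfolding \<rho>_def using r0s[OF fin[OF x]] by simp
    then show ?thesis
      using x hd[OF x] Xc.a_comm[of "h (d c x)" "x \<ominus>\<^bsub>X c\<^esub> h (d c x)"] by (simp add: a_minus_def Xc.a_assoc Xc.l_neg)
  qed
  then show ?thesis using \<rho> by blast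
qed

text \<open>X_(c-1) is the direct sum of d X_c and the kernel of \<rho>, so X_c and d X_c form a
  contractible summand. Dropping it shrinks carriers and leaves operations and differential as they
  are.\<close>

lemma trimmed_complex:
  assumes \<rho>: "\<rho> \<in> module_homs R (X (c - 1)) (X c)" "\<And>x. x \<in> carrier (X c) \<Longrightarrow> \<rho> (d c x) = x"
  shows "\<exists>P' :: ('a, 'p) complex_data. power_homology_complex R xs P' M a l (c - 1) s"
proof -
  interpret Xc: module R "X c" by (rule module_X)
  interpret Xc': module R "X (c - 1)" by (rule module_X)
  \<comment> \<open>The retraction makes d_c injective, so there is no homology in degree c.\<close>
  have "s < c"
  proof (rule ccontr)
    assume "\<not> s < c"
    then have sc: "s = c" using s_le_c by simp
    have "z \<in> B c" if "z \<in> Z c" for z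
    proof -
      have "z = \<rho> \<zero>\<^bsub>X (c - 1)\<^esub>" using \<rho>(2)[of z] that unfolding Z_iff by simp
      then have "z = \<zero>\<^bsub>X c\<^esub>" using module_homs_zero[OF module_X module_X \<rho>(1)] by simp
      then show ?thesis using submoduleD(2)[OF module_X submodule_B] by simp
    qed
    then have "Z c = B c" using B_subset_Z by auto
    then show False using Z_eq_B_iff top_homology(1) sc by simp
  qed
  then have ac: "a c = 0" using top_homology(2) by simp
  define K where "K = {y \<in> carrier (X (c - 1)). \<rho> y \<in> {\<zero>\<^bsub>X c\<^esub>}}"
  have K: "submodule K R (X (c - 1))"
    unfolding K_def by (rule submodule_vimage[OF module_X module_X \<rho>(1) submodule_zero[OF module_X]])
  \<comment> \<open>The projection of X_(c-1) onto \<open>K\<close> along d X_c. It moves elements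
    by boundaries, so it changes neither their differential nor the homology class of a
    cycle.\<close>
  define \<kappa> where "\<kappa> y = y \<ominus>\<^bsub>X (c - 1)\<^esub> d c (\<rho> y)" for y
  have \<kappa>: "\<kappa> \<in> module_homs R (X (c - 1)) (X (c - 1))"
    unfolding \<kappa>_def by (rule module_homs_diff[OF module_X module_X module_homs_id module_homs_compose[OF \<rho>(1) d_hom]])
  have d\<rho>: "d c (\<rho> y) \<in> carrier (X (c - 1))" "\<rho> y \<in> carrier (X c)" if "y \<in> carrier (X (c - 1))" for y
    using module_homsD(1)[OF d_hom module_homsD(1)[OF \<rho>(1) that]] module_homsD(1)[OF \<rho>(1) that] by auto
  have \<kappa>K: "\<kappa> y \<in> K" if y: "y \<in> carrier (X (c - 1))" for y
  proof -
    have "\<rho> (\<kappa> y) = \<rho> y \<ominus>\<^bsub>X c\<^esub> \<rho> (d c (\<rho> y))"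
      unfolding \<kappa>_def by (rule module_homs_minus[OF module_X module_X \<rho>(1) y d\<rho>(1)[OF y]])
    also have "\<dots> = \<zero>\<^bsub>X c\<^esub>" using \<rho>(2)[OF d\<rho>(2)[OF y]] d\<rho>(2)[OF y] by (simp add: a_minus_def Xc.r_neg)
    finally show ?thesis unfolding K_def using module_homsD(1)[OF \<kappa> y] by simp
  qed
  have \<kappa>id: "\<kappa> y = y" if "y \<in> K" for y
    using that module_homs_zero[OF module_X module_X d_hom, of c] module_minus_zero[OF module_X, of y]
    unfolding K_def \<kappa>_def by simp
  have d\<kappa>: "d (c - 1) (\<kappa> y) = d (c - 1) y" if y: "y \<in> carrier (X (c - 1))" for y
  proof -
    have "d (c - 1) (\<kappa> y) = d (c - 1) y \<ominus>\<^bsub>X (c - 1 - 1)\<^esub> d (c - 1) (d c (\<rho> y))"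
      unfolding \<kappa>_def by (rule module_homs_minus[OF module_X module_X d_hom y d\<rho>(1)[OF y]])
    also have "d (c - 1) (d c (\<rho> y)) = \<zero>\<^bsub>X (c - 1 - 1)\<^esub>" by (rule d_d[OF d\<rho>(2)[OF y]])
    finally show ?thesis
      unfolding module_minus_zero[OF module_X module_homsD(1)[OF d_hom y]] .
  qed
  define Y where "Y i = (if i = c then {\<zero>\<^bsub>X c\<^esub>} else if i = c - 1 then K else carrier (X i))" for i
  have Y: "submodule (Y i) R (X i)" for i
    unfolding Y_def using K submodule_zero[OF module_X] submodule_carrier[OF module_X] by auto
  note Yc = submoduleD(1)[OF module_X Y]
  have dY: "d i y \<in> Y (i - 1)" if y: "y \<in> Y i" for i y
  proof (cases "i = c")
    case True
    then have "y = \<zero>\<^bsub>X c\<^esub>" using y unfolding Y_def by simp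
    then have "d i y = \<zero>\<^bsub>X (i - 1)\<^esub>" using module_homs_zero[OF module_X module_X d_hom] True by simp
    then show ?thesis using submoduleD(2)[OF module_X Y] by simp
  next
    case False
    show ?thesis
    proof (cases "i = c + 1")
      case True
      then have "y = \<zero>\<^bsub>X i\<^esub>" using Yc[OF y] zero_X(1)[OF above[of i]] by simp
      then have "d i y = \<zero>\<^bsub>X (i - 1)\<^esub>" using module_homs_zero[OF module_X module_X d_hom] by simp
      then show ?thesis using submoduleD(2)[OF module_X Y] by simp
    next
      case False
      then show ?thesis using \<open>i \<noteq> c\<close> module_homsD(1)[OF d_hom Yc[OF y]] unfolding Y_def by auto
    qed
  qed
  define P' :: "('a, 'p) complex_data" where "P' = \<lparr>obj = (\<lambda>i. (X i)\<lparr>carrier := Y i\<rparr>), differential = d\<rparr>"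
  have P': "obj P' i = (X i)\<lparr>carrier := Y i\<rparr>" "differential P' = d" for i unfolding P'_def by auto
  have complex': "is_complex R P'"
    unfolding is_complex_def P'
  proof (intro conjI allI ballI)
    show "module R ((X i)\<lparr>carrier := Y i\<rparr>)" for i by (rule submodule.submodule_is_module[OF Y module_X])
    show "d i \<in> module_homs R ((X i)\<lparr>carrier := Y i\<rparr>) ((X (i - 1))\<lparr>carrier := Y (i - 1)\<rparr>)" for i
      using dY Yc module_homsD(2,3)[OF d_hom] by (intro module_homsI) auto
    show "d i (d (i + 1) x) = \<zero>\<^bsub>(X (i - 1))\<lparr>carrier := Y (i - 1)\<rparr>\<^esub>"
      if "x \<in> carrier ((X (i + 1))\<lparr>carrier := Y (i + 1)\<rparr>)" for i x
      using d_d_Suc[of x i] Yc that by simp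
  qed
  interpret P': koszul_complex R xs P' by unfold_locales (rule complex')
  have Z': "P'.Z q = Z q \<inter> Y q" for q
    using P'.Z_iff[of _ q] Z_iff[of _ q] Yc unfolding P' by auto
  have B': "P'.B q = d (q + 1) ` Y (q + 1)" for q unfolding P'.B_def P' by simp
  have B'_iff: "z \<in> P'.B q \<longleftrightarrow> z \<in> B q" if z: "z \<in> Z q" "z \<in> Y q" for z q
  proof
    show "z \<in> P'.B q \<Longrightarrow> z \<in> B q" unfolding B' B_def using Yc by auto
    assume zB: "z \<in> B q"
    have zero: "\<zero>\<^bsub>X q\<^esub> \<in> P'.B q" using submoduleD(2)[OF P'.module_X P'.submodule_B, of q] unfolding P' by simp
    \<comment> \<open>Boundaries are affected in degree c - 1, where the lost d X_c meets
      \<open>K\<close> in zero, and possibly in degree c - 2, where d X_(c-1) = d K because d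
      \<kappa> = d.\<close>
    consider "q = c" | "q = c - 1" | "q = c - 1 - 1" | "q + 1 \<noteq> c" "q + 1 \<noteq> c - 1" "q \<noteq> c"
      by linarith
    then show "z \<in> P'.B q"
    proof cases
      case 1
      then show ?thesis using z(2) zero unfolding Y_def by simp
    next
      case 2
      obtain x where x: "x \<in> carrier (X c)" "z = d c x" using zB 2 unfolding B_def by auto
      have "\<rho> z = \<zero>\<^bsub>X c\<^esub>" using z(2) 2 unfolding Y_def K_def by simp
      then have "x = \<zero>\<^bsub>X c\<^esub>" using \<rho>(2)[OF x(1)] x(2) by simp
      then have "z = \<zero>\<^bsub>X q\<^esub>" using x(2) 2 module_homs_zero[OF module_X module_X d_hom] by simp
      then show ?thesis using zero by simp
    next
      case 3
      have q1: "q + 1 = c - 1" using 3 by simp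
      obtain y where y: "y \<in> carrier (X (c - 1))" "z = d (c - 1) y" using zB unfolding B_def q1 by auto
      then have "z = d (c - 1) (\<kappa> y)" using d\<kappa> by simp
      then show ?thesis unfolding B' q1 Y_def using \<kappa>K[OF y(1)] by auto
    next
      case 4
      then show ?thesis using zB unfolding B' B_def Y_def by auto
    qed
  qed
  have coords': "\<exists>\<theta>. power_coordinates R ((obj P' q)\<lparr>carrier := P'.Z q\<rparr>) (P'.B q) M (a q) \<theta>" for q
  proof -
    obtain \<theta> where \<theta>: "power_coordinates R ((X q)\<lparr>carrier := Z q\<rparr>) (B q) M (a q) \<theta>"
      using coordinates_ZB by blast
    note t = power_coordinatesD[OF \<theta>, simplified]
    have "power_coordinates R ((obj P' q)\<lparr>carrier := P'.Z q\<rparr>) (P'.B q) M (a q) \<theta>"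
      unfolding power_coordinates_def
    proof (intro conjI allI impI ballI)
      show "\<theta> i \<in> module_homs R ((obj P' q)\<lparr>carrier := P'.Z q\<rparr>) M" if "i < a q" for i
        unfolding P' Z' using module_homsD[OF t(1)[OF that]] by (intro module_homsI) auto
      show "(\<forall>i<a q. \<theta> i z = \<zero>\<^bsub>M\<^esub>) \<longleftrightarrow> z \<in> P'.B q"
        if "z \<in> carrier ((obj P' q)\<lparr>carrier := P'.Z q\<rparr>)" for z
        using that t(3)[of z] B'_iff[of z q] unfolding Z' by simp
      fix m assume m: "\<forall>i<a q. m i \<in> carrier M"
      then obtain z where z: "z \<in> Z q" "\<forall>i<a q. \<theta> i z = m i" using t(2)[of m] by auto
      \<comment> \<open>The old coordinates still attain all values if each old cycle has a
        counterpart in the smaller complex with the same coordinates. In degree c - 1 this is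
        \<open>\<kappa> z\<close>, in degree c there are no coordinates since a c = 0.\<close>
      have "\<exists>z'\<in>Z q \<inter> Y q. \<forall>i<a q. \<theta> i z' = \<theta> i z"
      proof -
        consider "q = c" | "q = c - 1" | "q \<noteq> c" "q \<noteq> c - 1" by blast
        then show ?thesis
        proof cases
          case 1
          then show ?thesis
            using ac submoduleD(2)[OF module_X submodule_Z, of q] submoduleD(2)[OF module_X Y, of q] by auto
        next
          case 2
          have zc: "z \<in> carrier (X (c - 1))" using z(1) 2 unfolding Z_iff by simp
          have "\<kappa> z \<in> Z q" unfolding 2 Z_iff using d\<kappa>[OF zc] module_homsD(1)[OF \<kappa> zc] z(1) 2 unfolding Z_iff by simp
          moreover have "\<kappa> z \<in> Y q" unfolding 2 Y_def using \<kappa>K[OF zc] by simp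
          moreover have "\<theta> i (\<kappa> z) = \<theta> i z" if i: "i < a q" for i
          proof -
            interpret M: module R M by (rule M)
            have dB: "d c (\<rho> z) \<in> B q" unfolding B_def 2 using d\<rho>(2)[OF zc] by auto
            then have dZ: "d c (\<rho> z) \<in> Z q" using B_subset_Z by auto
            have "z = \<kappa> z \<oplus>\<^bsub>X q\<^esub> d c (\<rho> z)"
              unfolding \<kappa>_def 2 using zc d\<rho>(1)[OF zc] by (simp add: a_minus_def Xc'.a_assoc Xc'.l_neg)
            then have "\<theta> i z = \<theta> i (\<kappa> z) \<oplus>\<^bsub>M\<^esub> \<theta> i (d c (\<rho> z))"
              using module_homsD(2)[OF t(1)[OF i], of "\<kappa> z" "d c (\<rho> z)"] \<open>\<kappa> z \<in> Z q\<close> dZ by simp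
            moreover have "\<theta> i (d c (\<rho> z)) = \<zero>\<^bsub>M\<^esub>" using t(3)[OF dZ] dB i by simp
            moreover have "\<theta> i (\<kappa> z) \<in> carrier M" using module_homsD(1)[OF t(1)[OF i], of "\<kappa> z"] \<open>\<kappa> z \<in> Z q\<close> by simp
            ultimately show ?thesis by simp
          qed
          ultimately show ?thesis by blast
        next
          case 3
          then have "z \<in> Z q \<inter> Y q" using z(1) Z_iff[of z q] unfolding Y_def by simp
          then show ?thesis by blast
        qed
      qed
      then show "\<exists>z\<in>carrier ((obj P' q)\<lparr>carrier := P'.Z q\<rparr>). \<forall>i<a q. \<theta> i z = m i"
        using z(2) unfolding Z' by auto
    qed
    then show ?thesis by blast
  qed
  have projective': "projective_module R (obj P' i)" for i
  proof -
    consider "i = c" | "i = c - 1" | "i \<noteq> c" "i \<noteq> c - 1" by blast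
    then show ?thesis
    proof cases
      case 1
      show ?thesis
        unfolding P' 1 by (rule projective_summand[OF projective Y module_homs_const_zero[OF module_X]]) (auto simp: Y_def)
    next
      case 2
      show ?thesis
        unfolding P' 2 by (rule projective_summand[OF projective Y \<kappa>]) (auto simp: Y_def \<kappa>K \<kappa>id)
    next
      case 3
      then show ?thesis unfolding P' Y_def using projective by simp
    qed
  qed
  have above': "zero_module (obj P' i)" if "i > c - 1" for i
    using that above[of i] unfolding P' zero_module_def Y_def by (cases "i = c") auto
  have below': "zero_module (obj P' i)" if "i < l" for i
  proof -
    have "carrier (X i) = {\<zero>\<^bsub>X i\<^esub>}" by (rule zero_X(1)[OF below[OF that]])
    moreover have "Y i \<subseteq> carrier (X i)" by (rule subsetI) (rule Yc)
    moreover have "\<zero>\<^bsub>X i\<^esub> \<in> Y i" by (rule submoduleD(2)[OF module_X Y])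
    ultimately have "Y i = {\<zero>\<^bsub>X i\<^esub>}" by blast
    then show ?thesis unfolding P' zero_module_def by simp
  qed
  have "power_homology_complex R xs P' M a l (c - 1) s"
    by (intro power_homology_complex.intro power_homology_complex_axioms.intro P'.koszul_complex_axioms
        projective' M M_fg M_nonzero above' below' coords' top_homology)
  then show ?thesis by blast
qed

end

section \<open>The Auslander-Buchsbaum formula\<close>

lemma Sup_ereal_int:
  fixes I :: "int set"
  assumes "I \<noteq> {}" "\<And>i. i \<in> I \<Longrightarrow> i \<le> u"
  obtains c where "c \<in> I" "\<And>i. i \<in> I \<Longrightarrow> i \<le> c" "Sup {ereal (real_of_int i) | i. i \<in> I} = ereal (real_of_int c)"
proof -
  obtain i0 where i0: "i0 \<in> I" using assms(1) by auto
  define J where "J = {i \<in> I. i0 \<le> i}"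
  have J: "finite J" "J \<noteq> {}"
    unfolding J_def using i0 assms(2) by (auto intro: finite_subset[of _ "{i0..u}"])
  have c: "Max J \<in> I" using Max_in[OF J] unfolding J_def by simp
  have max: "i \<le> Max J" if i: "i \<in> I" for i
  proof (cases "i0 \<le> i")
    case True
    then show ?thesis using Max_ge[OF J(1)] i unfolding J_def by simp
  next
    case False
    then show ?thesis using Max_in[OF J] unfolding J_def by simp
  qed
  have "Sup {ereal (real_of_int i) | i. i \<in> I} = ereal (real_of_int (Max J))"
    by (rule Sup_eqI) (use c max in auto)
  with c max show thesis by (rule that)
qed

lemma (in koszul_complex) homology_eq:
  "homology P q = quotient_module ((X q)\<lparr>carrier := Z q\<rparr>) (B q)"
  unfolding homology_def Z_def B_def ..

lemma (in koszul_complex) zero_homology_iff: "zero_module (homology P q) \<longleftrightarrow> Z q = B q"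
  unfolding homology_eq
  using zero_module_quotient_iff[OF submodule.submodule_is_module[OF submodule_Z module_X]
      submodule_restrict[OF module_X submodule_Z submodule_B B_subset_Z]]
  by auto

context power_homology_complex
begin

text \<open>As \<open>c\<close> is a mere bound, the first comparison is an inequality; together
  they bound csup P - hsup P from above by c - s.\<close>

lemma finite_resolution:
  "finite_quasi_projective_resolution R M P" "csup P \<le> ereal (real_of_int c)" "ereal (real_of_int s) \<le> hsup P"
proof -
  have iso: "module_iso R (homology P i) (direct_power M (a i))" for i
  proof -
    obtain \<theta> where "power_coordinates R ((X i)\<lparr>carrier := Z i\<rparr>) (B i) M (a i) \<theta>"
      using coordinates_ZB by blast
    then show ?thesis
      unfolding homology_eq
      by (rule iso_of_power_coordinates[OF submodule.submodule_is_module[OF submodule_Z module_X]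
            submodule_restrict[OF module_X submodule_Z submodule_B B_subset_Z] M])
  qed
  have Xs: "\<not> zero_module (X s)" using zero_X(2)[of s] Z_eq_B_iff[of s] top_homology(1) by auto
  then have "cinf P \<le> ereal (real_of_int s)"
    unfolding cinf_def by (intro Inf_lower) blast
  then have "quasi_projective_resolution R M P"
    unfolding quasi_projective_resolution_def bounded_below_def
    using complex projective below iso top_homology(1) by (intro conjI exI[of _ a] exI[of _ l] exI[of _ s]) auto
  then show "finite_quasi_projective_resolution R M P"
    unfolding finite_quasi_projective_resolution_def bounded_above_def using above by blast
  show "csup P \<le> ereal (real_of_int c)"
    unfolding csup_def using above by (intro Sup_least) (auto simp: not_less[symmetric])
  have "\<not> zero_module (homology P s)" using zero_homology_iff Z_eq_B_iff top_homology(1) by simp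
  then show "ereal (real_of_int s) \<le> hsup P"
    unfolding hsup_def by (intro Sup_upper) blast
qed

end

lemma (in koszul_local_ring) finite_resolution_data:
  fixes P :: "('a, 'p) complex_data"
  assumes M: "module R M" and fg: "finitely_generated R M" and nz: "\<not> zero_module M"
    and P: "finite_quasi_projective_resolution R M P"
  obtains a l c s where "power_homology_complex R xs P M a l c s"
    "csup P = ereal (real_of_int c)" "hsup P = ereal (real_of_int s)"
proof -
  have qp: "quasi_projective_resolution R M P" and ba: "bounded_above P"
    using P unfolding finite_quasi_projective_resolution_def by auto
  have complex: "is_complex R P" and bb: "bounded_below P" and proj: "\<And>i. projective_module R (obj P i)"
    using qp unfolding quasi_projective_resolution_def by auto
  obtain a0 i0 where iso: "\<And>i. cinf P \<le> ereal (real_of_int i) \<Longrightarrow> module_iso R (homology P i) (direct_power M (a0 i))"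
    and i0: "cinf P \<le> ereal (real_of_int i0)" "a0 i0 \<noteq> 0"
    using qp unfolding quasi_projective_resolution_def by blast
  obtain l where l: "\<And>i. i < l \<Longrightarrow> zero_module (obj P i)" using bb unfolding bounded_below_def by auto
  obtain u where u: "\<And>i. i > u \<Longrightarrow> zero_module (obj P i)" using ba unfolding bounded_above_def by auto
  interpret K: koszul_complex R xs P by unfold_locales (rule complex)
  \<comment> \<open>A resolution prescribes its exponents from cinf P on. Below that degree the
    complex is zero, and the value 0 describes its homology.\<close>
  define a where "a i = (if cinf P \<le> ereal (real_of_int i) then a0 i else 0)" for i
  have coords: "\<exists>\<theta>. power_coordinates R ((K.X q)\<lparr>carrier := K.Z q\<rparr>) (K.B q) M (a q) \<theta>" for q
  proof (cases "cinf P \<le> ereal (real_of_int q)")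
    case True
    then show ?thesis
      using power_coordinates_of_iso[OF submodule.submodule_is_module[OF K.submodule_Z K.module_X]
          submodule_restrict[OF K.module_X K.submodule_Z K.submodule_B K.B_subset_Z] M] iso[OF True]
      unfolding K.homology_eq a_def by simp
  next
    case False
    have "zero_module (obj P q)"
    proof (rule ccontr)
      assume "\<not> zero_module (obj P q)"
      then have "cinf P \<le> ereal (real_of_int q)" unfolding cinf_def by (intro Inf_lower) blast
      then show False using False by simp
    qed
    then have "K.Z q = K.B q" by (rule K.zero_X(2))
    then show ?thesis
      using False by (intro exI[of _ "\<lambda>_ _. \<zero>\<^bsub>M\<^esub>"]) (use submoduleD(2)[OF K.module_X K.submodule_B, of q] in \<open>auto simp: power_coordinates_def a_def\<close>)
  qed
  have ZB: "K.Z q = K.B q \<longleftrightarrow> a q = 0" for q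
    using coords[of q] K.Z_eq_B_iff_of_coordinates[OF M nz] by blast
  define I where "I = {i. \<not> zero_module (obj P i)}"
  define J where "J = {i. \<not> zero_module (homology P i)}"
  have J: "i \<in> J \<longleftrightarrow> a i \<noteq> 0" for i unfolding J_def using K.zero_homology_iff ZB by simp
  have JI: "i \<in> I" if "i \<in> J" for i using that K.zero_X(2)[of i] K.zero_homology_iff unfolding I_def J_def by auto
  have Iu: "i \<le> u" if "i \<in> I" for i using that u[of i] unfolding I_def by force
  have "i0 \<in> J" using J i0 unfolding a_def by simp
  then have ne: "J \<noteq> {}" "I \<noteq> {}" using JI by auto
  obtain c where c: "c \<in> I" "\<And>i. i \<in> I \<Longrightarrow> i \<le> c" "Sup {ereal (real_of_int i) | i. i \<in> I} = ereal (real_of_int c)"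
    using Sup_ereal_int[OF ne(2) Iu] by blast
  obtain s where s: "s \<in> J" "\<And>i. i \<in> J \<Longrightarrow> i \<le> s" "Sup {ereal (real_of_int i) | i. i \<in> J} = ereal (real_of_int s)"
    using Sup_ereal_int[OF ne(1) Iu[OF JI]] by blast
  have above: "zero_module (obj P i)" if "i > c" for i using c(2)[of i] that unfolding I_def by auto
  have top: "a i = 0" if "i > s" for i using s(2)[of i] that J[of i] by auto
  have s0: "a s \<noteq> 0" using s(1) J by simp
  have "power_homology_complex R xs P M a l c s"
    by (intro power_homology_complex.intro power_homology_complex_axioms.intro K.koszul_complex_axioms
        proj M fg nz above l coords s0 top)
  moreover have "csup P = ereal (real_of_int c)" using c(3) unfolding csup_def I_def by simp
  moreover have "hsup P = ereal (real_of_int s)" using s(3) unfolding hsup_def J_def by simp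
  ultimately show thesis by (rule that)
qed

lemma (in koszul_local_ring) not_zero_ring_as_module: "\<not> zero_module R\<^sub>m"
proof
  assume "zero_module R\<^sub>m"
  then have "\<one> = \<zero>" unfolding zero_module_def using one_closed by auto
  then show False using one_notin_max_ideal mm.zero_closed by simp
qed

theorem theorem1p1:
  fixes R :: "('a, 'r) ring_scheme" and M :: "('a, 'b, 'd) module_scheme"
  assumes "noetherian_ring R" and "local_ring R"
    and "module R M" and "finitely_generated R M"
    and "qpd R M TYPE('p) < \<infinity>"
  shows "qpd R M TYPE('p) = depth R (ring_as_module R) - depth R M"
proof -
  interpret noetherian_local_ring R by (rule noetherian_local_ring.intro[OF assms(1,2)])
  obtain A where A: "A \<subseteq> carrier R" "finite A" "\<mm> = Idl\<^bsub>R\<^esub> A"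
    using finetely_gen[OF mm.ideal_axioms] by blast
  obtain xs where xs: "set xs = A" using finite_list[OF A(2)] by blast
  interpret koszul_local_ring R xs
    by (intro koszul_local_ring.intro koszul_local_ring_axioms.intro noetherian_local_ring_axioms)
      (use A xs in auto)
  note M = assms(3) and fg = assms(4)
  obtain r where r: "cohomological_depth R\<^sub>m {\<zero>\<^bsub>R\<^esub>} (int r)" "depth R R\<^sub>m = ereal (real r)"
    using depth_eq_cohomological_depth[OF module_ring_as_module finitely_generated_ring_as_module not_zero_ring_as_module]
    by auto
  show ?thesis
  proof (cases "zero_module M")
    case True
    \<comment> \<open>Both sides are -\<infinity>: the depth of R is finite and that of the zero
      module is \<infinity>.\<close>
    then show ?thesis unfolding r(2) by (simp add: qpd_def depth_def)
  next
    case False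
    obtain e where e: "cohomological_depth M {\<zero>\<^bsub>M\<^esub>} (int e)" "depth R M = ereal (real e)"
      using depth_eq_cohomological_depth[OF M fg False] by auto
    define S where "S = {csup P - hsup P | P :: ('a, 'p) complex_data. finite_quasi_projective_resolution R M P}"
    have qpd: "qpd R M TYPE('p) = Inf S" unfolding qpd_def S_def using False by simp
    \<comment> \<open>The infimum of the empty set would be \<infinity>.\<close>
    then have "S \<noteq> {}" using assms(5) by (auto simp: top_ereal_def)
    then obtain P0 :: "('a, 'p) complex_data" where P0: "finite_quasi_projective_resolution R M P0"
      unfolding S_def by auto
    \<comment> \<open>The difference c - s is minimized over all complexes with all bounds c for
      them. Trimming lowers c by one with s fixed, so it contradicts minimality even where the new
      top module is zero.\<close>
    define L where "L n \<longleftrightarrow> (\<exists>(P :: ('a, 'p) complex_data) a l c s. power_homology_complex R xs P M a l c s \<and> n = nat (c - s))" for n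
    have L0: "\<exists>n. L n" unfolding L_def using finite_resolution_data[OF M fg False P0] by metis
    define n where "n = (LEAST n. L n)"
    have "L n" unfolding n_def using L0 by (rule LeastI_ex)
    then obtain P :: "('a, 'p) complex_data" and a l c s where P: "power_homology_complex R xs P M a l c s" "n = nat (c - s)"
      unfolding L_def by blast
    interpret P: power_homology_complex R xs P M a l c s by (rule P(1))
    have len: "c - s \<le> int r - int e"
    proof (rule ccontr)
      assume "\<not> c - s \<le> int r - int e"
      then have "int r - int e < c - s" by simp
      from P.top_differential_retraction[OF r(1) e(1) this] obtain P' :: "('a, 'p) complex_data" where
        P': "power_homology_complex R xs P' M a l (c - 1) s"
        using P.trimmed_complex by blast
      \<comment> \<open>This keeps the truncation of differences at 0 from hiding the
        decrease.\<close>
      then have "s \<le> c - 1" by (rule power_homology_complex.s_le_c)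
      then have "nat (c - 1 - s) < n" unfolding P(2) by simp
      moreover have "L (nat (c - 1 - s))" unfolding L_def using P' by blast
      ultimately show False using not_less_Least[of _ L] unfolding n_def by blast
    qed
    have "Inf S = ereal (real r) - ereal (real e)"
    proof (rule antisym)
      have "csup P - hsup P \<le> ereal (real_of_int c) - ereal (real_of_int s)"
        by (rule ereal_minus_mono[OF P.finite_resolution(2,3)])
      also have "\<dots> \<le> ereal (real r) - ereal (real e)" using len by simp
      finally have "csup P - hsup P \<le> ereal (real r) - ereal (real e)" .
      moreover have "csup P - hsup P \<in> S" unfolding S_def using P.finite_resolution(1) by blast
      ultimately show "Inf S \<le> ereal (real r) - ereal (real e)" by (rule Inf_lower2[rotated])
    next
      show "ereal (real r) - ereal (real e) \<le> Inf S"
      proof (rule Inf_greatest)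
        fix t assume "t \<in> S"
        then obtain Q :: "('a, 'p) complex_data" where Q: "finite_quasi_projective_resolution R M Q" "t = csup Q - hsup Q"
          unfolding S_def by blast
        obtain a' l' c' s' where Q': "power_homology_complex R xs Q M a' l' c' s'"
          "csup Q = ereal (real_of_int c')" "hsup Q = ereal (real_of_int s')"
          using finite_resolution_data[OF M fg False Q(1)] by blast
        have "int r - int e \<le> c' - s'" by (rule power_homology_complex.length_lower_bound[OF Q'(1) r(1) e(1)])
        then show "ereal (real r) - ereal (real e) \<le> t" unfolding Q(2) Q'(2,3) by simp
      qed
    qed
    then show ?thesis unfolding qpd r(2) e(2) .
  qed
qed

end
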